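(* Let $1<p<\infty$, $0<q,r\le\infty$, and $k\in\mathbb N$. There are positive constants $C_0,C_1,C_2$, independent of $f$ and $\varepsilon$, such that, as $\varepsilon\to0+$ (i.e. for all sufficiently small $\varepsilon>0$), $$\|f^{\#}\|_{L_{d/\varepsilon,r}(\mathbb R^d)}\le C_0\,\varepsilon^{-1/r}\|f\|_{\dot B^{d/p-\varepsilon}_rL_{p,q}(\mathbb R^d);k}\qquad\text{if }k>d/p,$$ $$\|f^{\#}\|_{L_{d/\varepsilon,r}(\mathbb R^d)}\le C_1\|f\|_{\dot B^{d/p-\varepsilon}_rL_{p,q}(\mathbb R^d);k}\qquad\text{if }k=d/p.$$ The corresponding estimate for a cube $Q_0\subset\mathbb R^d$ is $$\|f^{\#}_{Q_0}\|_{L_{d/\varepsilon,r}(Q_0)}\le C_2\,\varepsilon^{-1/r}\|f\|_{B^{d/p-\varepsilon}_rL_{p,q}(Q_0);k},\qquad\varepsilon\to0+,\qquad\text{if }k\ge d/p.$$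
   Context: Cubes have sides parallel to the axes; Lebesgue measure $|\cdot|_d$ is used. $f^*(t)=\inf\{\lambda\ge0:|\{|f|>\lambda\}|_d\le t\}$. $f^{\#}(x)=\sup_{Q\ni x}\frac1{|Q|_d}\int_Q|f-f_Q|$, $f_Q=\frac1{|Q|_d}\int_Qf$; $f^{\#}_{Q_0}$ is defined for $x\in Q_0$ likewise with cubes $Q\subset Q_0$ containing $x$. Lorentz quasi-norms: $\|g\|_{L_{p,q}(\mathbb R^d)}=\big(\int_0^\infty(t^{1/p}g^*(t))^q\frac{dt}t\big)^{1/q}$ (supremum if $q=\infty$), and on $Q_0$ the integral is over $(0,1)$. With $\Delta_hf(x)=f(x+h)-f(x)$, $\Delta_h^k=\Delta_h\Delta_h^{k-1}$: on $\mathbb R^d$, $\omega_k(f,t)_{p,q}=\sup_{|h|\le t}\|\Delta_h^kf\|_{L_{p,q}(\mathbb R^d)}$; on $Q_0$, $\omega_k(f,t)_{p,q}=\sup_{|h|\le t}\|\Delta_h^kf\|_{L_{p,q}(Q_{kh})}$, $Q_{kh}=\{x:x,\,x+kh\in Q_0\}$. For $s>0$, $\dot B^s_rL_{p,q}(\mathbb R^d)$ is the completion of $C_0^\infty(\mathbb R^d)$ with respect to $$\|f\|_{\dot B^s_rL_{p,q}(\mathbb R^d);k}=\Big(\int_0^\infty(t^{-s}\omega_k(f,t)_{p,q})^r\frac{dt}t\Big)^{1/r},$$ and $B^s_rL_{p,q}(Q_0)$ consists of $f\in L_{p,q}(Q_0)$ with finite $$\|f\|_{B^s_rL_{p,q}(Q_0);k}=\|f\|_{L_{p,q}(Q_0)}+\Big(\int_0^1(t^{-s}\omega_k(f,t)_{p,q})^r\frac{dt}t\Big)^{1/r}$$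 (usual modifications if $r=\infty$). *)

theory Defs
  imports "HOL-Analysis.Analysis"
begin

text \<open>
  Euclidean space of dimension \<open>d\<close> is a type of class \<^class>\<open>euclidean_space\<close> with
  \<open>d = DIM('a)\<close>; the coordinate axes are those spanned by \<^const>\<open>Basis\<close>. Functions are real-valued
  and everything that may be infinite lives in \<^typ>\<open>ennreal\<close>. The secondary indices \<open>q\<close>, \<open>r\<close>
  are extended nonnegative reals, \<open>\<infinity>\<close> being allowed.
\<close>

text \<open>Intended for exponents \<open>a > 0\<close> only.\<close>

definition epowr :: "ennreal \<Rightarrow> real \<Rightarrow> ennreal" where
  "epowr x a = (if x = \<infinity> then \<infinity> else ennreal (enn2real x powr a))"

text \<open>The \<open>L\<^sub>q\<close> quasi-norm on \<open>I\<close> for the measure \<open>dt/t\<close>, with the supremum for \<open>q = \<infinity>\<close>.\<close>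

definition Lq_dtt :: "real set \<Rightarrow> ennreal \<Rightarrow> (real \<Rightarrow> ennreal) \<Rightarrow> ennreal" where
  "Lq_dtt I q u =
     (if q = \<infinity> then (SUP t\<in>I. u t)
      else epowr (\<integral>\<^sup>+t\<in>I. (epowr (u t) (enn2real q) * ennreal (1 / t)) \<partial>lborel) (1 / enn2real q))"

section \<open>Rearrangements and Lorentz quasi-norms\<close>

text \<open>
  The levels may be infinite here; this does not change the infimum, since \<open>Inf {} = \<infinity>\<close>.
  The completed measure is used because the level sets of the sharp maximal function are unions
  of closed cubes.
\<close>

definition rearrangement :: "'a::euclidean_space set \<Rightarrow> ('a \<Rightarrow> ennreal) \<Rightarrow> real \<Rightarrow> ennreal" where
  "rearrangement \<Omega> g t = Inf {l::ennreal. emeasure lebesgue {x\<in>\<Omega>. g x > l} \<le> ennreal t}"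

text \<open>The range \<open>I\<close> of integration is \<open>(0,\<infinity>)\<close> on the whole space and \<open>(0,1)\<close> on subsets of a cube.\<close>

definition lorentz_norm ::
  "'a::euclidean_space set \<Rightarrow> real set \<Rightarrow> real \<Rightarrow> ennreal \<Rightarrow> ('a \<Rightarrow> ennreal) \<Rightarrow> ennreal" where
  "lorentz_norm \<Omega> I p q g = Lq_dtt I q (\<lambda>t. ennreal (t powr (1 / p)) * rearrangement \<Omega> g t)"

section \<open>The sharp maximal function\<close>

definition cubes :: "'a::euclidean_space set set" where
  "cubes = {cbox a (a + l *\<^sub>R (\<Sum>Basis)) | a l. l > 0}"

definition average :: "('a::euclidean_space \<Rightarrow> real) \<Rightarrow> 'a set \<Rightarrow> real" where
  "average f Q = set_lebesgue_integral lebesgue Q f / measure lebesgue Q"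

text \<open>\<open>\<Omega> = UNIV\<close> gives the sharp maximal function on the whole space.\<close>

definition sharp :: "'a::euclidean_space set \<Rightarrow> ('a \<Rightarrow> real) \<Rightarrow> 'a \<Rightarrow> ennreal" where
  "sharp \<Omega> f x =
     (SUP Q\<in>{Q\<in>cubes. x \<in> Q \<and> Q \<subseteq> \<Omega>}.
        (\<integral>\<^sup>+y\<in>Q. ennreal \<bar>f y - average f Q\<bar> \<partial>lebesgue) / emeasure lebesgue Q)"

section \<open>Moduli of smoothness\<close>

definition fdiff :: "'a::euclidean_space \<Rightarrow> ('a \<Rightarrow> real) \<Rightarrow> 'a \<Rightarrow> real" where
  "fdiff h f x = f (x + h) - f x"

definition modulus ::
  "'a::euclidean_space set \<Rightarrow> real set \<Rightarrow> nat \<Rightarrow> real \<Rightarrow> ennreal \<Rightarrow> ('a \<Rightarrow> real) \<Rightarrow> real \<Rightarrow> ennreal" where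
  "modulus \<Omega> I k p q f t =
     (SUP h\<in>{h. norm h \<le> t}.
        lorentz_norm {x. x \<in> \<Omega> \<and> x + real k *\<^sub>R h \<in> \<Omega>} I p q (\<lambda>x. ennreal \<bar>(fdiff h ^^ k) f x\<bar>))"

section \<open>Test functions\<close>

primrec C_k :: "nat \<Rightarrow> ('a::euclidean_space \<Rightarrow> real) \<Rightarrow> bool" where
  "C_k 0 f \<longleftrightarrow> continuous_on UNIV f"
| "C_k (Suc n) f \<longleftrightarrow> (\<forall>x. f differentiable (at x)) \<and>
     (\<forall>b\<in>Basis. C_k n (\<lambda>x. frechet_derivative f (at x) b))"

definition test_functions :: "('a::euclidean_space \<Rightarrow> real) set" where
  "test_functions = {f. (\<forall>n. C_k n f) \<and> compact (closure {x. f x \<noteq> 0})}"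

section \<open>Besov spaces\<close>

definition hom_besov_norm ::
  "real \<Rightarrow> ennreal \<Rightarrow> real \<Rightarrow> ennreal \<Rightarrow> nat \<Rightarrow> ('a::euclidean_space \<Rightarrow> real) \<Rightarrow> ennreal" where
  "hom_besov_norm s r p q k f =
     Lq_dtt {0<..} r (\<lambda>t. ennreal (t powr (- s)) * modulus UNIV {0<..} k p q f t)"

text \<open>
  The completion of the test functions, realised as a space of locally integrable functions: its
  elements are the local \<open>L\<^sub>1\<close> limits of sequences of test functions that are Cauchy for the
  Besov quasi-norm. A limit in the Besov quasi-norm itself would not determine \<open>f\<close>, because
  the quasi-norm vanishes on polynomials of degree less than \<open>k\<close>.
\<close>

definition hom_besov ::
  "real \<Rightarrow> ennreal \<Rightarrow> real \<Rightarrow> ennreal \<Rightarrow> nat \<Rightarrow> ('a::euclidean_space \<Rightarrow> real) set" where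
  "hom_besov s r p q k =
     {f \<in> borel_measurable lebesgue.
        \<exists>\<phi>::nat \<Rightarrow> 'a \<Rightarrow> real.
          (\<forall>n. \<phi> n \<in> test_functions) \<and>
          (\<forall>e>0. \<exists>N. \<forall>m\<ge>N. \<forall>n\<ge>N. hom_besov_norm s r p q k (\<lambda>x. \<phi> m x - \<phi> n x) < e) \<and>
          (\<forall>K. compact K \<longrightarrow> (\<lambda>n. \<integral>\<^sup>+x\<in>K. ennreal \<bar>\<phi> n x - f x\<bar> \<partial>lebesgue) \<longlonglongrightarrow> 0)}"

definition besov_norm ::
  "'a::euclidean_space set \<Rightarrow> real \<Rightarrow> ennreal \<Rightarrow> real \<Rightarrow> ennreal \<Rightarrow> nat \<Rightarrow> ('a \<Rightarrow> real) \<Rightarrow> ennreal" where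
  "besov_norm Q\<^sub>0 s r p q k f =
     lorentz_norm Q\<^sub>0 {0<..<1} p q (\<lambda>x. ennreal \<bar>f x\<bar>) +
     Lq_dtt {0<..<1} r (\<lambda>t. ennreal (t powr (- s)) * modulus Q\<^sub>0 {0<..<1} k p q f t)"

definition besov ::
  "'a::euclidean_space set \<Rightarrow> real \<Rightarrow> ennreal \<Rightarrow> real \<Rightarrow> ennreal \<Rightarrow> nat \<Rightarrow> ('a \<Rightarrow> real) set" where
  "besov Q\<^sub>0 s r p q k = {f \<in> borel_measurable (lebesgue_on Q\<^sub>0). besov_norm Q\<^sub>0 s r p q k f < \<infinity>}"

end

theory Submission
  imports Defs
begin

text \<open>
  Write \<open>\<omega>(u)\<close> for the modulus of order \<open>k\<close> in \<open>L\<^sub>p\<^sub>,\<^sub>q\<close>. Everything follows from the estimate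
  \<open>(f\<^sup>#)\<^sup>*(t\<^sup>d) \<le> C sup\<^bsub>u \<ge> t\<^esub> u\<^bsup>-d/p\<^esup> \<omega>(u)\<close> and its analogue on a cube, because a Hardy inequality (Tonelli's theorem
  with the kernel \<open>u \<ge> t\<close>) turns the supremum into the Besov quasi-norm at the cost of \<open>\<epsilon>\<^bsup>-1/r\<^esup>\<close>; if
  \<open>k = d/p\<close>, then \<open>u\<^bsup>-k\<^esup> \<omega>(u)\<close> is almost decreasing and no supremum is needed.

  Embedding \<open>L\<^sub>p\<^sub>,\<^sub>q\<close> in weak \<open>L\<^sub>p\<close>, only the bounds of \<open>\<integral>\<^sub>E |\<Delta>\<^sub>h\<^sup>k f|\<close> by \<open>\<omega>(|h|) |E|\<^bsup>1-1/p\<^esup>\<close> matter. On a cube \<open>Q\<close> of side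
  \<open>l\<close>, a Lipschitz smoothing \<open>K f\<close> built from \<open>f(x + jh)\<close>, \<open>1 \<le> j \<le> k\<close>, differs from \<open>f\<close> by an average of
  \<open>k\<close>-th differences and has a Lipschitz constant controlled by the mean oscillation of \<open>f\<close> on \<open>Q\<close> divided
  by \<open>l\<close>. Hence the oscillation on a subcube of side \<open>l/N\<close> is at most \<open>C l\<^bsup>-d/p\<^esup> \<omega>(l) + (C'/N) osc(f, Q)\<close>; with
  \<open>N\<close> large this iterates over growing cubes and bounds the oscillation on all cubes of side at least \<open>t\<close>. On
  smaller cubes one subtracts a smoothing at scale \<open>t\<close> and applies the weak-type inequality for the
  maximal function to the remainder.
\<close>

section \<open>Cubes and mean oscillation\<close>

text \<open>For \<open>k \<ge> 2\<close> differences alone cannot control oscillation, because they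
  vanish on polynomials of degree below \<open>k\<close>. The iteration over growing cubes therefore
  ends with the oscillation on the last cube. On a cube this term is bounded by the norm of
  \<open>f\<close>. On the whole space it tends to 0 because \<open>f\<close> is a limit of test
  functions: the differences between late approximants and a fixed one have oscillation
  O(l^{-\<epsilon>}) on cubes of side l, uniformly. The loss \<epsilon>^{-1/r} is the r-th root of
  1/a with a = \<epsilon> r/d, coming from \<integral> t^{a-1} dt over (0, u^d) after the supremum
  has been dominated by a tail integral; an integral over a window [v, 2v] costs only a constant.
  The level sets of the sharp function are enclosed in Borel sets of measure at most t^d exactly;
  every constant of the weak-type inequality is moved into the level. The Lorentz norm on a cube
  sees only t < 1, although the cube may have larger measure; this is why the weak bounds are used
  only up to a fraction \<open>c\<close> of the measure of a set.\<close>

definition cube :: "'a::euclidean_space \<Rightarrow> real \<Rightarrow> 'a set" where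
  "cube a l = cbox a (a + l *\<^sub>R (\<Sum>Basis))"

lemma sum_Basis_inner: "b \<in> Basis \<Longrightarrow> (\<Sum>Basis) \<bullet> b = (1::real)"
  for b :: "'a::euclidean_space"
  by (simp add: inner_sum_left inner_Basis)

lemma mem_cube: "x \<in> cube a l \<longleftrightarrow> (\<forall>b\<in>Basis. a \<bullet> b \<le> x \<bullet> b \<and> x \<bullet> b \<le> a \<bullet> b + l)"
  by (simp add: cube_def mem_box inner_add_left sum_Basis_inner)

lemma cubes_eq: "cubes = {cube a l | a l. l > 0}"
  by (simp add: cubes_def cube_def)

lemma cube_borel [measurable, simp]: "cube a l \<in> sets borel"
  by (simp add: cube_def)

lemma emeasure_cube: "0 \<le> l \<Longrightarrow> emeasure lborel (cube a l) = ennreal (l ^ DIM('a))"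
  for a :: "'a::euclidean_space"
  unfolding cube_def
  by (subst emeasure_lborel_cbox) (auto simp: inner_add_left sum_Basis_inner inner_diff_left)

lemma emeasure_cube_lebesgue: "0 \<le> l \<Longrightarrow> emeasure lebesgue (cube a l) = ennreal (l ^ DIM('a))"
  for a :: "'a::euclidean_space"
  using emeasure_cube[of l a] by simp

lemma measure_cube: "0 \<le> l \<Longrightarrow> measure lborel (cube a l) = l ^ DIM('a)"
  for a :: "'a::euclidean_space"
  by (simp add: measure_def emeasure_cube)

lemma convex_cube: "convex (cube a l)"
  by (simp add: cube_def)

lemma dist_cube:
  fixes x y :: "'a::euclidean_space"
  assumes "x \<in> cube a l" "y \<in> cube a l"
  shows "norm (x - y) \<le> real DIM('a) * l"
proof -
  have "norm (x - y) \<le> (\<Sum>b\<in>Basis. \<bar>(x - y) \<bullet> b\<bar>)" by (rule norm_le_l1)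
  also have "\<dots> \<le> (\<Sum>b\<in>(Basis::'a set). l)"
    by (rule sum_mono) (use assms in \<open>force simp: mem_cube inner_diff_left abs_le_iff\<close>)
  finally show ?thesis by simp
qed

text \<open>The side \<open>l'\<close> either leaves room \<rho> on both sides of the small cube or
  is the full side \<open>L\<close>, and then the big cube itself will do. Used with \<rho> = 0 to
  pass to a cube \<open>N\<close> times larger, and with \<rho> = \<open>t\<close> to catch all
  points that a smoothing at scale \<open>t\<close> reaches.\<close>

lemma cube_extend:
  fixes a a0 :: "'a::euclidean_space"
  assumes sub: "cube a l \<subseteq> cube a0 L" and l: "0 \<le> l" and l': "l' \<le> L" "l + 2 * \<rho> \<le> l' \<or> l' = L"
  obtains a' where "cube a' l' \<subseteq> cube a0 L"
    "\<And>x y. x \<in> cube a l \<Longrightarrow> y \<in> cube a0 L \<Longrightarrow> (\<And>b. b \<in> Basis \<Longrightarrow> \<bar>y \<bullet> b - x \<bullet> b\<bar> \<le> \<rho>) \<Longrightarrow> y \<in> cube a' l'"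
proof (cases "l' = L")
  case True
  show ?thesis by (rule that[of a0]) (auto simp: True)
next
  case False
  \<comment> \<open>In each coordinate the upper face is put \<rho> beyond that of the small cube;
    the lower face is then at least \<rho> below, since \<open>l + 2 * \<rho> \<le> l'\<close>. The
    result is pushed back into the big cube, and a face that moves inward lands on a face of the big
    cube.\<close>
  define v :: 'a where "v = (\<Sum>b\<in>Basis. min (max (a0 \<bullet> b) (a \<bullet> b + l + \<rho> - l')) (a0 \<bullet> b + L - l') *\<^sub>R b)"
  have v: "v \<bullet> b = min (max (a0 \<bullet> b) (a \<bullet> b + l + \<rho> - l')) (a0 \<bullet> b + L - l')" if "b \<in> Basis" for b
    using that by (simp add: v_def)
  show ?thesis
  proof (rule that[of v])
    show "cube v l' \<subseteq> cube a0 L"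
    proof
      fix x assume x: "x \<in> cube v l'"
      show "x \<in> cube a0 L"
        unfolding mem_cube
      proof
        fix b :: 'a assume b: "b \<in> Basis"
        have "v \<bullet> b \<le> x \<bullet> b" "x \<bullet> b \<le> v \<bullet> b + l'" using x b by (auto simp: mem_cube)
        moreover have "a0 \<bullet> b \<le> v \<bullet> b" "v \<bullet> b \<le> a0 \<bullet> b + L - l'"
          unfolding v[OF b] using \<open>l' \<le> L\<close> by simp_all
        ultimately show "a0 \<bullet> b \<le> x \<bullet> b \<and> x \<bullet> b \<le> a0 \<bullet> b + L" by linarith
      qed
    qed
    fix x y assume x: "x \<in> cube a l" and y: "y \<in> cube a0 L"
      and xy: "\<And>b. b \<in> Basis \<Longrightarrow> \<bar>y \<bullet> b - x \<bullet> b\<bar> \<le> \<rho>"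
    have "l + 2 * \<rho> \<le> l'" using False l' by simp
    show "y \<in> cube v l'"
      unfolding mem_cube
    proof
      fix b :: 'a assume b: "b \<in> Basis"
      have "a0 \<bullet> b \<le> y \<bullet> b \<and> y \<bullet> b \<le> a0 \<bullet> b + L" using y b by (auto simp: mem_cube)
      moreover have "a \<bullet> b \<le> x \<bullet> b \<and> x \<bullet> b \<le> a \<bullet> b + l" using x b by (auto simp: mem_cube)
      moreover have "\<bar>y \<bullet> b - x \<bullet> b\<bar> \<le> \<rho>" using xy b by auto
      ultimately show "v \<bullet> b \<le> y \<bullet> b \<and> y \<bullet> b \<le> v \<bullet> b + l'"
        using \<open>l + 2 * \<rho> \<le> l'\<close> \<open>l' \<le> L\<close> unfolding v[OF b] by (smt (verit))
    qed
  qed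
qed

definition mean_osc :: "('a::euclidean_space \<Rightarrow> real) \<Rightarrow> 'a set \<Rightarrow> ennreal" where
  "mean_osc f Q = (\<integral>\<^sup>+y\<in>Q. ennreal \<bar>f y - average f Q\<bar> \<partial>lebesgue) / emeasure lebesgue Q"

lemma sharp_eq: "sharp \<Omega> f x = (SUP Q\<in>{Q\<in>cubes. x \<in> Q \<and> Q \<subseteq> \<Omega>}. mean_osc f Q)"
  by (simp add: sharp_def mean_osc_def)

text \<open>The mean is optimal up to a factor 2: |f_Q - c| |Q| is at most the integral of |f - c|
  over Q. The free constant \<open>c\<close> will be a value of a smoothing of
  \<open>f\<close>.\<close>

lemma mean_osc_le:
  fixes f :: "'a::euclidean_space \<Rightarrow> real"
  assumes f: "integrable lborel f" and l: "0 < l"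
  shows "mean_osc f (cube a l) \<le> 2 * (\<integral>\<^sup>+y\<in>cube a l. ennreal \<bar>f y - c\<bar> \<partial>lborel) / ennreal (l ^ DIM('a))"
proof -
  define Q where "Q = cube a l"
  define \<mu> where "\<mu> = l ^ DIM('a)"
  have \<mu>: "0 < \<mu>" "emeasure lborel Q = ennreal \<mu>" "measure lborel Q = \<mu>" and Q[measurable]: "Q \<in> sets borel"
    using l by (auto simp: \<mu>_def Q_def emeasure_cube measure_cube)
  have fm[measurable]: "f \<in> borel_measurable borel" using f by auto
  define J where "J = (\<integral>\<^sup>+y\<in>Q. ennreal \<bar>f y - c\<bar> \<partial>lborel)"
  have i1: "integrable lborel (\<lambda>y. indicator Q y *\<^sub>R f y)"
    using f by (intro integrable_mult_indicator) auto
  have i2: "integrable lborel (\<lambda>y. indicator Q y *\<^sub>R c)"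
    using \<mu> by (simp add: integrable_indicator_iff)
  have av: "average f Q * \<mu> = (LINT y|lborel. indicator Q y *\<^sub>R f y)"
    using \<mu> i1 by (simp add: average_def set_lebesgue_integral_def integral_completion borel_measurable_integrable)
  have diff: "(LINT y|lborel. indicator Q y *\<^sub>R (f y - c)) = average f Q * \<mu> - c * \<mu>"
    "integrable lborel (\<lambda>y. indicator Q y *\<^sub>R (f y - c))"
    unfolding av scaleR_diff_right using Bochner_Integration.integral_diff[OF i1 i2] Bochner_Integration.integrable_diff[OF i1 i2] \<mu>
    by (simp_all add: mult.commute)
  have "\<bar>average f Q - c\<bar> * \<mu> = \<bar>LINT y|lborel. indicator Q y *\<^sub>R (f y - c)\<bar>"
  proof -
    have "(LINT y|lborel. indicator Q y *\<^sub>R (f y - c)) = average f Q * \<mu> - c * \<mu>" by (rule diff(1))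
    also have "\<dots> = (average f Q - c) * \<mu>" by (simp add: algebra_simps)
    finally show ?thesis using \<mu> by (simp add: abs_mult)
  qed
  also have "ennreal \<dots> \<le> (\<integral>\<^sup>+y. ennreal (norm (indicator Q y *\<^sub>R (f y - c))) \<partial>lborel)"
    using integral_norm_bound_ennreal[OF diff(2)] by simp
  also have "\<dots> = J" unfolding J_def
    by (intro nn_integral_cong) (auto simp: indicator_def)
  finally have b: "ennreal (\<bar>average f Q - c\<bar> * \<mu>) \<le> J" .
  have "(\<integral>\<^sup>+y\<in>Q. ennreal \<bar>f y - average f Q\<bar> \<partial>lebesgue) = (\<integral>\<^sup>+y\<in>Q. ennreal \<bar>f y - average f Q\<bar> \<partial>lborel)"
    by (rule nn_integral_completion)
  also have "\<dots> \<le> (\<integral>\<^sup>+y. ennreal \<bar>f y - c\<bar> * indicator Q y + ennreal \<bar>average f Q - c\<bar> * indicator Q y \<partial>lborel)"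
    by (intro nn_integral_mono) (auto simp: indicator_def ennreal_plus[symmetric] ennreal_leI simp del: ennreal_plus intro!: ennreal_leI)
  also have "\<dots> = J + ennreal \<bar>average f Q - c\<bar> * emeasure lborel Q"
    unfolding J_def by (subst nn_integral_add) (auto simp: nn_integral_cmult_indicator)
  also have "\<dots> = J + ennreal (\<bar>average f Q - c\<bar> * \<mu>)" using \<mu> by (simp add: ennreal_mult)
  also have "\<dots> \<le> 2 * J" using b by (simp add: mult_2)
  finally show ?thesis
    unfolding mean_osc_def J_def[symmetric] Q_def[symmetric] \<mu>_def[symmetric]
    using \<mu> by (simp add: divide_right_mono_ennreal)
qed

lemma nn_integral_cube_average:
  fixes f :: "'a::euclidean_space \<Rightarrow> real"
  assumes l: "0 < l"
  shows "(\<integral>\<^sup>+y\<in>cube a l. ennreal \<bar>f y - average f (cube a l)\<bar> \<partial>lborel) = mean_osc f (cube a l) * ennreal (l ^ DIM('a))"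
proof -
  have "(\<integral>\<^sup>+y\<in>cube a l. ennreal \<bar>f y - average f (cube a l)\<bar> \<partial>lebesgue) = (\<integral>\<^sup>+y\<in>cube a l. ennreal \<bar>f y - average f (cube a l)\<bar> \<partial>lborel)"
    by (rule nn_integral_completion)
  moreover have "ennreal (l ^ DIM('a)) \<noteq> 0" using l by simp
  ultimately show ?thesis using l
    unfolding mean_osc_def emeasure_cube_lebesgue[OF less_imp_le[OF l]]
    by (subst ennreal_divide_times) (simp add: ennreal_divide_self)
qed

text \<open>The mean over the larger cube is an admissible constant in \<open>mean_osc_le\<close>;
  what remains is the ratio of the volumes.\<close>

lemma mean_osc_mono:
  fixes f :: "'a::euclidean_space \<Rightarrow> real"
  assumes f: "integrable lborel f" and l: "0 < l" and l': "0 < l'" and sub: "cube a l \<subseteq> cube a' l'"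
  shows "mean_osc f (cube a l) \<le> ennreal (2 * (l' / l) ^ DIM('a)) * mean_osc f (cube a' l')"
proof -
  have "mean_osc f (cube a l) \<le> 2 * (\<integral>\<^sup>+y\<in>cube a l. ennreal \<bar>f y - average f (cube a' l')\<bar> \<partial>lborel) / ennreal (l ^ DIM('a))"
    by (rule mean_osc_le[OF f l])
  also have "\<dots> \<le> 2 * (\<integral>\<^sup>+y\<in>cube a' l'. ennreal \<bar>f y - average f (cube a' l')\<bar> \<partial>lborel) / ennreal (l ^ DIM('a))"
    by (intro divide_right_mono_ennreal mult_left_mono nn_integral_mono)
       (use sub in \<open>auto simp: indicator_def\<close>)
  also have "\<dots> = ennreal (2 * (l' / l) ^ DIM('a)) * mean_osc f (cube a' l')"
  proof -
    have "ennreal (2 * (l' / l) ^ DIM('a)) = 2 * ennreal ((l' / l) ^ DIM('a))"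
      using l l' by (subst ennreal_mult) auto
    also have "ennreal ((l' / l) ^ DIM('a)) = ennreal (l' ^ DIM('a)) / ennreal (l ^ DIM('a))"
      using l l' by (simp add: divide_ennreal power_divide)
    finally have "ennreal (2 * (l' / l) ^ DIM('a)) = 2 * (ennreal (l' ^ DIM('a)) / ennreal (l ^ DIM('a)))" .
    then show ?thesis
      unfolding nn_integral_cube_average[OF l'] divide_ennreal_def by (simp only: mult_ac)
  qed
  finally show ?thesis .
qed

section \<open>Smoothing inside a cube\<close>

lemma nn_integral_lborel_affine:
  fixes t :: "'a::euclidean_space"
  assumes [measurable]: "g \<in> borel_measurable borel" and c: "c \<noteq> 0"
  shows "(\<integral>\<^sup>+x. g x \<partial>lborel) = ennreal (\<bar>c\<bar> ^ DIM('a)) * (\<integral>\<^sup>+x. g (t + c *\<^sub>R x) \<partial>lborel)"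
  by (subst lborel_affine[OF c, of t])
     (simp add: nn_integral_density nn_integral_distr nn_integral_cmult)

lemma integrable_lborel_affine:
  fixes t :: "'a::euclidean_space" and g :: "'a \<Rightarrow> real"
  assumes g: "integrable lborel g" and c: "c \<noteq> 0"
  shows "integrable lborel (\<lambda>x. g (t + c *\<^sub>R x))"
proof -
  have [measurable]: "g \<in> borel_measurable borel" using g by auto
  show ?thesis
    using g c unfolding integrable_iff_bounded
    by (subst (asm) nn_integral_lborel_affine[where c=c and t=t]) (auto simp: ennreal_mult_less_top)
qed

lemma integral_lborel_affine:
  fixes t :: "'a::euclidean_space" and g :: "'a \<Rightarrow> real"
  assumes g: "integrable lborel g" and c: "c \<noteq> 0"
  shows "(\<integral>x. g x \<partial>lborel) = \<bar>c\<bar> ^ DIM('a) * (\<integral>x. g (t + c *\<^sub>R x) \<partial>lborel)"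
proof -
  have [measurable]: "g \<in> borel_measurable borel" using g by auto
  show ?thesis
    using integrable_lborel_affine[OF g c, of t]
    by (subst lborel_affine[OF c, of t]) (simp add: integral_density integral_distr)
qed

section \<open>Differences as linear combinations of translates\<close>

lemma fdiff_funpow_expand:
  "\<exists>c::nat \<Rightarrow> real. c 0 = (-1) ^ n \<and>
     (\<forall>(f::'a::euclidean_space \<Rightarrow> real) h x. (fdiff h ^^ n) f x = (\<Sum>j\<le>n. c j * f (x + real j *\<^sub>R h)))"
proof (induction n)
  case 0
  show ?case by (rule exI[of _ "\<lambda>_. 1"]) auto
next
  case (Suc n)
  then obtain c where c: "c 0 = (-1) ^ n"
    "\<And>(f::'a \<Rightarrow> real) h x. (fdiff h ^^ n) f x = (\<Sum>j\<le>n. c j * f (x + real j *\<^sub>R h))"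
    by blast
  \<comment> \<open>Pascal's rule: the shifted coefficients minus the old ones, padded by zeros at
    both ends.\<close>
  define e where "e j = (if j = 0 then 0 else c (j - 1)) - (if j \<le> n then c j else 0)" for j
  have "(fdiff h ^^ Suc n) f x = (\<Sum>j\<le>Suc n. e j * f (x + real j *\<^sub>R h))" for f :: "'a \<Rightarrow> real" and h x
  proof -
    have "(\<Sum>j\<le>Suc n. e j * f (x + real j *\<^sub>R h))
        = (\<Sum>j\<le>Suc n. (if j = 0 then 0 else c (j - 1)) * f (x + real j *\<^sub>R h))
          - (\<Sum>j\<le>Suc n. (if j \<le> n then c j else 0) * f (x + real j *\<^sub>R h))"
      by (simp add: e_def left_diff_distrib sum_subtractf del: sum.atMost_Suc)
    also have "(\<Sum>j\<le>Suc n. (if j = 0 then 0 else c (j - 1)) * f (x + real j *\<^sub>R h))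
        = (\<Sum>j\<le>n. c j * f (x + h + real j *\<^sub>R h))"
      by (subst sum.atMost_Suc_shift) (simp add: scaleR_add_left add_ac)
    also have "(\<Sum>j\<le>Suc n. (if j \<le> n then c j else 0) * f (x + real j *\<^sub>R h)) = (\<Sum>j\<le>n. c j * f (x + real j *\<^sub>R h))"
      by simp
    finally show ?thesis by (simp add: fdiff_def c(2))
  qed
  moreover have "e 0 = (-1) ^ Suc n" by (simp add: e_def c)
  ultimately show ?case by blast
qed

text \<open>The expansion solved for \<open>f x\<close>. The coefficients add up to 1 because the
  \<open>k\<close>-th difference of the constant 1 vanishes; this makes the smoothing reproduce
  constants.\<close>

lemma fdiff_funpow_coeffs:
  assumes "1 \<le> k"
  obtains b :: "nat \<Rightarrow> real" where "(\<Sum>j=1..k. b j) = 1"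
    "\<And>(f::'a::euclidean_space \<Rightarrow> real) h x.
       (fdiff h ^^ k) f x = (-1) ^ k * (f x - (\<Sum>j=1..k. b j * f (x + real j *\<^sub>R h)))"
proof -
  obtain c :: "nat \<Rightarrow> real" where c0: "c 0 = (-1) ^ k" and
    c: "\<And>(f::'a \<Rightarrow> real) h x. (fdiff h ^^ k) f x = (\<Sum>j\<le>k. c j * f (x + real j *\<^sub>R h))"
    using fdiff_funpow_expand[of k, where 'a='a] by blast
  define b where "b j = - ((-1) ^ k * c j)" for j
  have sq: "(-1) ^ k * ((-1) ^ k * y) = y" for y :: real
    by (cases "even k") auto
  have eq: "(fdiff h ^^ k) f x = (-1) ^ k * (f x - (\<Sum>j=1..k. b j * f (x + real j *\<^sub>R h)))"
    for f :: "'a \<Rightarrow> real" and h x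
  proof -
    have "(fdiff h ^^ k) f x = c 0 * f x + (\<Sum>j=1..k. c j * f (x + real j *\<^sub>R h))"
      unfolding c by (simp add: sum.atMost_shift sum.shift_bounds_cl_Suc_ivl atLeast0LessThan
          sum.atLeast1_atMost_eq)
    also have "(\<Sum>j=1..k. c j * f (x + real j *\<^sub>R h)) = (-1) ^ k * (- (\<Sum>j=1..k. b j * f (x + real j *\<^sub>R h)))"
      by (simp add: b_def sum_negf sum_distrib_left mult.assoc sq)
    finally show ?thesis by (simp add: c0 algebra_simps)
  qed
  have "(fdiff h ^^ k) (\<lambda>_::'a. 1) = (\<lambda>_. 0)" for h
    using assms
  proof (induction k)
    case (Suc n)
    show ?case
    proof (cases "n = 0")
      case True then show ?thesis by (simp add: fdiff_def fun_eq_iff)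
    next
      case False
      then show ?thesis using Suc by (simp add: fdiff_def fun_eq_iff)
    qed
  qed simp
  from fun_cong[OF this, of 0] eq[of 0 "\<lambda>_::'a. 1"] have "(\<Sum>j=1..k. b j) = 1" by simp
  with eq show thesis using that by blast
qed

text \<open>Joint measurability in point and step is what Tonelli's theorem asks for in
  \<open>smooth_error_integral\<close>.\<close>

lemma fdiff_funpow_measurable [measurable]:
  fixes f :: "'a::euclidean_space \<Rightarrow> real"
  assumes [measurable]: "f \<in> borel_measurable borel"
  shows "(\<lambda>x. (fdiff (snd x) ^^ n) f (fst x)) \<in> borel_measurable (borel \<Otimes>\<^sub>M borel)"
    and "(fdiff h ^^ n) f \<in> borel_measurable borel"
proof -
  obtain c :: "nat \<Rightarrow> real" where
    c: "\<And>(f::'a \<Rightarrow> real) h x. (fdiff h ^^ n) f x = (\<Sum>j\<le>n. c j * f (x + real j *\<^sub>R h))"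
    using fdiff_funpow_expand[of n, where 'a='a] by blast
  show "(\<lambda>x. (fdiff (snd x) ^^ n) f (fst x)) \<in> borel_measurable (borel \<Otimes>\<^sub>M borel)"
    unfolding c by measurable
  have "(fdiff h ^^ n) f = (\<lambda>x. \<Sum>j\<le>n. c j * f (x + real j *\<^sub>R h))"
    using c by (simp add: fun_eq_iff)
  also have "\<dots> \<in> borel_measurable borel" by measurable
  finally show "(fdiff h ^^ n) f \<in> borel_measurable borel" .
qed

text \<open>A cone of height 1 over the ball inscribed in the cube. The properties used are its
  Lipschitz constant 2/l, its support in the cube and a mass of order
  \<open>l ^ DIM('a)\<close>.\<close>

definition tent :: "'a::euclidean_space \<Rightarrow> real \<Rightarrow> 'a \<Rightarrow> real" where
  "tent a l x = max 0 (1 - 2 * norm (x - (a + (l / 2) *\<^sub>R (\<Sum>Basis))) / l)"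

definition tent_mass :: "'a::euclidean_space \<Rightarrow> real \<Rightarrow> real" where
  "tent_mass a l = (\<integral>x. tent a l x \<partial>lborel)"

lemma tent_measurable [measurable]: "tent a l \<in> borel_measurable borel"
  unfolding tent_def[abs_def] by measurable

lemma tent_nonneg: "0 \<le> tent a l x"
  by (simp add: tent_def)

lemma tent_le_1: "0 < l \<Longrightarrow> tent a l x \<le> 1"
  by (simp add: tent_def)

lemma tent_supp:
  assumes "0 < l" "tent a l x \<noteq> 0"
  shows "x \<in> cube a l"
proof -
  have n: "norm (x - (a + (l / 2) *\<^sub>R (\<Sum>Basis))) < l / 2"
    using assms by (auto simp: tent_def max_def field_simps split: if_splits)
  show ?thesis
    unfolding mem_cube
  proof
    fix b :: 'a assume b: "b \<in> Basis"
    have "\<bar>(x - (a + (l / 2) *\<^sub>R (\<Sum>Basis))) \<bullet> b\<bar> < l / 2"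
      using Basis_le_norm[OF b, of "x - (a + (l / 2) *\<^sub>R (\<Sum>Basis))"] n by linarith
    then show "a \<bullet> b \<le> x \<bullet> b \<and> x \<bullet> b \<le> a \<bullet> b + l"
      unfolding inner_diff_left inner_add_left inner_scaleR_left sum_Basis_inner[OF b] by linarith
  qed
qed

lemma tent_lipschitz:
  assumes l: "0 < l"
  shows "\<bar>tent a l x - tent a l y\<bar> \<le> 2 / l * norm (x - y)"
proof -
  define c where "c = a + (l / 2) *\<^sub>R (\<Sum>Basis)"
  have "\<bar>norm (x - c) - norm (y - c)\<bar> \<le> norm (x - y)"
    using norm_triangle_ineq3[of "x - c" "y - c"] by simp
  moreover have "2 * norm (x - c) / l - 2 * norm (y - c) / l = 2 / l * (norm (x - c) - norm (y - c))"
    by (simp add: right_diff_distrib)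
  ultimately have "\<bar>2 * norm (x - c) / l - 2 * norm (y - c) / l\<bar> \<le> 2 / l * norm (x - y)"
    using l by (simp add: abs_mult mult_left_mono divide_right_mono)
  then show ?thesis
    unfolding tent_def c_def[symmetric] by (auto simp: max_def)
qed

lemma integrable_tent: "0 < l \<Longrightarrow> integrable lborel (tent a l)"
proof -
  assume l: "0 < l"
  have "integrable lborel (indicator (cube a l) :: 'a \<Rightarrow> real)"
    using l by (simp add: integrable_indicator_iff emeasure_cube)
  moreover have "norm (tent a l x) \<le> norm (indicator (cube a l) x :: real)" for x
  proof (cases "tent a l x = 0")
    case False
    with tent_supp[OF l False] tent_nonneg[of a l x] tent_le_1[OF l, of a x] show ?thesis by simp
  qed simp
  ultimately show ?thesis
    by (intro Bochner_Integration.integrable_bound[of lborel "indicator (cube a l) :: 'a \<Rightarrow> real" "tent a l"] AE_I2) simp_all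
qed

text \<open>On the concentric cube of side m = l/(2d) the distance from the centre is at most d m/2
  = l/4, and there the cone has height at least 1/2.\<close>

lemma tent_mass_ge:
  fixes a :: "'a::euclidean_space"
  assumes l: "0 < l"
  shows "1 / 2 * (l / (2 * real DIM('a))) ^ DIM('a) \<le> tent_mass a l"
proof -
  define d where "d = real DIM('a)"
  have d: "1 \<le> d" by (simp add: d_def Suc_leI)
  define m where "m = l / (2 * d)"
  have m: "0 < m" using l d by (simp add: m_def)
  define c where "c = a + (l / 2) *\<^sub>R (\<Sum>Basis)"
  define Q where "Q = cube (c - (m / 2) *\<^sub>R (\<Sum>Basis)) m"
  have "indicator Q x * (1 / 2) \<le> tent a l x" for x
  proof (cases "x \<in> Q")
    case True
    have "norm (x - c) \<le> (\<Sum>b\<in>Basis. \<bar>(x - c) \<bullet> b\<bar>)" by (rule norm_le_l1)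
    also have "\<dots> \<le> (\<Sum>b\<in>(Basis::'a set). m / 2)"

    proof (rule sum_mono)
      fix b :: 'a assume b: "b \<in> Basis"
      have "c \<bullet> b - m / 2 \<le> x \<bullet> b \<and> x \<bullet> b \<le> c \<bullet> b - m / 2 + m"
        using True b unfolding Q_def mem_cube by (auto simp: inner_diff_left sum_Basis_inner)
      then show "\<bar>(x - c) \<bullet> b\<bar> \<le> m / 2" unfolding inner_diff_left by linarith
    qed
    also have "\<dots> = l / 4" using d by (simp add: d_def[symmetric] m_def)
    finally show ?thesis using True l by (simp add: tent_def c_def[symmetric] field_simps)
  qed (simp add: tent_nonneg)
  then have "(\<integral>x. indicator Q x * (1 / 2) \<partial>lborel) \<le> (\<integral>x. tent a l x \<partial>lborel)"
    using l m
    by (intro integral_mono integrable_tent integrable_mult_left)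
       (auto simp: integrable_indicator_iff Q_def emeasure_cube)
  also have "(\<integral>x. indicator Q x * (1 / 2) \<partial>lborel) = 1 / 2 * m ^ DIM('a)"
    using m by (simp add: Q_def measure_cube)
  finally show ?thesis by (simp add: m_def d_def tent_mass_def)
qed

lemma tent_mass_pos: "0 < l \<Longrightarrow> 0 < tent_mass (a::'a::euclidean_space) l"
  by (rule less_le_trans[OF _ tent_mass_ge]) auto

text \<open>
  The average, over the \<open>h\<close> for which \<open>x + \<rho> h\<close> lies in the cube, of a combination of the \<open>f(x + jh)\<close> that
  differs from \<open>f(x)\<close> by \<open>\<Delta>\<^sub>h\<^sup>k f(x)\<close> up to sign. Since \<open>h\<close> points towards a point of the cube, \<open>x + jh\<close> stays inside for
  \<open>j \<le> k \<le> \<rho>\<close>, so no extension of \<open>f\<close> is needed.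
\<close>

definition smooth ::
  "(nat \<Rightarrow> real) \<Rightarrow> nat \<Rightarrow> real \<Rightarrow> 'a::euclidean_space \<Rightarrow> real \<Rightarrow> ('a \<Rightarrow> real) \<Rightarrow> 'a \<Rightarrow> real" where
  "smooth b k \<rho> a l f x = \<rho> ^ DIM('a) / tent_mass a l *
     (\<Sum>j=1..k. b j * (\<integral>h. tent a l (x + \<rho> *\<^sub>R h) * f (x + real j *\<^sub>R h) \<partial>lborel))"

lemma integrable_tent_mult:
  fixes f :: "'a::euclidean_space \<Rightarrow> real"
  assumes l: "0 < l" and f: "integrable lborel f"
  shows "integrable lborel (\<lambda>h. tent a l (s + t *\<^sub>R h) * f h)"
  by (rule Bochner_Integration.integrable_bound[OF f])
     (use f tent_nonneg[of a l] tent_le_1[OF l, of a] in \<open>auto simp: abs_mult intro!: mult_left_le_one_le\<close>)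

lemma integral_tent_affine:
  fixes x :: "'a::euclidean_space"
  assumes l: "0 < l" and \<rho>: "0 < \<rho>"
  shows "\<rho> ^ DIM('a) * (\<integral>h. tent a l (x + \<rho> *\<^sub>R h) \<partial>lborel) = tent_mass a l"
  using integral_lborel_affine[OF integrable_tent[OF l, of a], of \<rho> x] \<rho> by (simp add: tent_mass_def)

text \<open>The kernel \<open>\<rho> ^ DIM('a) / tent_mass a l * tent a l (x + \<rho> *\<^sub>R
  h)\<close> has integral 1 in \<open>h\<close>, so \<open>f x\<close> is its own average against
  it. Subtracting the smoothing leaves the average of the \<open>k\<close>-th differences up to
  sign.\<close>

lemma smooth_error:
  fixes f :: "'a::euclidean_space \<Rightarrow> real"
  assumes l: "0 < l" and f: "integrable lborel f" and \<rho>: "0 < \<rho>"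
    and b: "\<And>(f::'a \<Rightarrow> real) h x. (fdiff h ^^ k) f x = (-1) ^ k * (f x - (\<Sum>j=1..k. b j * f (x + real j *\<^sub>R h)))"
  shows "ennreal \<bar>f x - smooth b k \<rho> a l f x\<bar>
    \<le> ennreal (\<rho> ^ DIM('a) / tent_mass a l) * (\<integral>\<^sup>+h. ennreal (tent a l (x + \<rho> *\<^sub>R h) * \<bar>(fdiff h ^^ k) f x\<bar>) \<partial>lborel)"
proof -
  define A where "A = \<rho> ^ DIM('a) / tent_mass a l"
  have A: "0 < A" using l \<rho> by (simp add: A_def tent_mass_pos)
  have fm[measurable]: "f \<in> borel_measurable borel" using f by auto
  have i1: "integrable lborel (\<lambda>h. tent a l (x + \<rho> *\<^sub>R h) * f x)"
    using integrable_lborel_affine[OF integrable_tent[OF l, of a], of \<rho> x] \<rho> by simp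
  have i2: "integrable lborel (\<lambda>h. b j * (tent a l (x + \<rho> *\<^sub>R h) * f (x + real j *\<^sub>R h)))" if "j \<in> {1..k}" for j
    using integrable_tent_mult[OF l integrable_lborel_affine[OF f, of "real j" x], of a x \<rho>] that by simp
  have sq: "(-1) ^ k * (t * ((-1) ^ k * y)) = t * y" for t y :: real
    by (cases "even k") auto
  have tent_fdiff: "(\<lambda>h. tent a l (x + \<rho> *\<^sub>R h) * f x -
        (\<Sum>j=1..k. b j * (tent a l (x + \<rho> *\<^sub>R h) * f (x + real j *\<^sub>R h))))
      = (\<lambda>h. (-1) ^ k * (tent a l (x + \<rho> *\<^sub>R h) * (fdiff h ^^ k) f x))"
    unfolding b sq by (simp add: fun_eq_iff right_diff_distrib sum_distrib_left mult.left_commute)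
  have "f x = A * (\<integral>h. tent a l (x + \<rho> *\<^sub>R h) \<partial>lborel) * f x"
    using integral_tent_affine[OF l \<rho>, of a x] tent_mass_pos[OF l, of a] by (simp add: A_def field_simps)
  then have "f x = A * (\<integral>h. tent a l (x + \<rho> *\<^sub>R h) * f x \<partial>lborel)"
    by simp
  moreover have "smooth b k \<rho> a l f x = A * (\<integral>h. (\<Sum>j=1..k. b j * (tent a l (x + \<rho> *\<^sub>R h) * f (x + real j *\<^sub>R h))) \<partial>lborel)"
    unfolding smooth_def A_def[symmetric] using i2
    by (subst Bochner_Integration.integral_sum) auto
  ultimately have "f x - smooth b k \<rho> a l f x = A * ((\<integral>h. tent a l (x + \<rho> *\<^sub>R h) * f x \<partial>lborel) -
        (\<integral>h. (\<Sum>j=1..k. b j * (tent a l (x + \<rho> *\<^sub>R h) * f (x + real j *\<^sub>R h))) \<partial>lborel))"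
    by (simp add: right_diff_distrib)
  also have "\<dots> = A * (\<integral>h. tent a l (x + \<rho> *\<^sub>R h) * f x -
        (\<Sum>j=1..k. b j * (tent a l (x + \<rho> *\<^sub>R h) * f (x + real j *\<^sub>R h))) \<partial>lborel)"
    by (subst Bochner_Integration.integral_diff[OF i1 Bochner_Integration.integrable_sum[OF i2]]) auto
  also note tent_fdiff
  finally have eq: "f x - smooth b k \<rho> a l f x
      = A * (\<integral>h. (-1) ^ k * (tent a l (x + \<rho> *\<^sub>R h) * (fdiff h ^^ k) f x) \<partial>lborel)" .
  have i3: "integrable lborel (\<lambda>h. (-1) ^ k * (tent a l (x + \<rho> *\<^sub>R h) * (fdiff h ^^ k) f x))"
    unfolding tent_fdiff[symmetric]
    by (rule Bochner_Integration.integrable_diff[OF i1 Bochner_Integration.integrable_sum[OF i2]])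
  have "ennreal \<bar>f x - smooth b k \<rho> a l f x\<bar> = ennreal A * ennreal (norm (\<integral>h. (-1) ^ k * (tent a l (x + \<rho> *\<^sub>R h) * (fdiff h ^^ k) f x) \<partial>lborel))"
    unfolding eq using A by (simp add: abs_mult ennreal_mult)
  also have "\<dots> \<le> ennreal A * (\<integral>\<^sup>+h. ennreal (norm ((-1) ^ k * (tent a l (x + \<rho> *\<^sub>R h) * (fdiff h ^^ k) f x))) \<partial>lborel)"
    by (intro mult_left_mono integral_norm_bound_ennreal[OF i3]) auto
  also have "(\<lambda>h. norm ((-1) ^ k * (tent a l (x + \<rho> *\<^sub>R h) * (fdiff h ^^ k) f x))) = (\<lambda>h. tent a l (x + \<rho> *\<^sub>R h) * \<bar>(fdiff h ^^ k) f x\<bar>)"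
    by (simp add: fun_eq_iff abs_mult power_abs tent_nonneg)
  finally show ?thesis by (simp add: A_def)
qed

text \<open>
  The supremum of \<open>|E|\<^bsup>1/p-1\<^esup> \<integral>\<^sub>E |g|\<close> is a translation-invariant norm equivalent to the weak \<open>L\<^sub>p\<close> quasi-norm for
  \<open>p > 1\<close>. On sets of infinite measure the bound would be the junk value 0, so \<open>Q\<close> is bounded in all uses.
\<close>

definition fdiff_bound ::
  "'a::euclidean_space set \<Rightarrow> nat \<Rightarrow> real \<Rightarrow> real \<Rightarrow> real \<Rightarrow> ('a \<Rightarrow> real) \<Rightarrow> bool" where
  "fdiff_bound Q k p u W f \<longleftrightarrow>
     (\<forall>h E. norm h \<le> u \<longrightarrow> E \<in> sets borel \<longrightarrow> E \<subseteq> {x \<in> Q. x + real k *\<^sub>R h \<in> Q} \<longrightarrow>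
        (\<integral>\<^sup>+x\<in>E. ennreal \<bar>(fdiff h ^^ k) f x\<bar> \<partial>lborel) \<le> ennreal (W * measure lborel E powr (1 - 1 / p)))"

lemma fdiff_boundD:
  assumes "fdiff_bound Q k p u W f" "norm h \<le> u" "E \<in> sets borel" "E \<subseteq> {x \<in> Q. x + real k *\<^sub>R h \<in> Q}"
  shows "(\<integral>\<^sup>+x\<in>E. ennreal \<bar>(fdiff h ^^ k) f x\<bar> \<partial>lborel) \<le> ennreal (W * measure lborel E powr (1 - 1 / p))"
  using assms by (auto simp: fdiff_bound_def)

lemma fdiff_bound_subset:
  "fdiff_bound Q k p u W f \<Longrightarrow> Q' \<subseteq> Q \<Longrightarrow> u' \<le> u \<Longrightarrow> fdiff_bound Q' k p u' W f"
  unfolding fdiff_bound_def[of Q'] by (intro allI impI, erule fdiff_boundD) auto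

lemma fdiff_bound_mono:
  assumes bd: "fdiff_bound Q k p u W f" and W: "W \<le> W'"
  shows "fdiff_bound Q k p u W' f"
  unfolding fdiff_bound_def
proof (intro allI impI)
  fix h E assume "norm h \<le> u" "E \<in> sets borel" "E \<subseteq> {x \<in> Q. x + real k *\<^sub>R h \<in> Q}"
  then have "(\<integral>\<^sup>+x\<in>E. ennreal \<bar>(fdiff h ^^ k) f x\<bar> \<partial>lborel) \<le> ennreal (W * measure lborel E powr (1 - 1 / p))"
    by (rule fdiff_boundD[OF bd])
  also have "\<dots> \<le> ennreal (W' * measure lborel E powr (1 - 1 / p))"
    by (intro ennreal_leI mult_right_mono W) simp
  finally show "(\<integral>\<^sup>+x\<in>E. ennreal \<bar>(fdiff h ^^ k) f x\<bar> \<partial>lborel) \<le> ennreal (W' * measure lborel E powr (1 - 1 / p))" .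
qed

lemma emeasure_cball_le:
  assumes "0 \<le> v"
  shows "emeasure lborel (cball (0::'a::euclidean_space) v) \<le> ennreal ((2 * v) ^ DIM('a))"
proof -
  have "cball (0::'a) v \<subseteq> cube (- v *\<^sub>R (\<Sum>Basis)) (2 * v)"
  proof
    fix x :: 'a assume x: "x \<in> cball 0 v"
    show "x \<in> cube (- v *\<^sub>R (\<Sum>Basis)) (2 * v)"
      unfolding mem_cube
    proof
      fix b :: 'a assume b: "b \<in> Basis"
      have "\<bar>x \<bullet> b\<bar> \<le> v" using Basis_le_norm[OF b, of x] x by simp
      then show "- v *\<^sub>R (\<Sum>Basis) \<bullet> b \<le> x \<bullet> b \<and> x \<bullet> b \<le> - v *\<^sub>R (\<Sum>Basis) \<bullet> b + 2 * v"
        unfolding inner_scaleR_left sum_Basis_inner[OF b] by linarith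
    qed
  qed
  then have "emeasure lborel (cball (0::'a) v) \<le> emeasure lborel (cube (- v *\<^sub>R (\<Sum>Basis :: 'a)) (2 * v))"
    by (intro emeasure_mono) auto
  then show ?thesis using assms by (simp add: emeasure_cube)
qed

text \<open>Tonelli's theorem: for each fixed step the integral over \<open>E\<close> is at most W
  |E|^{1-1/p}. The steps fill a ball of radius d l/\<rho> and the normalised kernel has size of
  order (\<rho>/l)^d, so both \<open>\<rho>\<close> and \<open>l\<close> cancel from the
  constant.\<close>

lemma smooth_error_integral:
  fixes f :: "'a::euclidean_space \<Rightarrow> real"
  assumes l: "0 < l" and f: "integrable lborel f" and \<rho>: "1 \<le> \<rho>" "real k \<le> \<rho>"
    and b: "\<And>(f::'a \<Rightarrow> real) h x. (fdiff h ^^ k) f x = (-1) ^ k * (f x - (\<Sum>j=1..k. b j * f (x + real j *\<^sub>R h)))"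
    and p: "1 \<le> p" and W: "fdiff_bound (cube a l) k p u W f" "0 \<le> W" and u: "real DIM('a) * l / \<rho> \<le> u"
    and E: "E \<in> sets borel" "E \<subseteq> cube a l"
  shows "(\<integral>\<^sup>+x\<in>E. ennreal \<bar>f x - smooth b k \<rho> a l f x\<bar> \<partial>lborel)
    \<le> ennreal (2 * (4 * (real DIM('a))\<^sup>2) ^ DIM('a) * W * measure lborel E powr (1 - 1 / p))"
proof -
  define d where "d = real DIM('a)"
  have d: "1 \<le> d" by (simp add: d_def Suc_leI)
  define Q where "Q = cube a l"
  define A where "A = \<rho> ^ DIM('a) / tent_mass a l"
  have \<rho>0: "0 < \<rho>" using \<rho> by simp
  have A: "0 < A" using l \<rho>0 by (simp add: A_def tent_mass_pos)
  have fm[measurable]: "f \<in> borel_measurable borel" using f by auto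
  have [measurable]: "E \<in> sets borel" "Q \<in> sets borel" using E by (auto simp: Q_def)
  have fin: "emeasure lborel E < \<infinity>"
  proof -
    have "emeasure lborel E \<le> emeasure lborel Q" using E by (intro emeasure_mono) (auto simp: Q_def)
    also have "\<dots> < \<infinity>" using l by (simp add: Q_def emeasure_cube)
    finally show ?thesis .
  qed
  \<comment> \<open>Both \<open>x\<close> and \<open>x + \<rho> *\<^sub>R h\<close> lie in the cube,
    whose diameter is at most d l; this bounds the step.\<close>
  define v where "v = d * l / \<rho>"
  have v: "0 \<le> v" "v \<le> u" using d l \<rho>0 u by (auto simp: v_def d_def)
  define B :: "'a set" where "B = cball 0 v"
  have [measurable]: "B \<in> sets borel" by (simp add: B_def)
  define G where "G x h = ennreal \<bar>(fdiff h ^^ k) f x\<bar> * (indicator E x * indicator Q (x + real k *\<^sub>R h))" for x h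
  have G_meas[measurable]: "(\<lambda>(x, h). indicator B h * G x h) \<in> borel_measurable (lborel \<Otimes>\<^sub>M lborel)"
    unfolding measurable_cong_sets[OF sets_pair_measure_cong[OF sets_lborel sets_lborel] refl] G_def case_prod_beta
    using fdiff_funpow_measurable(1)[OF fm, of k] by measurable
  have fun_le: "ennreal (tent a l (x + \<rho> *\<^sub>R h) * \<bar>(fdiff h ^^ k) f x\<bar>) * indicator E x \<le> indicator B h * G x h"
    for x h
  proof (cases "x \<in> E \<and> tent a l (x + \<rho> *\<^sub>R h) \<noteq> 0")
    case True
    then have x: "x \<in> Q" and z: "x + \<rho> *\<^sub>R h \<in> Q" using E tent_supp[OF l] by (auto simp: Q_def)
    have "\<rho> * norm h \<le> d * l"
      using dist_cube[of "x + \<rho> *\<^sub>R h" a l x] x z \<rho>0 by (simp add: Q_def d_def)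
    then have "norm h \<le> v" using \<rho>0 by (simp add: v_def field_simps)
    \<comment> \<open>The far end of the difference is a convex combination of two points of the
      cube with weight k/\<rho> \<le> 1, so \<open>fdiff_bound\<close> applies.\<close>
    moreover have "x + real k *\<^sub>R h \<in> Q"
    proof -
      have "x + real k *\<^sub>R h = (1 - real k / \<rho>) *\<^sub>R x + (real k / \<rho>) *\<^sub>R (x + \<rho> *\<^sub>R h)"
        using \<rho>0 by (simp add: algebra_simps)
      also have "\<dots> \<in> Q" unfolding Q_def
        by (rule convexD[OF convex_cube]) (use x z \<rho> \<rho>0 in \<open>auto simp: Q_def\<close>)
      finally show ?thesis .
    qed
    moreover have "ennreal (tent a l (x + \<rho> *\<^sub>R h) * \<bar>(fdiff h ^^ k) f x\<bar>) \<le> ennreal \<bar>(fdiff h ^^ k) f x\<bar>"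
      using tent_le_1[OF l] tent_nonneg by (intro ennreal_leI mult_left_le_one_le) auto
    ultimately show ?thesis using True by (simp add: G_def B_def)
  qed auto
  have "(\<integral>\<^sup>+x\<in>E. ennreal \<bar>f x - smooth b k \<rho> a l f x\<bar> \<partial>lborel)
      \<le> (\<integral>\<^sup>+x. ennreal A * (\<integral>\<^sup>+h. indicator B h * G x h \<partial>lborel) \<partial>lborel)"
  proof (rule nn_integral_mono)
    fix x
    have "ennreal \<bar>f x - smooth b k \<rho> a l f x\<bar> * indicator E x
        \<le> ennreal A * (\<integral>\<^sup>+h. ennreal (tent a l (x + \<rho> *\<^sub>R h) * \<bar>(fdiff h ^^ k) f x\<bar>) \<partial>lborel) * indicator E x"
      unfolding A_def by (intro mult_right_mono smooth_error[OF l f \<rho>0 b]) auto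
    also have "\<dots> \<le> ennreal A * (\<integral>\<^sup>+h. indicator B h * G x h \<partial>lborel)"
    proof (cases "x \<in> E")
      case True
      then show ?thesis using fun_le[of x]
        by (auto intro!: mult_left_mono nn_integral_mono)
    qed auto
    finally show "ennreal \<bar>f x - smooth b k \<rho> a l f x\<bar> * indicator E x
        \<le> ennreal A * (\<integral>\<^sup>+h. indicator B h * G x h \<partial>lborel)" .
  qed
  also have "\<dots> = ennreal A * (\<integral>\<^sup>+x. (\<integral>\<^sup>+h. indicator B h * G x h \<partial>lborel) \<partial>lborel)"
    using G_meas by (intro nn_integral_cmult lborel.borel_measurable_nn_integral) auto
  also have "\<dots> = ennreal A * (\<integral>\<^sup>+h. (\<integral>\<^sup>+x. indicator B h * G x h \<partial>lborel) \<partial>lborel)"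
    by (subst lborel_pair.Fubini'[OF G_meas]) simp
  also have "\<dots> \<le> ennreal A * (\<integral>\<^sup>+h. ennreal (W * measure lborel E powr (1 - 1 / p)) * indicator B h \<partial>(lborel::'a measure))"
  proof (intro mult_left_mono nn_integral_mono)
    fix h :: 'a
    show "(\<integral>\<^sup>+x. indicator B h * G x h \<partial>lborel) \<le> ennreal (W * measure lborel E powr (1 - 1 / p)) * indicator B h"
    proof (cases "norm h \<le> v")
      case True
      define E' where "E' = {x \<in> E. x + real k *\<^sub>R h \<in> Q}"
      have [measurable]: "E' \<in> sets borel" unfolding E'_def by measurable
      have "(\<integral>\<^sup>+x. indicator B h * G x h \<partial>lborel) = (\<integral>\<^sup>+x\<in>E'. ennreal \<bar>(fdiff h ^^ k) f x\<bar> \<partial>lborel)"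
        using True by (intro nn_integral_cong) (auto simp: G_def B_def E'_def indicator_def)
      also have "\<dots> \<le> ennreal (W * measure lborel E' powr (1 - 1 / p))"
        using True v E by (intro fdiff_boundD[OF W(1)]) (auto simp: E'_def Q_def)
      also have "\<dots> \<le> ennreal (W * measure lborel E powr (1 - 1 / p))"
        using p W(2) fin by (intro ennreal_leI mult_left_mono powr_mono2 measure_mono_fmeasurable)
          (auto simp: E'_def fmeasurable_def)
      finally show ?thesis using True by (simp add: B_def)
    qed (simp add: B_def)
  qed auto
  also have "\<dots> = ennreal A * (ennreal (W * measure lborel E powr (1 - 1 / p)) * emeasure lborel B)"
    by (simp add: nn_integral_cmult_indicator)
  also have "\<dots> \<le> ennreal A * (ennreal (W * measure lborel E powr (1 - 1 / p)) * ennreal ((2 * v) ^ DIM('a)))"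
    unfolding B_def by (intro mult_left_mono emeasure_cball_le v) auto
  also have "\<dots> = ennreal ((A * (2 * v) ^ DIM('a)) * (W * measure lborel E powr (1 - 1 / p)))"
    using A v W(2) by (simp add: ennreal_mult mult_ac)
  also have "\<dots> \<le> ennreal ((2 * (4 * d\<^sup>2) ^ DIM('a)) * (W * measure lborel E powr (1 - 1 / p)))"
  proof (intro ennreal_leI mult_right_mono)
    have "A \<le> \<rho> ^ DIM('a) / (1 / 2 * (l / (2 * d)) ^ DIM('a))"
      unfolding A_def using tent_mass_ge[OF l, of a] l d \<rho>0
      by (intro divide_left_mono mult_pos_pos tent_mass_pos) (auto simp: d_def)
    then have "A * (2 * v) ^ DIM('a) \<le> \<rho> ^ DIM('a) / (1 / 2 * (l / (2 * d)) ^ DIM('a)) * (2 * v) ^ DIM('a)"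
      using v by (intro mult_right_mono) auto
    also have "\<dots> = 2 * (\<rho> / (l / (2 * d)) * (2 * v)) ^ DIM('a)"
      unfolding power_mult_distrib power_divide by simp
    also have "\<rho> / (l / (2 * d)) * (2 * v) = 4 * d\<^sup>2"
      using l \<rho>0 d by (simp add: v_def power2_eq_square)
    finally show "A * (2 * v) ^ DIM('a) \<le> 2 * (4 * d\<^sup>2) ^ DIM('a)" .
  qed (use W in auto)
  finally show ?thesis by (simp add: d_def mult_ac)
qed

text \<open>The substitution v = x + j h moves the dependence on \<open>x\<close> out of
  \<open>f\<close> and into the kernel; the constant \<open>c\<close> passes through because the
  coefficients add up to 1.\<close>

lemma smooth_minus_const:
  fixes f :: "'a::euclidean_space \<Rightarrow> real"
  assumes l: "0 < l" and f: "integrable lborel f" and \<rho>: "0 < \<rho>" and b: "(\<Sum>j=1..k. b j) = 1"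
  shows "smooth b k \<rho> a l f x - c = \<rho> ^ DIM('a) / tent_mass a l *
    (\<Sum>j=1..k. b j * ((1 / real j) ^ DIM('a) * (\<integral>v. tent a l (x + (\<rho> / real j) *\<^sub>R (v - x)) * (f v - c) \<partial>lborel)))"
    and "1 \<le> j \<Longrightarrow> integrable lborel (\<lambda>v. tent a l (x + (\<rho> / real j) *\<^sub>R (v - x)) * (f v - c))"
proof -
  define A where "A = \<rho> ^ DIM('a) / tent_mass a l"
  define T where "T j v = tent a l (x + (\<rho> / real j) *\<^sub>R (v - x))" for j v
  have aff: "x + (\<rho> / real j) *\<^sub>R (v - x) = (x - (\<rho> / real j) *\<^sub>R x) + (\<rho> / real j) *\<^sub>R v" for v j
    by (simp add: algebra_simps)
  have T1: "integrable lborel (T j)" if "1 \<le> j" for j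
    unfolding T_def[abs_def] aff using that \<rho> by (intro integrable_lborel_affine integrable_tent l) auto
  have T2: "integrable lborel (\<lambda>v. T j v * f v)" for j
    unfolding T_def aff by (rule integrable_tent_mult[OF l f])
  have TA: "T j (x + real j *\<^sub>R h) = tent a l (x + \<rho> *\<^sub>R h)" if "1 \<le> j" for j h
    using that by (simp add: T_def)
  have T3: "(1 / real j) ^ DIM('a) * (\<integral>v. T j v * f v \<partial>lborel) = (\<integral>h. tent a l (x + \<rho> *\<^sub>R h) * f (x + real j *\<^sub>R h) \<partial>lborel)"
    if "1 \<le> j" for j
    using integral_lborel_affine[OF T2[of j], of "real j" x] that by (simp add: TA power_divide)
  have T4: "(1 / real j) ^ DIM('a) * (\<integral>v. T j v \<partial>lborel) = (\<integral>h. tent a l (x + \<rho> *\<^sub>R h) \<partial>lborel)"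
    if "1 \<le> j" for j
    using integral_lborel_affine[OF T1[OF that], of "real j" x] that by (simp add: TA power_divide)
  have T5: "(\<integral>v. T j v * (f v - c) \<partial>lborel) = (\<integral>v. T j v * f v \<partial>lborel) - (\<integral>v. T j v \<partial>lborel) * c" if "1 \<le> j" for j
    unfolding right_diff_distrib using T1[OF that] T2[of j] by (subst Bochner_Integration.integral_diff) auto
  have "(\<Sum>j=1..k. b j * ((1 / real j) ^ DIM('a) * (\<integral>v. T j v * (f v - c) \<partial>lborel)))
      = (\<Sum>j=1..k. b j * (\<integral>h. tent a l (x + \<rho> *\<^sub>R h) * f (x + real j *\<^sub>R h) \<partial>lborel) - b j * ((\<integral>h. tent a l (x + \<rho> *\<^sub>R h) \<partial>lborel) * c))"
  proof (rule sum.cong[OF refl])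
    fix j assume "j \<in> {1..k}"
    then have j: "1 \<le> j" by simp
    show "b j * ((1 / real j) ^ DIM('a) * (\<integral>v. T j v * (f v - c) \<partial>lborel)) =
      b j * (\<integral>h. tent a l (x + \<rho> *\<^sub>R h) * f (x + real j *\<^sub>R h) \<partial>lborel) - b j * ((\<integral>h. tent a l (x + \<rho> *\<^sub>R h) \<partial>lborel) * c)"
      unfolding T3[OF j, symmetric] T4[OF j, symmetric] T5[OF j] by (simp only: right_diff_distrib mult.assoc)
  qed
  also have "\<dots> = (\<Sum>j=1..k. b j * (\<integral>h. tent a l (x + \<rho> *\<^sub>R h) * f (x + real j *\<^sub>R h) \<partial>lborel)) - (\<integral>h. tent a l (x + \<rho> *\<^sub>R h) \<partial>lborel) * c"
    unfolding sum_subtractf sum_distrib_right[symmetric] b by simp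
  finally have "A * (\<Sum>j=1..k. b j * ((1 / real j) ^ DIM('a) * (\<integral>v. T j v * (f v - c) \<partial>lborel)))
    = smooth b k \<rho> a l f x - A * (\<integral>h. tent a l (x + \<rho> *\<^sub>R h) \<partial>lborel) * c"
    by (simp add: smooth_def A_def right_diff_distrib)
  also have "A * (\<integral>h. tent a l (x + \<rho> *\<^sub>R h) \<partial>lborel) = 1"
    using integral_tent_affine[OF l \<rho>, of a x] tent_mass_pos[OF l, of a] by (simp add: A_def field_simps)
  finally show "smooth b k \<rho> a l f x - c = \<rho> ^ DIM('a) / tent_mass a l *
    (\<Sum>j=1..k. b j * ((1 / real j) ^ DIM('a) * (\<integral>v. tent a l (x + (\<rho> / real j) *\<^sub>R (v - x)) * (f v - c) \<partial>lborel)))"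
    by (simp add: A_def T_def)
  show "integrable lborel (\<lambda>v. tent a l (x + (\<rho> / real j) *\<^sub>R (v - x)) * (f v - c))" if "1 \<le> j"
    unfolding T_def[symmetric] right_diff_distrib using T1[OF that] T2[of j] by auto
qed

text \<open>After the substitution \<open>f\<close> enters only through the values
  \<open>f v - c\<close>, so the smoothing inherits the Lipschitz bound of the kernel however rough
  \<open>f\<close> is. \<open>G\<close> contains the points where the kernels of \<open>x\<close>
  and \<open>y\<close> live; \<open>c\<close> will be the mean of \<open>f\<close> over such a
  set.\<close>

lemma smooth_lipschitz:
  fixes f :: "'a::euclidean_space \<Rightarrow> real"
  assumes l: "0 < l" and f: "integrable lborel f" and \<rho>: "1 \<le> \<rho>" "real k \<le> \<rho>" and b: "(\<Sum>j=1..k. b j) = 1"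
    and G: "G \<in> sets borel" "\<And>v w j. w \<in> {x, y} \<Longrightarrow> j \<in> {1..k} \<Longrightarrow> w + (\<rho> / real j) *\<^sub>R (v - w) \<in> cube a l \<Longrightarrow> v \<in> G"
  shows "ennreal \<bar>smooth b k \<rho> a l f x - smooth b k \<rho> a l f y\<bar>
    \<le> ennreal (4 * (2 * real DIM('a)) ^ DIM('a) * (\<Sum>j=1..k. \<bar>b j\<bar>) * (\<rho> / l) ^ (DIM('a) + 1) * norm (x - y))
        * (\<integral>\<^sup>+v\<in>G. ennreal \<bar>f v - c\<bar> \<partial>lborel)"
proof -
  define A where "A = \<rho> ^ DIM('a) / tent_mass a l"
  define d where "d = real DIM('a)"
  have d: "1 \<le> d" by (simp add: d_def Suc_leI)
  have \<rho>0: "0 < \<rho>" using \<rho> by simp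
  have A: "0 < A" using l \<rho>0 by (simp add: A_def tent_mass_pos)
  have fm[measurable]: "f \<in> borel_measurable borel" using f by auto
  define T where "T j w v = tent a l (w + (\<rho> / real j) *\<^sub>R (v - w))" for j w v
  define I where "I j w = (\<integral>v. T j w v * (f v - c) \<partial>lborel)" for j w
  define J where "J = (\<integral>\<^sup>+v\<in>G. ennreal \<bar>f v - c\<bar> \<partial>lborel)"
  have Tint: "integrable lborel (\<lambda>v. T j w v * (f v - c))" if "1 \<le> j" for j w
    unfolding T_def by (rule smooth_minus_const(2)[OF l f \<rho>0 b that])
  have step: "ennreal \<bar>I j x - I j y\<bar> \<le> ennreal (2 * \<rho> / l * norm (x - y)) * J" if j: "j \<in> {1..k}" for j
  proof -
    have j1: "1 \<le> j" "j \<le> k" using j by auto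
    have r: "1 \<le> \<rho> / real j" "\<rho> / real j \<le> \<rho>" using j1 \<rho> \<rho>0 by (auto simp: field_simps)
    have "ennreal \<bar>I j x - I j y\<bar> = ennreal (norm (\<integral>v. T j x v * (f v - c) - T j y v * (f v - c) \<partial>lborel))"
      unfolding I_def by (subst Bochner_Integration.integral_diff[OF Tint[OF j1(1)] Tint[OF j1(1)]]) simp
    also have "\<dots> \<le> (\<integral>\<^sup>+v. ennreal (norm (T j x v * (f v - c) - T j y v * (f v - c))) \<partial>lborel)"
      by (intro integral_norm_bound_ennreal Bochner_Integration.integrable_diff Tint j1)
    also have "\<dots> \<le> (\<integral>\<^sup>+v. ennreal (2 * \<rho> / l * norm (x - y)) * (ennreal \<bar>f v - c\<bar> * indicator G v) \<partial>lborel)"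
    proof (rule nn_integral_mono)
      fix v
      have "T j x v = 0 \<and> T j y v = 0" if "v \<notin> G"
        using that G(2)[of _ j v] j tent_supp[OF l, of a] unfolding T_def by blast
      moreover have "norm (T j x v * (f v - c) - T j y v * (f v - c)) \<le> 2 * \<rho> / l * norm (x - y) * \<bar>f v - c\<bar>"
      proof -
        have "\<bar>T j x v - T j y v\<bar> \<le> 2 / l * norm ((x + (\<rho> / real j) *\<^sub>R (v - x)) - (y + (\<rho> / real j) *\<^sub>R (v - y)))"
          unfolding T_def by (rule tent_lipschitz[OF l])
        \<comment> \<open>The point \<open>v\<close> cancels, and the factor 1 - \<rho>/j that
          remains is at most \<rho> in modulus since 1 \<le> \<rho>/j \<le> \<rho>.\<close>
        also have "(x + (\<rho> / real j) *\<^sub>R (v - x)) - (y + (\<rho> / real j) *\<^sub>R (v - y)) = (1 - \<rho> / real j) *\<^sub>R (x - y)"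
          by (simp add: algebra_simps)
        also have "2 / l * norm \<dots> \<le> 2 / l * (\<rho> * norm (x - y))"
          using l r by (intro mult_left_mono) (auto intro!: mult_right_mono)
        finally have "\<bar>T j x v - T j y v\<bar> \<le> 2 * \<rho> / l * norm (x - y)" by simp
        then show ?thesis
          unfolding left_diff_distrib[symmetric] real_norm_def abs_mult by (rule mult_right_mono) simp
      qed
      ultimately show "ennreal (norm (T j x v * (f v - c) - T j y v * (f v - c)))
          \<le> ennreal (2 * \<rho> / l * norm (x - y)) * (ennreal \<bar>f v - c\<bar> * indicator G v)"
        using l \<rho>0 by (cases "v \<in> G") (auto simp: ennreal_mult[symmetric] intro!: ennreal_leI)
    qed
    also have "\<dots> = ennreal (2 * \<rho> / l * norm (x - y)) * J"
      unfolding J_def using G by (intro nn_integral_cmult) auto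
    finally show ?thesis .
  qed
  have "smooth b k \<rho> a l f x - smooth b k \<rho> a l f y = (smooth b k \<rho> a l f x - c) - (smooth b k \<rho> a l f y - c)" by simp
  also have "\<dots> = A * (\<Sum>j=1..k. b j * ((1 / real j) ^ DIM('a) * (I j x - I j y)))"
    unfolding smooth_minus_const(1)[OF l f \<rho>0 b] A_def[symmetric] T_def[symmetric] I_def[symmetric]
    by (simp add: right_diff_distrib sum_subtractf)
  also have "\<bar>\<dots>\<bar> \<le> A * (\<Sum>j=1..k. \<bar>b j\<bar> * \<bar>I j x - I j y\<bar>)"
  proof -
    have "\<bar>\<Sum>j=1..k. b j * ((1 / real j) ^ DIM('a) * (I j x - I j y))\<bar> \<le> (\<Sum>j=1..k. \<bar>b j * ((1 / real j) ^ DIM('a) * (I j x - I j y))\<bar>)"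
      by (rule sum_abs)
    also have "\<dots> \<le> (\<Sum>j=1..k. \<bar>b j\<bar> * \<bar>I j x - I j y\<bar>)"
    proof (rule sum_mono)
      fix j assume "j \<in> {1..k}"
      then have "(1 / real j) ^ DIM('a) \<le> 1" by (intro power_le_one) auto
      then show "\<bar>b j * ((1 / real j) ^ DIM('a) * (I j x - I j y))\<bar> \<le> \<bar>b j\<bar> * \<bar>I j x - I j y\<bar>"
        unfolding abs_mult by (intro mult_left_mono mult_left_le_one_le) auto
    qed
    finally show ?thesis using A by (simp add: abs_mult)
  qed
  finally have "ennreal \<bar>smooth b k \<rho> a l f x - smooth b k \<rho> a l f y\<bar> \<le> ennreal (A * (\<Sum>j=1..k. \<bar>b j\<bar> * \<bar>I j x - I j y\<bar>))"
    by (rule ennreal_leI)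
  also have "\<dots> = ennreal A * (\<Sum>j=1..k. ennreal \<bar>b j\<bar> * ennreal \<bar>I j x - I j y\<bar>)"
    using A by (simp add: ennreal_mult sum_nonneg sum_ennreal[symmetric] del: sum_ennreal)
  also have "\<dots> \<le> ennreal A * (\<Sum>j=1..k. ennreal \<bar>b j\<bar> * (ennreal (2 * \<rho> / l * norm (x - y)) * J))"
    by (intro mult_left_mono sum_mono step) auto
  also have "\<dots> = ennreal A * (ennreal (\<Sum>j=1..k. \<bar>b j\<bar>) * (ennreal (2 * \<rho> / l * norm (x - y)) * J))"
    unfolding sum_distrib_right[symmetric] by simp
  also have "\<dots> = ennreal (A * ((\<Sum>j=1..k. \<bar>b j\<bar>) * (2 * \<rho> / l * norm (x - y)))) * J"
  proof -
    have "0 \<le> (\<Sum>j=1..k. \<bar>b j\<bar>)" "0 \<le> 2 * \<rho> / l * norm (x - y)" using l \<rho>0 by (auto intro: sum_nonneg)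
    then show ?thesis using A by (simp only: ennreal_mult mult_nonneg_nonneg less_imp_le mult.assoc)
  qed
  also have "\<dots> \<le> ennreal (4 * (2 * d) ^ DIM('a) * (\<Sum>j=1..k. \<bar>b j\<bar>) * (\<rho> / l) ^ (DIM('a) + 1) * norm (x - y)) * J"
  proof (intro mult_right_mono ennreal_leI)
    have "A \<le> \<rho> ^ DIM('a) / (1 / 2 * (l / (2 * d)) ^ DIM('a))"
      unfolding A_def using tent_mass_ge[OF l, of a] l d \<rho>0
      by (intro divide_left_mono mult_pos_pos tent_mass_pos) (auto simp: d_def)
    also have "\<dots> = 2 * (2 * d) ^ DIM('a) * (\<rho> / l) ^ DIM('a)"
      by (simp add: power_divide power_mult_distrib)
    finally have "A * ((\<Sum>j=1..k. \<bar>b j\<bar>) * (2 * \<rho> / l * norm (x - y)))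
        \<le> 2 * (2 * d) ^ DIM('a) * (\<rho> / l) ^ DIM('a) * ((\<Sum>j=1..k. \<bar>b j\<bar>) * (2 * \<rho> / l * norm (x - y)))"
      using l \<rho>0 by (intro mult_right_mono mult_nonneg_nonneg sum_nonneg) auto
    then show "A * ((\<Sum>j=1..k. \<bar>b j\<bar>) * (2 * \<rho> / l * norm (x - y)))
        \<le> 4 * (2 * d) ^ DIM('a) * (\<Sum>j=1..k. \<bar>b j\<bar>) * (\<rho> / l) ^ (DIM('a) + 1) * norm (x - y)"
      by (simp add: mult_ac)
  qed simp
  finally show ?thesis by (simp add: d_def J_def)
qed

lemma smooth_measurable [measurable]:
  fixes f :: "'a::euclidean_space \<Rightarrow> real"
  assumes [measurable]: "f \<in> borel_measurable borel"
  shows "smooth b k \<rho> a l f \<in> borel_measurable borel"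
proof -
  have "(\<lambda>x. \<integral>h. tent a l (x + \<rho> *\<^sub>R h) * f (x + real j *\<^sub>R h) \<partial>lborel) \<in> borel_measurable borel" for j
    by (rule lborel.borel_measurable_lebesgue_integral) measurable
  then show ?thesis unfolding smooth_def[abs_def] by measurable
qed

text \<open>\<open>f\<close> is compared with the single value of its smoothing at the corner
  \<open>a\<close>. The error splits into the smoothing error and the variation of the smoothing
  over the cube; the latter carries a factor \<open>l\<close> times the oscillation of
  \<open>f\<close> on the cube that the kernels see.\<close>

lemma mean_osc_smooth_le:
  fixes f :: "'a::euclidean_space \<Rightarrow> real"
  assumes f: "integrable lborel f" and b: "(\<Sum>j=1..k. b j) = 1" and \<rho>: "1 \<le> \<rho>" "real k \<le> \<rho>"
    and l: "0 < l" "0 < l'" "0 < m"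
    and G: "\<And>v w j. w \<in> cube a l \<Longrightarrow> j \<in> {1..k} \<Longrightarrow> w + (\<rho> / real j) *\<^sub>R (v - w) \<in> cube a' l' \<Longrightarrow> v \<in> cube g m"
  shows "mean_osc f (cube a l) \<le>
      2 * (\<integral>\<^sup>+y\<in>cube a l. ennreal \<bar>f y - smooth b k \<rho> a' l' f y\<bar> \<partial>lborel) / ennreal (l ^ DIM('a))
      + ennreal (8 * (2 * real DIM('a)) ^ DIM('a) * (\<Sum>j=1..k. \<bar>b j\<bar>) * (\<rho> / l') ^ (DIM('a) + 1)
          * (real DIM('a) * l) * m ^ DIM('a)) * mean_osc f (cube g m)"
proof -
  define K where "K = smooth b k \<rho> a' l' f"
  define d where "d = real DIM('a)"
  have fm[measurable]: "f \<in> borel_measurable borel" using f by auto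
  have K[measurable]: "K \<in> borel_measurable borel" by (simp add: K_def)
  define J where "J = (\<integral>\<^sup>+v\<in>cube g m. ennreal \<bar>f v - average f (cube g m)\<bar> \<partial>lborel)"
  define C where "C = 4 * (2 * d) ^ DIM('a) * (\<Sum>j=1..k. \<bar>b j\<bar>) * (\<rho> / l') ^ (DIM('a) + 1)"
  have C: "0 \<le> C" using l \<rho> by (auto simp: C_def d_def intro!: mult_nonneg_nonneg sum_nonneg)
  have a: "a \<in> cube a l" using l by (simp add: mem_cube)
  have lip: "ennreal \<bar>K y - K a\<bar> \<le> ennreal (C * (d * l)) * J" if y: "y \<in> cube a l" for y
  proof -
    have "ennreal \<bar>K y - K a\<bar> \<le> ennreal (C * norm (y - a)) * J"
      unfolding K_def C_def J_def d_def
      by (rule smooth_lipschitz[OF l(2) f \<rho> b]) (use y a G in auto)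
    also have "\<dots> \<le> ennreal (C * (d * l)) * J"
      using C dist_cube[OF y a] by (intro mult_right_mono ennreal_leI mult_left_mono) (auto simp: d_def)
    finally show ?thesis .
  qed
  have "(\<integral>\<^sup>+y\<in>cube a l. ennreal \<bar>f y - K a\<bar> \<partial>lborel)
      \<le> (\<integral>\<^sup>+y. ennreal \<bar>f y - K y\<bar> * indicator (cube a l) y + ennreal (C * (d * l)) * J * indicator (cube a l) y \<partial>lborel)"
  proof (rule nn_integral_mono)
    fix y
    show "ennreal \<bar>f y - K a\<bar> * indicator (cube a l) y \<le> ennreal \<bar>f y - K y\<bar> * indicator (cube a l) y + ennreal (C * (d * l)) * J * indicator (cube a l) y"
    proof (cases "y \<in> cube a l")
      case True
      have "ennreal \<bar>f y - K a\<bar> \<le> ennreal (\<bar>f y - K y\<bar> + \<bar>K y - K a\<bar>)"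
        by (rule ennreal_leI) simp
      also have "\<dots> = ennreal \<bar>f y - K y\<bar> + ennreal \<bar>K y - K a\<bar>" by simp
      also have "\<dots> \<le> ennreal \<bar>f y - K y\<bar> + ennreal (C * (d * l)) * J"
        by (intro add_left_mono lip True)
      finally show ?thesis using True by simp
    qed simp
  qed
  also have "\<dots> = (\<integral>\<^sup>+y\<in>cube a l. ennreal \<bar>f y - K y\<bar> \<partial>lborel) + ennreal (C * (d * l)) * J * ennreal (l ^ DIM('a))"
    using l by (subst nn_integral_add) (auto simp: nn_integral_cmult_indicator emeasure_cube)
  finally have *: "(\<integral>\<^sup>+y\<in>cube a l. ennreal \<bar>f y - K a\<bar> \<partial>lborel)
    \<le> (\<integral>\<^sup>+y\<in>cube a l. ennreal \<bar>f y - K y\<bar> \<partial>lborel) + ennreal (C * (d * l)) * J * ennreal (l ^ DIM('a))" .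
  have "mean_osc f (cube a l) \<le> 2 * (\<integral>\<^sup>+y\<in>cube a l. ennreal \<bar>f y - K a\<bar> \<partial>lborel) / ennreal (l ^ DIM('a))"
    by (rule mean_osc_le[OF f l(1)])
  also have "\<dots> \<le> 2 * ((\<integral>\<^sup>+y\<in>cube a l. ennreal \<bar>f y - K y\<bar> \<partial>lborel) + ennreal (C * (d * l)) * J * ennreal (l ^ DIM('a))) / ennreal (l ^ DIM('a))"
    by (intro divide_right_mono_ennreal mult_left_mono *) simp
  also have "\<dots> = 2 * (\<integral>\<^sup>+y\<in>cube a l. ennreal \<bar>f y - K y\<bar> \<partial>lborel) / ennreal (l ^ DIM('a))
      + (2 * (ennreal (C * (d * l)) * J)) * ennreal (l ^ DIM('a)) / ennreal (l ^ DIM('a))"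
    by (simp add: distrib_left add_divide_distrib_ennreal mult.assoc)
  also have "(2 * (ennreal (C * (d * l)) * J)) * ennreal (l ^ DIM('a)) / ennreal (l ^ DIM('a)) = 2 * (ennreal (C * (d * l)) * J)"
    using l by (intro mult_divide_eq_ennreal) auto
  also have "\<dots> = ennreal (2 * C * (d * l) * m ^ DIM('a)) * mean_osc f (cube g m)"
    unfolding J_def nn_integral_cube_average[OF l(3)] using C l
    by (simp add: ennreal_mult d_def mult_ac)
  also have "2 * C * (d * l) * m ^ DIM('a) = 8 * (2 * d) ^ DIM('a) * (\<Sum>j=1..k. \<bar>b j\<bar>) * (\<rho> / l') ^ (DIM('a) + 1) * (d * l) * m ^ DIM('a)"
    by (simp add: C_def)
  finally show ?thesis by (simp add: K_def d_def)
qed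

section \<open>Weak-type inequality for the maximal function\<close>

lemma emeasure_lborel_cball_translate:
  "emeasure lborel (cball (c::'a::euclidean_space) r) = emeasure lborel (cball (0::'a) r)"
proof -
  have "emeasure lborel (cball c r) = emeasure (distr lborel borel ((+) c)) (cball c r)"
    by (simp only: lborel_distr_plus)
  also have "\<dots> = emeasure lborel ((+) c -` cball c r \<inter> space lborel)"
    by (rule emeasure_distr) auto
  also have "(+) c -` cball c r \<inter> space lborel = cball (0::'a) r"
    by (auto simp: dist_norm)
  finally show ?thesis .
qed

lemma emeasure_UN_countable_le:
  assumes sets[measurable]: "\<And>i. i \<in> I \<Longrightarrow> X i \<in> sets M" and I[simp]: "countable I"
  shows "emeasure M (\<Union>(X ` I)) \<le> (\<integral>\<^sup>+i. emeasure M (X i) \<partial>count_space I)"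
proof -
  have "(\<integral>\<^sup>+x. indicator (\<Union>(X ` I)) x \<partial>M) \<le> (\<integral>\<^sup>+x. (\<integral>\<^sup>+i. indicator (X i) x \<partial>count_space I) \<partial>M)"
  proof (rule nn_integral_mono)
    fix x
    show "indicator (\<Union>(X ` I)) x \<le> (\<integral>\<^sup>+i. indicator (X i) x \<partial>count_space I)"
    proof (cases "x \<in> \<Union>(X ` I)")
      case True
      then obtain i where i: "i \<in> I" "x \<in> X i" by blast
      with nn_integral_ge_point[OF i(1), of "\<lambda>i. indicator (X i) x"] show ?thesis
        by (simp only: indicator_simps(1)[OF True] indicator_simps(1)[OF i(2)])
    qed simp
  qed
  also have "\<dots> = (\<integral>\<^sup>+i. (\<integral>\<^sup>+x. indicator (X i) x \<partial>M) \<partial>count_space I)"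
    by (rule nn_integral_count_space_nn_integral) auto
  also have "\<dots> = (\<integral>\<^sup>+i. emeasure M (X i) \<partial>count_space I)"
    by (intro nn_integral_cong) simp
  finally show ?thesis by (simp add: sets.countable_UN'')
qed

text \<open>Vitali's lemma selects disjoint cubes whose enlarged balls cover \<open>X\<close>. On
  their union U the hypotheses give \<kappa> |U| \<le> \<integral>_U |g| \<le> W |U|^{1-1/p}, hence
  |U| \<le> (W/\<kappa>)^p: the exponent \<open>p\<close> comes out directly. A Borel cover
  \<open>Y\<close> is produced because \<open>X\<close> is an arbitrary set.\<close>

lemma weak_type_maximal:
  fixes g :: "'a::euclidean_space \<Rightarrow> real"
  assumes g[measurable]: "g \<in> borel_measurable borel" and L: "0 < L" and p: "1 \<le> p" and W: "0 \<le> W" and \<kappa>: "0 < \<kappa>"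
    and bd: "\<And>E. E \<in> sets borel \<Longrightarrow> E \<subseteq> cube a0 L \<Longrightarrow> (\<integral>\<^sup>+x\<in>E. ennreal \<bar>g x\<bar> \<partial>lborel) \<le> ennreal (W * measure lborel E powr (1 - 1 / p))"
    and X: "\<And>x. x \<in> X \<Longrightarrow> \<exists>a l. 0 < l \<and> x \<in> cube a l \<and> cube a l \<subseteq> cube a0 L \<and> l \<le> L \<and>
              ennreal (\<kappa> * l ^ DIM('a)) \<le> (\<integral>\<^sup>+x\<in>cube a l. ennreal \<bar>g x\<bar> \<partial>lborel)"
  obtains Y where "Y \<in> sets borel" "X \<subseteq> Y"
    "emeasure lborel Y \<le> ennreal ((20 * real DIM('a)) ^ DIM('a) * (W / \<kappa>) powr p)"
proof -
  define d where "d = real DIM('a)"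
  have d: "1 \<le> d" by (simp add: d_def Suc_leI)
  have "\<forall>x\<in>X. \<exists>q. 0 < snd q \<and> x \<in> cube (fst q) (snd q) \<and> cube (fst q) (snd q) \<subseteq> cube a0 L \<and> snd q \<le> L \<and>
              ennreal (\<kappa> * snd q ^ DIM('a)) \<le> (\<integral>\<^sup>+y\<in>cube (fst q) (snd q). ennreal \<bar>g y\<bar> \<partial>lborel)"
  proof
    fix x assume "x \<in> X"
    from X[OF this] obtain a l where "0 < l \<and> x \<in> cube a l \<and> cube a l \<subseteq> cube a0 L \<and> l \<le> L \<and>
              ennreal (\<kappa> * l ^ DIM('a)) \<le> (\<integral>\<^sup>+x\<in>cube a l. ennreal \<bar>g x\<bar> \<partial>lborel)" by blast
    then show "\<exists>q. 0 < snd q \<and> x \<in> cube (fst q) (snd q) \<and> cube (fst q) (snd q) \<subseteq> cube a0 L \<and> snd q \<le> L \<and>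
              ennreal (\<kappa> * snd q ^ DIM('a)) \<le> (\<integral>\<^sup>+y\<in>cube (fst q) (snd q). ennreal \<bar>g y\<bar> \<partial>lborel)"
      by (intro exI[of _ "(a, l)"]) simp
  qed
  from bchoice[OF this] obtain q where q: "\<forall>x\<in>X. 0 < snd (q x) \<and> x \<in> cube (fst (q x)) (snd (q x)) \<and> cube (fst (q x)) (snd (q x)) \<subseteq> cube a0 L \<and> snd (q x) \<le> L \<and>
              ennreal (\<kappa> * snd (q x) ^ DIM('a)) \<le> (\<integral>\<^sup>+y\<in>cube (fst (q x)) (snd (q x)). ennreal \<bar>g y\<bar> \<partial>lborel)" ..
  define A where "A x = fst (q x)" for x
  define l where "l x = snd (q x)" for x
  have Al: "\<And>x. x \<in> X \<Longrightarrow> 0 < l x \<and> x \<in> cube (A x) (l x) \<and> cube (A x) (l x) \<subseteq> cube a0 L \<and> l x \<le> L \<and>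
              ennreal (\<kappa> * l x ^ DIM('a)) \<le> (\<integral>\<^sup>+y\<in>cube (A x) (l x). ennreal \<bar>g y\<bar> \<partial>lborel)"
    using q by (simp add: A_def l_def)
  \<comment> \<open>The diameter of the cube is at most d l, and the factor 2 gives room because the
    balls are open. The five-fold balls fit into cubes of side 20 d l, the source of the
    constant.\<close>
  define r where "r x = 2 * (d * l x)" for x
  have sub: "cube (A x) (l x) \<subseteq> ball (A x) (r x)" if "x \<in> X" for x
  proof
    fix y assume y: "y \<in> cube (A x) (l x)"
    have a: "A x \<in> cube (A x) (l x)" using Al[OF that] by (simp add: mem_cube)
    have "norm (A x - y) \<le> d * l x" using dist_cube[OF a y] by (simp add: d_def)
    moreover have "0 < d * l x" using Al[OF that] d by simp
    ultimately show "y \<in> ball (A x) (r x)" by (simp add: r_def dist_norm)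
  qed
  have "X \<subseteq> (\<Union>x\<in>X. ball (A x) (r x))" using sub Al by blast
  moreover have "0 < r x \<and> r x \<le> 2 * (d * L)" if "x \<in> X" for x
    using Al[OF that] d by (auto simp: r_def)
  ultimately obtain C where C: "countable C" "C \<subseteq> X" "pairwise (\<lambda>i j. disjnt (ball (A i) (r i)) (ball (A j) (r j))) C"
    "X \<subseteq> (\<Union>i\<in>C. ball (A i) (5 * r i))"
    by (rule Vitali_covering_lemma_balls) blast
  define Q where "Q i = cube (A i) (l i)" for i
  define U where "U = (\<Union>i\<in>C. Q i)"
  have Qm[measurable]: "Q i \<in> sets borel" for i by (simp add: Q_def)
  have U[measurable]: "U \<in> sets borel" unfolding U_def using C(1) by (intro sets.countable_UN'') auto
  have disj: "disjoint_family_on Q C"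
    unfolding disjoint_family_on_def
  proof (intro ballI impI)
    fix i j assume "i \<in> C" "j \<in> C" "i \<noteq> j"
    with C have "disjnt (ball (A i) (r i)) (ball (A j) (r j))" by (auto simp: pairwise_def)
    with sub[of i] sub[of j] C \<open>i \<in> C\<close> \<open>j \<in> C\<close> show "Q i \<inter> Q j = {}"
      unfolding Q_def disjnt_def by blast
  qed
  have eU: "emeasure lborel U = (\<integral>\<^sup>+i. emeasure lborel (Q i) \<partial>count_space C)"
    unfolding U_def by (rule emeasure_UN_countable[OF _ C(1) disj]) simp
  have Usub: "U \<subseteq> cube a0 L" using Al C(2) by (fastforce simp: U_def Q_def)
  have "emeasure lborel U \<le> emeasure lborel (cube a0 L)" using Usub by (intro emeasure_mono) auto
  also have "\<dots> < \<infinity>" using L by (simp add: emeasure_cube)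
  \<comment> \<open>Finiteness of |U| allows the factor |U|^{1-1/p} to be cancelled below.\<close>
  finally have Ufin: "emeasure lborel U < \<infinity>" .
  then have Ueq: "emeasure lborel U = ennreal (measure lborel U)" by (intro emeasure_eq_ennreal_measure) auto
  define Y where "Y = (\<Union>i\<in>C. ball (A i) (5 * r i))"
  have Y: "Y \<in> sets borel" unfolding Y_def using C(1) by (intro sets.countable_UN'') auto
  have "emeasure lborel Y \<le> (\<integral>\<^sup>+i. emeasure lborel (ball (A i) (5 * r i)) \<partial>count_space C)"
    unfolding Y_def using C(1) by (intro emeasure_UN_countable_le) auto
  also have "\<dots> \<le> (\<integral>\<^sup>+i. ennreal ((20 * d) ^ DIM('a)) * emeasure lborel (Q i) \<partial>count_space C)"
  proof (rule nn_integral_mono)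
    fix i assume "i \<in> space (count_space C)"
    then have li: "0 < l i" using C(2) Al by auto
    have "emeasure lborel (ball (A i) (5 * r i)) \<le> emeasure lborel (cball (A i) (5 * r i))"
      by (intro emeasure_mono) auto
    also have "\<dots> = emeasure lborel (cball (0::'a) (5 * r i))"
      by (rule emeasure_lborel_cball_translate)
    also have "\<dots> \<le> ennreal ((2 * (5 * r i)) ^ DIM('a))"
      using li d by (intro emeasure_cball_le) (simp add: r_def)
    also have "2 * (5 * r i) = 20 * d * l i" by (simp add: r_def)
    also have "ennreal ((20 * d * l i) ^ DIM('a)) = ennreal ((20 * d) ^ DIM('a)) * emeasure lborel (Q i)"
      using li d by (simp add: Q_def emeasure_cube power_mult_distrib ennreal_mult)
    finally show "emeasure lborel (ball (A i) (5 * r i)) \<le> ennreal ((20 * d) ^ DIM('a)) * emeasure lborel (Q i)" .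
  qed
  also have "\<dots> = ennreal ((20 * d) ^ DIM('a)) * emeasure lborel U"
    unfolding eU by (rule nn_integral_cmult) simp
  finally have Y_le: "emeasure lborel Y \<le> ennreal ((20 * d) ^ DIM('a) * measure lborel U)"
    using d by (simp add: Ueq ennreal_mult)
  define \<mu> where "\<mu> = measure lborel U"
  have "ennreal \<kappa> * emeasure lborel U = (\<integral>\<^sup>+i. ennreal \<kappa> * emeasure lborel (Q i) \<partial>count_space C)"
    unfolding eU by (rule nn_integral_cmult[symmetric]) simp
  also have "\<dots> \<le> (\<integral>\<^sup>+i. emeasure (density lborel (\<lambda>x. ennreal \<bar>g x\<bar>)) (Q i) \<partial>count_space C)"
  proof (rule nn_integral_mono)
    fix i assume "i \<in> space (count_space C)"
    then have i: "i \<in> X" using C(2) by auto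
    have "ennreal \<kappa> * emeasure lborel (Q i) = ennreal (\<kappa> * l i ^ DIM('a))"
      using Al[OF i] \<kappa> by (simp add: Q_def emeasure_cube ennreal_mult)
    also have "\<dots> \<le> emeasure (density lborel (\<lambda>x. ennreal \<bar>g x\<bar>)) (Q i)"
      using Al[OF i] by (simp add: Q_def emeasure_density)
    finally show "ennreal \<kappa> * emeasure lborel (Q i) \<le> emeasure (density lborel (\<lambda>x. ennreal \<bar>g x\<bar>)) (Q i)" .
  qed
  also have "\<dots> = emeasure (density lborel (\<lambda>x. ennreal \<bar>g x\<bar>)) U"
    unfolding U_def by (rule emeasure_UN_countable[OF _ C(1) disj, symmetric]) simp
  also have "\<dots> = (\<integral>\<^sup>+x\<in>U. ennreal \<bar>g x\<bar> \<partial>lborel)" by (simp add: emeasure_density)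
  also have "\<dots> \<le> ennreal (W * \<mu> powr (1 - 1 / p))" unfolding \<mu>_def by (rule bd[OF U Usub])
  finally have "ennreal (\<kappa> * \<mu>) \<le> ennreal (W * \<mu> powr (1 - 1 / p))"
    using \<kappa> by (simp add: Ueq \<mu>_def ennreal_mult)
  then have le: "\<kappa> * \<mu> \<le> W * \<mu> powr (1 - 1 / p)"
    using W by (subst (asm) ennreal_le_iff) auto
  have "\<mu> \<le> (W / \<kappa>) powr p"
  proof (cases "\<mu> = 0")
    case False
    then have \<mu>: "0 < \<mu>" by (simp add: \<mu>_def less_le)
    have "\<kappa> * \<mu> powr (1 / p) * \<mu> powr (1 - 1 / p) \<le> W * \<mu> powr (1 - 1 / p)"
      using le \<mu> by (simp add: mult.assoc powr_add[symmetric])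
    then have "\<kappa> * \<mu> powr (1 / p) \<le> W" using \<mu> by simp
    then have "\<mu> powr (1 / p) \<le> W / \<kappa>" using \<kappa> by (simp add: field_simps)
    then have "(\<mu> powr (1 / p)) powr p \<le> (W / \<kappa>) powr p" using p by (intro powr_mono2) auto
    then show ?thesis using p \<mu> by (simp add: powr_powr)
  qed simp
  then have "(20 * d) ^ DIM('a) * measure lborel U \<le> (20 * d) ^ DIM('a) * (W / \<kappa>) powr p"
    using d by (intro mult_left_mono) (auto simp: \<mu>_def)
  with Y_le have "emeasure lborel Y \<le> ennreal ((20 * d) ^ DIM('a) * (W / \<kappa>) powr p)"
    by (meson ennreal_leI order_trans)
  with Y C(4) show thesis by (intro that[of Y]) (auto simp: Y_def d_def)
qed

section \<open>Oscillation on large cubes\<close>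

lemma power_measure_powr:
  assumes "0 < l" "1 \<le> p"
  shows "(l ^ n) powr (1 - 1 / p) = l ^ n / l powr (real n / p)"
proof -
  have "(l ^ n) powr (1 - 1 / p) = l powr (real n - real n / p)"
    using assms by (simp add: powr_realpow[symmetric] powr_powr right_diff_distrib)
  then show ?thesis using assms by (simp add: powr_diff powr_realpow)
qed

text \<open>The weight S u^{d/p} is scale invariant: with u = N l and |Q|^{1-1/p} = l^d / l^{d/p}
  all powers of \<open>l\<close> cancel, and N^{d/p} \<le> N^d is left.\<close>

lemma smooth_error_cube:
  fixes f :: "'a::euclidean_space \<Rightarrow> real"
  assumes l: "0 < l" "0 < N" and f: "integrable lborel f" and k: "1 \<le> k" and p: "1 \<le> p" and S: "0 \<le> S"
    and b: "\<And>(f::'a \<Rightarrow> real) h x. (fdiff h ^^ k) f x = (-1) ^ k * (f x - (\<Sum>j=1..k. b j * f (x + real j *\<^sub>R h)))"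
    and bd: "fdiff_bound (cube a' (N * l)) k p (N * l) (S * (N * l) powr (real DIM('a) / p)) f"
    and sub: "cube a l \<subseteq> cube a' (N * l)" and N: "1 \<le> N"
  shows "2 * (\<integral>\<^sup>+y\<in>cube a l. ennreal \<bar>f y - smooth b k (real k * real DIM('a)) a' (N * l) f y\<bar> \<partial>lborel) / ennreal (l ^ DIM('a))
    \<le> ennreal (4 * (4 * (real DIM('a))\<^sup>2) ^ DIM('a) * N ^ DIM('a) * S)"
proof -
  define d where "d = real DIM('a)"
  have d: "1 \<le> d" by (simp add: d_def Suc_leI)
  have kd: "1 \<le> real k * d" "real k \<le> real k * d" using k d mult_mono[of 1 "real k" 1 d] by auto
  have Nl: "0 < N * l" using l by simp
  have "d * (N * l) / (real k * d) = N * l / real k" using d by simp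
  also have "\<dots> \<le> N * l / 1" using k Nl by (intro divide_left_mono) auto
  finally have u: "d * (N * l) / (real k * d) \<le> N * l" by simp
  have "(\<integral>\<^sup>+y\<in>cube a l. ennreal \<bar>f y - smooth b k (real k * d) a' (N * l) f y\<bar> \<partial>lborel)
      \<le> ennreal (2 * (4 * d\<^sup>2) ^ DIM('a) * (S * (N * l) powr (d / p)) * measure lborel (cube a l) powr (1 - 1 / p))"
    unfolding d_def
    by (rule smooth_error_integral[OF Nl f _ _ b p bd]) (use kd u S sub l in \<open>auto simp: d_def\<close>)
  also have "measure lborel (cube a l) powr (1 - 1 / p) = l ^ DIM('a) / l powr (d / p)"
    using l p by (simp add: measure_cube power_measure_powr d_def)
  also have "(N * l) powr (d / p) = N powr (d / p) * l powr (d / p)"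
    using l by (simp add: powr_mult)
  also have "2 * (4 * d\<^sup>2) ^ DIM('a) * (S * (N powr (d / p) * l powr (d / p))) * (l ^ DIM('a) / l powr (d / p))
      = (2 * (4 * d\<^sup>2) ^ DIM('a) * S * l ^ DIM('a)) * N powr (d / p)"
    using l by simp
  also have "\<dots> \<le> (2 * (4 * d\<^sup>2) ^ DIM('a) * S * l ^ DIM('a)) * N ^ DIM('a)"
  proof (intro mult_left_mono)
    have "d / p \<le> d" using p d by (simp add: field_simps)
    then have "N powr (d / p) \<le> N powr d" using N by (intro powr_mono) auto
    then show "N powr (d / p) \<le> N ^ DIM('a)" using l by (simp add: d_def powr_realpow)
  qed (use S l in auto)
  finally have "(\<integral>\<^sup>+y\<in>cube a l. ennreal \<bar>f y - smooth b k (real k * d) a' (N * l) f y\<bar> \<partial>lborel)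
      \<le> ennreal (2 * (4 * d\<^sup>2) ^ DIM('a) * S * l ^ DIM('a) * N ^ DIM('a))" (is "?I \<le> ennreal ?R")
    using ennreal_leI by blast
  then have "2 * ?I / ennreal (l ^ DIM('a)) \<le> 2 * ennreal ?R / ennreal (l ^ DIM('a))"
    by (intro divide_right_mono_ennreal mult_left_mono) auto
  also have "2 * ennreal ?R = ennreal (2 * ?R)" using S l N by (subst ennreal_mult) auto
  also have "ennreal (2 * ?R) / ennreal (l ^ DIM('a)) = ennreal (2 * ?R / l ^ DIM('a))"
    using S l N by (intro divide_ennreal) auto
  also have "2 * ?R / l ^ DIM('a) = 4 * (4 * d\<^sup>2) ^ DIM('a) * N ^ DIM('a) * S"
    using l by simp
  finally show ?thesis by (simp add: d_def)
qed

text \<open>A smoothing at scale N l varies little over a cube of side \<open>l\<close>: in the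
  coefficient of the oscillation on the enlarged cube the powers of \<open>l\<close> cancel and C2
  \<rho>^{d+1} d / N is left. Once this is at most 1/2, the same constant \<open>D\<close> survives
  every enlargement.\<close>

lemma mean_osc_large_cubes:
  fixes k :: nat and p :: real
  assumes k: "1 \<le> k" and p: "1 \<le> p"
  obtains D where "0 < D"
    "\<And>(f::'a::euclidean_space \<Rightarrow> real) a0 L t S a l. integrable lborel f \<Longrightarrow> 0 < t \<Longrightarrow> 0 \<le> S \<Longrightarrow>
      (\<And>u. t \<le> u \<Longrightarrow> u \<le> L \<Longrightarrow> fdiff_bound (cube a0 L) k p u (S * u powr (real DIM('a) / p)) f) \<Longrightarrow>
      cube a l \<subseteq> cube a0 L \<Longrightarrow> t \<le> l \<Longrightarrow> l \<le> L \<Longrightarrow>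
      mean_osc f (cube a l) \<le> ennreal D * (ennreal S + mean_osc f (cube a0 L))"
proof -
  define d where "d = real DIM('a)"
  have d: "1 \<le> d" by (simp add: d_def Suc_leI)
  obtain b :: "nat \<Rightarrow> real" where b1: "(\<Sum>j=1..k. b j) = 1" and
    b: "\<And>(f::'a \<Rightarrow> real) h x. (fdiff h ^^ k) f x = (-1) ^ k * (f x - (\<Sum>j=1..k. b j * f (x + real j *\<^sub>R h)))"
    using fdiff_funpow_coeffs[OF k, where 'a='a] by blast
  define \<rho> where "\<rho> = real k * d"
  have \<rho>: "1 \<le> \<rho>" "real k \<le> \<rho>" using k d mult_mono[of 1 "real k" 1 d] by (auto simp: \<rho>_def)
  define C1 where "C1 = 4 * (4 * d\<^sup>2) ^ DIM('a)"
  define C2 where "C2 = 8 * (2 * d) ^ DIM('a) * (\<Sum>j=1..k. \<bar>b j\<bar>)"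
  have C1: "0 < C1" and C2: "0 \<le> C2" using d by (auto simp: C1_def C2_def intro!: mult_nonneg_nonneg sum_nonneg)
  \<comment> \<open>Makes the coefficient of the oscillation on the enlarged cube at most
    1/2.\<close>
  define N where "N = max 2 (2 * (C2 * \<rho> ^ (DIM('a) + 1) * d))"
  have N: "2 \<le> N" "2 * (C2 * \<rho> ^ (DIM('a) + 1) * d) \<le> N" by (auto simp: N_def)
  \<comment> \<open>The first summand makes C1 N^d S at most D S/2, so that a step with coefficient
    1/2 reproduces \<open>D\<close>. The second pays for the final comparison with the big cube,
    whose volume is then at most N^d times as large.\<close>
  define D where "D = 2 * C1 * N ^ DIM('a) + 2 * N ^ DIM('a)"
  have D: "0 < D" using C1 N by (auto simp: D_def intro!: add_pos_pos mult_pos_pos)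
  have main: "mean_osc f (cube a l) \<le> ennreal D * (ennreal S + mean_osc f (cube a0 L))"
    if f: "integrable lborel f" and t: "0 < t" and S: "0 \<le> S"
      and bd: "\<And>u. t \<le> u \<Longrightarrow> u \<le> L \<Longrightarrow> fdiff_bound (cube a0 L) k p u (S * u powr (real DIM('a) / p)) f"
      and sub: "cube a l \<subseteq> cube a0 L" and l: "t \<le> l" "l \<le> L"
    for f :: "'a \<Rightarrow> real" and a0 L t S a l
  proof -
    define A0 where "A0 = mean_osc f (cube a0 L)"
    \<comment> \<open>\<open>n\<close> bounds the number of enlargements by the factor
      \<open>N\<close> until the side \<open>L\<close> is reached.\<close>
    have claim: "mean_osc f (cube a l) \<le> ennreal D * (ennreal S + A0)"
      if "L \<le> N ^ n * l" "cube a l \<subseteq> cube a0 L" "t \<le> l" "l \<le> L" for n a l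
      using that
    proof (induction n arbitrary: a l rule: nat.induct)
      case zero
      then have "l = L" by simp
      have "mean_osc f (cube a l) \<le> ennreal (2 * (L / l) ^ DIM('a)) * A0"
        unfolding A0_def using zero t by (intro mean_osc_mono[OF f]) auto
      also have "\<dots> \<le> ennreal D * (ennreal S + A0)"
      proof (intro mult_mono ennreal_leI)
        have "1 \<le> N ^ DIM('a)" using N by simp
        moreover have "0 \<le> 2 * C1 * N ^ DIM('a)" using C1 N by simp
        ultimately show "2 * (L / l) ^ DIM('a) \<le> D" using \<open>l = L\<close> t zero by (simp add: D_def)
      qed auto
      finally show ?case .
    next
      case (Suc n)
      have l0: "0 < l" using t Suc.prems by simp
      show ?case
      proof (cases "L \<le> N * l")
        case True
        have "mean_osc f (cube a l) \<le> ennreal (2 * (L / l) ^ DIM('a)) * A0"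
          unfolding A0_def using Suc.prems t by (intro mean_osc_mono[OF f]) auto
        also have "\<dots> \<le> ennreal D * (ennreal S + A0)"
        proof (intro mult_mono ennreal_leI)
          have "L / l \<le> N" using True l0 by (simp add: field_simps)
          then have "(L / l) ^ DIM('a) \<le> N ^ DIM('a)" using l0 Suc.prems by (intro power_mono) auto
          moreover have "0 \<le> 2 * C1 * N ^ DIM('a)" using C1 N by simp
          ultimately show "2 * (L / l) ^ DIM('a) \<le> D" by (simp add: D_def)
        qed auto
        finally show ?thesis .
      next
        case False
        then have NL: "N * l \<le> L" by simp
        have lNl: "l \<le> N * l" using N l0 by simp
        obtain a' where a': "cube a' (N * l) \<subseteq> cube a0 L"
          "\<And>x y. x \<in> cube a l \<Longrightarrow> y \<in> cube a0 L \<Longrightarrow> (\<And>b. b \<in> Basis \<Longrightarrow> \<bar>y \<bullet> b - x \<bullet> b\<bar> \<le> 0) \<Longrightarrow> y \<in> cube a' (N * l)"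
          using cube_extend[OF Suc.prems(2), of "N * l" 0] NL lNl l0 by auto
        have sub': "cube a l \<subseteq> cube a' (N * l)"
          using a'(2)[of x x for x] Suc.prems(2) by auto
        have IH: "mean_osc f (cube a' (N * l)) \<le> ennreal D * (ennreal S + A0)"
          using Suc.prems a' NL lNl by (intro Suc.IH) (auto simp: mult_ac)
        have tNl: "t \<le> N * l" using lNl Suc.prems by simp
        have bd': "fdiff_bound (cube a' (N * l)) k p (N * l) (S * (N * l) powr (real DIM('a) / p)) f"
          by (rule fdiff_bound_subset[OF bd[OF tNl NL] a'(1) order.refl])
        have "mean_osc f (cube a l) \<le>
            2 * (\<integral>\<^sup>+y\<in>cube a l. ennreal \<bar>f y - smooth b k \<rho> a' (N * l) f y\<bar> \<partial>lborel) / ennreal (l ^ DIM('a))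
            + ennreal (C2 * (\<rho> / (N * l)) ^ (DIM('a) + 1) * (d * l) * (N * l) ^ DIM('a)) * mean_osc f (cube a' (N * l))"
          unfolding C2_def d_def
        proof (rule mean_osc_smooth_le[OF f b1 \<rho>])
          fix v w :: 'a and j assume w: "w \<in> cube a l" and j: "j \<in> {1..k}"
            and z: "w + (\<rho> / real j) *\<^sub>R (v - w) \<in> cube a' (N * l)"
          have "v = (1 - real j / \<rho>) *\<^sub>R w + (real j / \<rho>) *\<^sub>R (w + (\<rho> / real j) *\<^sub>R (v - w))"
            using j \<rho> by (simp add: algebra_simps)
          also have "\<dots> \<in> cube a' (N * l)"
            by (rule convexD[OF convex_cube]) (use w z sub' \<rho> j in auto)
          finally show "v \<in> cube a' (N * l)" .
        qed (use l0 N in auto)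
        also have "\<dots> \<le> ennreal (C1 * N ^ DIM('a) * S) + ennreal (1 / 2) * (ennreal D * (ennreal S + A0))"
        proof (intro add_mono mult_mono IH ennreal_leI)
          show "2 * (\<integral>\<^sup>+y\<in>cube a l. ennreal \<bar>f y - smooth b k \<rho> a' (N * l) f y\<bar> \<partial>lborel) / ennreal (l ^ DIM('a))
            \<le> ennreal (C1 * N ^ DIM('a) * S)"
            unfolding \<rho>_def C1_def d_def
            by (rule smooth_error_cube[OF l0 _ f k p S b bd' sub']) (use N in auto)
          have "C2 * (\<rho> / (N * l)) ^ (DIM('a) + 1) * (d * l) * (N * l) ^ DIM('a) = C2 * \<rho> ^ (DIM('a) + 1) * d / N"
            using l0 N by (simp add: power_divide)
          also have "\<dots> \<le> 1 / 2" using N by (simp add: field_simps)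
          finally show "C2 * (\<rho> / (N * l)) ^ (DIM('a) + 1) * (d * l) * (N * l) ^ DIM('a) \<le> 1 / 2" .
        qed auto
        also have "\<dots> \<le> ennreal (D / 2) * (ennreal S + A0) + ennreal (D / 2) * (ennreal S + A0)"
        proof (intro add_mono)
          have "ennreal (C1 * N ^ DIM('a) * S) \<le> ennreal (D / 2 * S)"
            using S N by (intro ennreal_leI mult_right_mono) (auto simp: D_def)
          also have "\<dots> = ennreal (D / 2) * ennreal S" using D S by (intro ennreal_mult) auto
          also have "\<dots> \<le> ennreal (D / 2) * (ennreal S + A0)" by (intro mult_left_mono) auto
          finally show "ennreal (C1 * N ^ DIM('a) * S) \<le> ennreal (D / 2) * (ennreal S + A0)" .
          show "ennreal (1 / 2) * (ennreal D * (ennreal S + A0)) \<le> ennreal (D / 2) * (ennreal S + A0)"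
          proof -
            have "ennreal (D / 2) = ennreal (1 / 2) * ennreal D" using D by (subst ennreal_mult[symmetric]) auto
            then show ?thesis by (simp only: mult.assoc order.refl)
          qed
        qed
        also have "\<dots> = ennreal D * (ennreal S + A0)"
          using D by (simp add: distrib_right[symmetric] ennreal_plus[symmetric] del: ennreal_plus)
        finally show ?thesis .
      qed
    qed
    obtain n where "L / l < N ^ n" using real_arch_pow[of N "L / l"] N by auto
    then have "L \<le> N ^ n * l" using t l by (simp add: field_simps)
    from claim[OF this sub l] show ?thesis by (simp add: A0_def)
  qed
  show thesis by (rule that[OF D]) (rule main)
qed

section \<open>Level sets of the sharp maximal function\<close>

text \<open>One smoothing, built on the big cube, serves all small cubes at once, so the remainder
  is a single function to which the weak-type inequality applies. The choice \<rho> = k d L/t keeps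
  the points \<open>x + j h\<close> within \<open>t\<close> of \<open>x\<close> in each coordinate,
  although \<open>x + \<rho> h\<close> may range over the whole big cube.\<close>

lemma mean_osc_small_cubes:
  fixes f :: "'a::euclidean_space \<Rightarrow> real"
  assumes f: "integrable lborel f" and k: "1 \<le> k" and b1: "(\<Sum>j=1..k. b j) = 1"
    and t: "0 < t" "t \<le> L" and l: "0 < l" "l \<le> t" and sub: "cube a l \<subseteq> cube a0 L"
  obtains g m where "cube g m \<subseteq> cube a0 L" "t \<le> m" "m \<le> L"
    "mean_osc f (cube a l) \<le>
      2 * (\<integral>\<^sup>+y\<in>cube a l. ennreal \<bar>f y - smooth b k (real k * real DIM('a) * L / t) a0 L f y\<bar> \<partial>lborel) / ennreal (l ^ DIM('a))
      + ennreal (8 * (2 * real DIM('a)) ^ DIM('a) * (\<Sum>j=1..k. \<bar>b j\<bar>) * (real k * real DIM('a)) ^ (DIM('a) + 1)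
          * real DIM('a) * 3 ^ DIM('a)) * mean_osc f (cube g m)"
proof -
  define d where "d = real DIM('a)"
  have d: "1 \<le> d" by (simp add: d_def Suc_leI)
  define \<rho> where "\<rho> = real k * d * L / t"
  have kd: "1 \<le> real k * d" "real k \<le> real k * d" using k d mult_mono[of 1 "real k" 1 d] by auto
  have "real k * d * 1 \<le> real k * d * (L / t)" using kd t by (intro mult_left_mono) (auto simp: field_simps)
  then have \<rho>: "1 \<le> \<rho>" "real k \<le> \<rho>" using kd by (auto simp: \<rho>_def)
  \<comment> \<open>Room \<open>t\<close> on both sides of a cube of side at most \<open>t\<close>,
    unless the big cube is smaller than that.\<close>
  define m where "m = min (3 * t) L"
  have m: "t \<le> m" "m \<le> L" "m \<le> 3 * t" using t by (auto simp: m_def)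
  have ext: "0 \<le> l" "m \<le> L" "l + 2 * t \<le> m \<or> m = L" using l t by (auto simp: m_def)
  obtain g where g: "cube g m \<subseteq> cube a0 L"
    "\<And>x y. x \<in> cube a l \<Longrightarrow> y \<in> cube a0 L \<Longrightarrow> (\<And>b. b \<in> Basis \<Longrightarrow> \<bar>y \<bullet> b - x \<bullet> b\<bar> \<le> t) \<Longrightarrow> y \<in> cube g m"
    using cube_extend[OF sub ext] by blast
  have "mean_osc f (cube a l) \<le>
      2 * (\<integral>\<^sup>+y\<in>cube a l. ennreal \<bar>f y - smooth b k \<rho> a0 L f y\<bar> \<partial>lborel) / ennreal (l ^ DIM('a))
      + ennreal (8 * (2 * d) ^ DIM('a) * (\<Sum>j=1..k. \<bar>b j\<bar>) * (\<rho> / L) ^ (DIM('a) + 1) * (d * l) * m ^ DIM('a)) * mean_osc f (cube g m)"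
    unfolding d_def
  proof (rule mean_osc_smooth_le[OF f b1 \<rho>])
    fix v w :: 'a and j assume w: "w \<in> cube a l" and j: "j \<in> {1..k}"
      and z: "w + (\<rho> / real j) *\<^sub>R (v - w) \<in> cube a0 L"
    define y where "y = w + (\<rho> / real j) *\<^sub>R (v - w)"
    have j0: "0 < real j" "real j \<le> real k" using j by auto
    have veq: "v = (1 - real j / \<rho>) *\<^sub>R w + (real j / \<rho>) *\<^sub>R y"
      using j0 \<rho> by (simp add: y_def algebra_simps)
    have w0: "w \<in> cube a0 L" using w sub by auto
    have v0: "v \<in> cube a0 L" unfolding veq
      by (rule convexD[OF convex_cube]) (use w0 z j0 \<rho> in \<open>auto simp: y_def\<close>)
    show "v \<in> cube g m"
    proof (rule g(2)[OF w v0])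
      fix b :: 'a assume b: "b \<in> Basis"
      have "v \<bullet> b - w \<bullet> b = (real j / \<rho>) * (y \<bullet> b - w \<bullet> b)"
        unfolding veq by (simp add: inner_add_left inner_diff_left algebra_simps)
      moreover have "a0 \<bullet> b \<le> w \<bullet> b \<and> w \<bullet> b \<le> a0 \<bullet> b + L" "a0 \<bullet> b \<le> y \<bullet> b \<and> y \<bullet> b \<le> a0 \<bullet> b + L"
        using w0 z b unfolding mem_cube y_def[symmetric] by blast+
      then have "\<bar>y \<bullet> b - w \<bullet> b\<bar> \<le> L" by linarith
      ultimately have "\<bar>v \<bullet> b - w \<bullet> b\<bar> \<le> (real j / \<rho>) * L"
        using j0 \<rho> by (simp add: abs_mult mult_left_mono divide_right_mono)
      also have "\<dots> = real j * t / (real k * d)" using t by (simp add: \<rho>_def)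
      also have "\<dots> \<le> real k * t / (real k * d)" using j0 t kd by (intro divide_right_mono mult_right_mono) auto
      also have "\<dots> = t / d" using k by simp
      also have "\<dots> \<le> t / 1" using d t by (intro divide_left_mono) auto
      finally show "\<bar>v \<bullet> b - w \<bullet> b\<bar> \<le> t" by simp
    qed
  qed (use l t m in auto)
  also have "\<dots> \<le> 2 * (\<integral>\<^sup>+y\<in>cube a l. ennreal \<bar>f y - smooth b k \<rho> a0 L f y\<bar> \<partial>lborel) / ennreal (l ^ DIM('a))
      + ennreal (8 * (2 * d) ^ DIM('a) * (\<Sum>j=1..k. \<bar>b j\<bar>) * (real k * d) ^ (DIM('a) + 1) * d * 3 ^ DIM('a)) * mean_osc f (cube g m)"
  proof (intro add_left_mono mult_right_mono ennreal_leI)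
    have "(\<rho> / L) ^ (DIM('a) + 1) * (d * l) * m ^ DIM('a) \<le> (\<rho> / L) ^ (DIM('a) + 1) * (d * t) * (3 * t) ^ DIM('a)"
      using \<rho> t d l m by (intro mult_mono power_mono mult_left_mono) auto
    also have "\<dots> = (real k * d) ^ (DIM('a) + 1) * d * 3 ^ DIM('a)"
      using t by (simp add: \<rho>_def power_divide power_mult_distrib)
    finally have "8 * (2 * d) ^ DIM('a) * (\<Sum>j=1..k. \<bar>b j\<bar>) * ((\<rho> / L) ^ (DIM('a) + 1) * (d * l) * m ^ DIM('a))
        \<le> 8 * (2 * d) ^ DIM('a) * (\<Sum>j=1..k. \<bar>b j\<bar>) * ((real k * d) ^ (DIM('a) + 1) * d * 3 ^ DIM('a))"
      using d by (intro mult_left_mono mult_nonneg_nonneg sum_nonneg) auto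
    then show "8 * (2 * d) ^ DIM('a) * (\<Sum>j=1..k. \<bar>b j\<bar>) * (\<rho> / L) ^ (DIM('a) + 1) * (d * l) * m ^ DIM('a)
        \<le> 8 * (2 * d) ^ DIM('a) * (\<Sum>j=1..k. \<bar>b j\<bar>) * (real k * d) ^ (DIM('a) + 1) * d * 3 ^ DIM('a)"
      by (simp only: mult.assoc)
  qed simp
  finally show thesis using that[OF g(1) m(1,2)] by (simp add: \<rho>_def d_def)
qed

text \<open>A cube of side at least \<open>t\<close> cannot exceed the level, by
  \<open>mean_osc_large_cubes\<close>. On a smaller cube the Lipschitz part is controlled through a
  cube \<open>g\<close> of side at least \<open>t\<close>, so exceeding the level forces a large
  mean of the remainder \<open>h\<close>, and \<open>weak_type_maximal\<close> covers all such
  points.\<close>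

lemma sharp_level_set:
  fixes k :: nat and p :: real
  assumes k: "1 \<le> k" and p: "1 \<le> p"
  obtains C where "0 < C"
    "\<And>(f::'a::euclidean_space \<Rightarrow> real) a0 L t S. integrable lborel f \<Longrightarrow> 0 < t \<Longrightarrow> t \<le> L \<Longrightarrow> 0 < S \<Longrightarrow>
      (\<And>u. t \<le> u \<Longrightarrow> u \<le> L \<Longrightarrow> fdiff_bound (cube a0 L) k p u (S * u powr (real DIM('a) / p)) f) \<Longrightarrow>
      \<exists>Y\<in>sets borel. {x \<in> cube a0 L. ennreal C * (ennreal S + mean_osc f (cube a0 L)) < sharp (cube a0 L) f x} \<subseteq> Y
        \<and> emeasure lborel Y \<le> ennreal (t ^ DIM('a))"
proof -
  define d where "d = real DIM('a)"
  have d: "1 \<le> d" by (simp add: d_def Suc_leI)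
  obtain b :: "nat \<Rightarrow> real" where b1: "(\<Sum>j=1..k. b j) = 1" and
    b: "\<And>(f::'a \<Rightarrow> real) h x. (fdiff h ^^ k) f x = (-1) ^ k * (f x - (\<Sum>j=1..k. b j * f (x + real j *\<^sub>R h)))"
    using fdiff_funpow_coeffs[OF k, where 'a='a] by blast
  obtain D where D: "0 < D" and large:
    "\<And>(f::'a \<Rightarrow> real) a0 L t S a l. integrable lborel f \<Longrightarrow> 0 < t \<Longrightarrow> 0 \<le> S \<Longrightarrow>
      (\<And>u. t \<le> u \<Longrightarrow> u \<le> L \<Longrightarrow> fdiff_bound (cube a0 L) k p u (S * u powr (real DIM('a) / p)) f) \<Longrightarrow>
      cube a l \<subseteq> cube a0 L \<Longrightarrow> t \<le> l \<Longrightarrow> l \<le> L \<Longrightarrow>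
      mean_osc f (cube a l) \<le> ennreal D * (ennreal S + mean_osc f (cube a0 L))"
    using mean_osc_large_cubes[OF k p, where 'a='a] by blast
  define C1 where "C1 = 2 * (4 * d\<^sup>2) ^ DIM('a)"
  define C2 where "C2 = 8 * (2 * d) ^ DIM('a) * (\<Sum>j=1..k. \<bar>b j\<bar>) * (real k * d) ^ (DIM('a) + 1) * d * 3 ^ DIM('a)"
  define V where "V = (20 * d) ^ DIM('a)"
  have C1: "0 < C1" and C2: "0 \<le> C2" using d by (auto simp: C1_def C2_def intro!: mult_nonneg_nonneg sum_nonneg)
  have V: "1 \<le> V" unfolding V_def using d by (intro one_le_power) simp
  \<comment> \<open>The summands pay for cubes of side at least \<open>t\<close>, for the Lipschitz
    part on smaller cubes, and for the remainder.\<close>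
  define C where "C = D + C2 * D + 2 * C1 * V"
  have C: "0 < C" "D \<le> C" using C1 C2 D V by (auto simp: C_def intro!: add_pos_nonneg)
  have main: "\<exists>Y\<in>sets borel. {x \<in> cube a0 L. ennreal C * (ennreal S + mean_osc f (cube a0 L)) < sharp (cube a0 L) f x} \<subseteq> Y
        \<and> emeasure lborel Y \<le> ennreal (t ^ DIM('a))"
    if f: "integrable lborel f" and t: "0 < t" "t \<le> L" and S: "0 < S"
      and bd: "\<And>u. t \<le> u \<Longrightarrow> u \<le> L \<Longrightarrow> fdiff_bound (cube a0 L) k p u (S * u powr (real DIM('a) / p)) f"
    for f :: "'a \<Rightarrow> real" and a0 L t S
  proof -
    define A where "A = ennreal S + mean_osc f (cube a0 L)"
    define \<rho> where "\<rho> = real k * d * L / t"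
    have fm[measurable]: "f \<in> borel_measurable borel" using f by auto
    have kd: "1 \<le> real k * d" "real k \<le> real k * d" using k d mult_mono[of 1 "real k" 1 d] by auto
    have "real k * d * 1 \<le> real k * d * (L / t)" using kd t by (intro mult_left_mono) (auto simp: field_simps)
    then have \<rho>: "1 \<le> \<rho>" "real k \<le> \<rho>" using kd by (auto simp: \<rho>_def)
    have L: "0 < L" using t by simp
    define h where "h x = f x - smooth b k \<rho> a0 L f x" for x
    have h[measurable]: "h \<in> borel_measurable borel" unfolding h_def[abs_def] by measurable
    define W where "W = C1 * (S * t powr (d / p))"
    have W: "0 \<le> W" using C1 S by (simp add: W_def)
    have hW: "(\<integral>\<^sup>+x\<in>E. ennreal \<bar>h x\<bar> \<partial>lborel) \<le> ennreal (W * measure lborel E powr (1 - 1 / p))"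
      if "E \<in> sets borel" "E \<subseteq> cube a0 L" for E
    proof -
      have bd': "fdiff_bound (cube a0 L) k p t (S * t powr (d / p)) f"
        using bd[of t] t by (simp add: d_def)
      have "real DIM('a) * L / \<rho> = t / real k" using L d by (simp add: \<rho>_def d_def)
      also have "\<dots> \<le> t / 1" using k t by (intro divide_left_mono) auto
      finally have u: "real DIM('a) * L / \<rho> \<le> t" by simp
      show ?thesis unfolding h_def W_def C1_def d_def
        using smooth_error_integral[OF L f \<rho> b p bd' _ u that] S by (simp add: d_def)
    qed
    \<comment> \<open>The factor \<open>V\<close> in the level turns the weak-type bound into V
      (t^{d/p}/V)^p = V^{1-p} t^d \<le> t^d, so the cover has measure at most t^d with no constant
      in front.\<close>
    define \<kappa> where "\<kappa> = C1 * V * S"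
    have \<kappa>: "0 < \<kappa>" using C1 V S by (simp add: \<kappa>_def)
    define X where "X = {x \<in> cube a0 L. ennreal C * A < sharp (cube a0 L) f x}"
    have X: "\<exists>a l. 0 < l \<and> x \<in> cube a l \<and> cube a l \<subseteq> cube a0 L \<and> l \<le> L \<and>
              ennreal (\<kappa> * l ^ DIM('a)) \<le> (\<integral>\<^sup>+x\<in>cube a l. ennreal \<bar>h x\<bar> \<partial>lborel)" if x: "x \<in> X" for x
    proof -
      from x obtain Q where Q: "Q \<in> cubes" "x \<in> Q" "Q \<subseteq> cube a0 L" "ennreal C * A < mean_osc f Q"
        unfolding X_def sharp_eq by (auto simp: less_SUP_iff)
      then obtain a l where al: "Q = cube a l" "0 < l" unfolding cubes_eq by blast
      have lL: "l \<le> L"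
      proof -
        obtain e :: 'a where e: "e \<in> Basis" using nonempty_Basis by blast
        have "a \<in> cube a l" "a + l *\<^sub>R (\<Sum>Basis) \<in> cube a l"
          using al by (auto simp: mem_cube inner_add_left sum_Basis_inner)
        then have "a \<in> cube a0 L" "a + l *\<^sub>R (\<Sum>Basis) \<in> cube a0 L"
          using Q(3) al by auto
        then have "a0 \<bullet> e \<le> a \<bullet> e" "a \<bullet> e + l \<le> a0 \<bullet> e + L"
          using e by (auto simp: mem_cube inner_add_left sum_Basis_inner)
        then show ?thesis by linarith
      qed
      have "l < t"
      proof (rule ccontr)
        assume "\<not> l < t"
        then have "mean_osc f Q \<le> ennreal D * A"
          unfolding A_def al(1) using S lL Q(3) al by (intro large[OF f t(1) _ bd]) auto
        also have "\<dots> \<le> ennreal C * A" using C by (intro mult_right_mono ennreal_leI) auto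
        finally show False using Q(4) by simp
      qed
      then have lt: "l \<le> t" by simp
      obtain g m where g: "cube g m \<subseteq> cube a0 L" "t \<le> m" "m \<le> L" and
        osc: "mean_osc f (cube a l) \<le> 2 * (\<integral>\<^sup>+y\<in>cube a l. ennreal \<bar>h y\<bar> \<partial>lborel) / ennreal (l ^ DIM('a))
          + ennreal C2 * mean_osc f (cube g m)"
        using mean_osc_small_cubes[OF f k b1 t al(2) lt Q(3)[unfolded al(1)]]
        unfolding C2_def h_def \<rho>_def d_def by blast
      define J where "J = (\<integral>\<^sup>+y\<in>cube a l. ennreal \<bar>h y\<bar> \<partial>lborel)"
      have "mean_osc f (cube g m) \<le> ennreal D * A"
        unfolding A_def using S g by (intro large[OF f t(1) _ bd]) auto
      then have "2 * J / ennreal (l ^ DIM('a)) + ennreal C2 * mean_osc f (cube g m)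
          \<le> 2 * J / ennreal (l ^ DIM('a)) + ennreal C2 * (ennreal D * A)"
        by (intro add_left_mono mult_left_mono) auto
      with osc have "mean_osc f (cube a l) \<le> 2 * J / ennreal (l ^ DIM('a)) + ennreal C2 * (ennreal D * A)"
        unfolding J_def by (rule order_trans)
      then have lt1: "ennreal C * A < 2 * J / ennreal (l ^ DIM('a)) + ennreal C2 * (ennreal D * A)"
        using Q(4) al by (metis order.strict_trans2)
      have "\<not> J < ennreal (\<kappa> * l ^ DIM('a))"
      proof
        assume "J < ennreal (\<kappa> * l ^ DIM('a))"
        then have "2 * J / ennreal (l ^ DIM('a)) \<le> 2 * ennreal (\<kappa> * l ^ DIM('a)) / ennreal (l ^ DIM('a))"
          by (intro divide_right_mono_ennreal mult_left_mono) auto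
        also have "2 * ennreal (\<kappa> * l ^ DIM('a)) = ennreal (2 * (\<kappa> * l ^ DIM('a)))"
          using \<kappa> al by (subst ennreal_mult) auto
        also have "ennreal (2 * (\<kappa> * l ^ DIM('a))) / ennreal (l ^ DIM('a)) = ennreal (2 * \<kappa>)"
          using \<kappa> al by (subst divide_ennreal) auto
        also have "\<dots> = ennreal (2 * C1 * V) * ennreal S"
          using C1 V S by (simp add: \<kappa>_def ennreal_mult mult_ac)
        also have "\<dots> \<le> ennreal (2 * C1 * V) * A" by (intro mult_left_mono) (auto simp: A_def)
        finally have "2 * J / ennreal (l ^ DIM('a)) + ennreal C2 * (ennreal D * A)
            \<le> ennreal (2 * C1 * V) * A + ennreal C2 * (ennreal D * A)" by (rule add_right_mono)
        also have "\<dots> = (ennreal (2 * C1 * V) + ennreal (C2 * D)) * A"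
          unfolding ennreal_mult[OF C2 less_imp_le[OF D]] by (simp only: distrib_right mult.assoc)
        also have "\<dots> = ennreal (2 * C1 * V + C2 * D) * A" using C1 V C2 D by simp
        also have "\<dots> \<le> ennreal C * A" using D by (intro mult_right_mono ennreal_leI) (auto simp: C_def)
        finally show False using lt1 by simp
      qed
      then show ?thesis using al Q lL by (intro exI[of _ a] exI[of _ l]) (auto simp: J_def)
    qed
    obtain Y where Y: "Y \<in> sets borel" "X \<subseteq> Y"
      "emeasure lborel Y \<le> ennreal ((20 * real DIM('a)) ^ DIM('a) * (W / \<kappa>) powr p)"
      by (rule weak_type_maximal[OF h L p W \<kappa> hW X])
    have "(20 * real DIM('a)) ^ DIM('a) * (W / \<kappa>) powr p = V * (t powr (d / p) / V) powr p"
      using C1 S by (simp add: V_def d_def W_def \<kappa>_def)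
    also have "\<dots> = V / V powr p * t ^ DIM('a)"
      using t p V by (simp add: powr_divide powr_powr d_def powr_realpow)
    also have "\<dots> \<le> 1 * t ^ DIM('a)"
    proof (rule mult_right_mono)
      have "V powr 1 \<le> V powr p" using p V by (intro powr_mono) auto
      then show "V / V powr p \<le> 1" using V by simp
    qed (use t in auto)
    finally have "emeasure lborel Y \<le> ennreal (t ^ DIM('a))"
      using Y(3) by (simp add: ennreal_leI order_trans)
    with Y show ?thesis by (auto simp: X_def A_def)
  qed
  show thesis by (rule that[OF C(1)]) (rule main)
qed

section \<open>Lorentz quasi-norms\<close>

lemma epowr_mono: "x \<le> y \<Longrightarrow> 0 \<le> a \<Longrightarrow> epowr x a \<le> epowr y a"
proof -
  assume xy: "x \<le> y" and a: "0 \<le> a"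
  show ?thesis
  proof (cases "y = \<infinity>")
    case True then show ?thesis by (simp add: epowr_def)
  next
    case False
    then have "x < \<infinity>" "y < \<infinity>" using xy by (auto simp: less_top[symmetric] top_unique)
    then show ?thesis using xy a
      by (auto simp: epowr_def intro!: ennreal_leI powr_mono2 enn2real_mono)
  qed
qed

lemma epowr_ennreal: "0 \<le> x \<Longrightarrow> epowr (ennreal x) a = ennreal (x powr a)"
  by (simp add: epowr_def)

lemma epowr_mult: "0 < a \<Longrightarrow> epowr (x * y) a = epowr x a * epowr y a"
proof (cases x; cases y)
  fix s t assume a: "0 < a" and *: "x = ennreal s" "0 \<le> s" "y = ennreal t" "0 \<le> t"
  then show ?thesis by (simp add: ennreal_mult[symmetric] epowr_ennreal powr_mult)
next
  fix s assume a: "0 < a" and *: "x = ennreal s" "0 \<le> s" "y = top"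
  then show ?thesis
    by (cases "s = 0") (auto simp: epowr_def ennreal_mult_top ennreal_top_mult)
next
  fix s assume a: "0 < a" and *: "y = ennreal s" "0 \<le> s" "x = top"
  then show ?thesis
    by (cases "s = 0") (auto simp: epowr_def ennreal_mult_top ennreal_top_mult)
qed (auto simp: epowr_def ennreal_mult_top ennreal_top_mult)

lemma epowr_inverse: "0 < a \<Longrightarrow> epowr (epowr x a) (1 / a) = x"
  by (cases x) (auto simp: epowr_def powr_powr)

lemma epowr_le_iff: "0 < a \<Longrightarrow> epowr x a \<le> epowr y a \<longleftrightarrow> x \<le> y"
  by (metis epowr_mono epowr_inverse divide_nonneg_pos zero_le_one less_imp_le)

lemma epowr_measurable [measurable]: "(\<lambda>x. epowr x a) \<in> borel_measurable borel"
  unfolding epowr_def by measurable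

lemma enn2real_pos: "0 < q \<Longrightarrow> q \<noteq> \<infinity> \<Longrightarrow> 0 < enn2real q"
  by (simp add: enn2real_positive_iff less_top)

text \<open>For dt/t the interval [a, 2a] has mass at least 1/2, which is where the factor 2 comes
  from.\<close>

lemma le_integral_dtt:
  fixes m :: ennreal
  assumes a: "0 < a" and I: "{a..2 * a} \<subseteq> I" and u: "\<And>s. s \<in> {a..2 * a} \<Longrightarrow> m \<le> u s"
  shows "m \<le> 2 * (\<integral>\<^sup>+t\<in>I. (u t * ennreal (1 / t)) \<partial>lborel)"
proof -
  have "m * ennreal (1 / 2) = m * ennreal (1 / (2 * a)) * emeasure lborel {a..2 * a}"
    using a by (simp add: mult.assoc ennreal_mult[symmetric])
  also have "\<dots> = (\<integral>\<^sup>+t\<in>{a..2 * a}. (m * ennreal (1 / (2 * a))) \<partial>lborel)"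
    by (simp add: nn_integral_cmult_indicator)
  also have "\<dots> \<le> (\<integral>\<^sup>+t\<in>I. (u t * ennreal (1 / t)) \<partial>lborel)"
  proof (rule nn_integral_mono)
    fix t
    show "m * ennreal (1 / (2 * a)) * indicator {a..2 * a} t \<le> u t * ennreal (1 / t) * indicator I t"
    proof (cases "t \<in> {a..2 * a}")
      case True
      then have "m * ennreal (1 / (2 * a)) \<le> u t * ennreal (1 / t)"
        using a by (intro mult_mono u ennreal_leI divide_left_mono) auto
      then show ?thesis using True I by auto
    qed simp
  qed
  finally have "2 * (m * ennreal (1 / 2)) \<le> 2 * (\<integral>\<^sup>+t\<in>I. (u t * ennreal (1 / t)) \<partial>lborel)"
    by (rule mult_left_mono) simp
  moreover have "2 * (m * ennreal (1 / 2)) = m"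
  proof -
    have "(2::ennreal) * ennreal (1 / 2) = ennreal (2 * (1 / 2))" by (subst ennreal_mult) auto
    then show ?thesis by (simp only: mult.left_commute[of 2 m]) simp
  qed
  ultimately show ?thesis by simp
qed

text \<open>The constant is 1 for \<open>q = \<infinity>\<close>, since then \<^term>\<open>enn2real q = 0\<close>.\<close>

lemma le_Lq_dtt:
  assumes q: "0 < q" and a: "0 < a" and I: "{a..2 * a} \<subseteq> I" and u: "\<And>s. s \<in> {a..2 * a} \<Longrightarrow> m \<le> u s"
  shows "m \<le> ennreal (2 powr (1 / enn2real q)) * Lq_dtt I q u"
proof (cases "q = \<infinity>")
  case True
  have "m \<le> u a" using a by (intro u) auto
  also have "\<dots> \<le> (SUP t\<in>I. u t)" using a I by (intro SUP_upper) auto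
  finally show ?thesis using True by (simp add: Lq_dtt_def)
next
  case False
  define q' where "q' = enn2real q"
  have q': "0 < q'" using enn2real_pos q False by (simp add: q'_def)
  have "epowr m q' \<le> 2 * (\<integral>\<^sup>+t\<in>I. (epowr (u t) q' * ennreal (1 / t)) \<partial>lborel)"
    by (rule le_integral_dtt[OF a I]) (use q' u in \<open>auto intro!: epowr_mono\<close>)
  then have "epowr (epowr m q') (1 / q') \<le> epowr (2 * (\<integral>\<^sup>+t\<in>I. (epowr (u t) q' * ennreal (1 / t)) \<partial>lborel)) (1 / q')"
    using q' by (intro epowr_mono) auto
  also have "\<dots> = epowr (ennreal 2) (1 / q') * Lq_dtt I q u"
    using q' False by (simp add: epowr_mult Lq_dtt_def q'_def)
  finally show ?thesis using q' by (simp add: epowr_inverse epowr_ennreal q'_def del: ennreal_numeral)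
qed

lemma rearrangement_antimono: "s \<le> t \<Longrightarrow> rearrangement \<Omega> g t \<le> rearrangement \<Omega> g s"
  unfolding rearrangement_def by (intro Inf_superset_mono) (auto intro: order_trans ennreal_leI)

text \<open>The embedding into weak L_p: the rearrangement decreases, so its value at
  \<open>t\<close> is a lower bound on [t/2, t], and only this interval has to lie in the range of
  integration.\<close>

lemma rearrangement_le_lorentz:
  assumes p: "0 < p" and q: "0 < q" and t: "0 < t" "{t / 2..t} \<subseteq> I"
  shows "rearrangement \<Omega> g t \<le> ennreal (2 powr (1 / p) * 2 powr (1 / enn2real q) * t powr (- 1 / p)) * lorentz_norm \<Omega> I p q g"
proof -
  have "ennreal ((t / 2) powr (1 / p)) * rearrangement \<Omega> g t
      \<le> ennreal (2 powr (1 / enn2real q)) * Lq_dtt I q (\<lambda>t. ennreal (t powr (1 / p)) * rearrangement \<Omega> g t)"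
  proof (rule le_Lq_dtt[OF q, of "t / 2"])
    fix s assume s: "s \<in> {t / 2..2 * (t / 2)}"
    show "ennreal ((t / 2) powr (1 / p)) * rearrangement \<Omega> g t \<le> ennreal (s powr (1 / p)) * rearrangement \<Omega> g s"
      using s p t by (intro mult_mono ennreal_leI powr_mono2 rearrangement_antimono) auto
  qed (use t in auto)
  then have le: "ennreal ((t / 2) powr (- 1 / p)) * (ennreal ((t / 2) powr (1 / p)) * rearrangement \<Omega> g t)
      \<le> ennreal ((t / 2) powr (- 1 / p)) * (ennreal (2 powr (1 / enn2real q)) * lorentz_norm \<Omega> I p q g)"
    unfolding lorentz_norm_def by (rule mult_left_mono) simp
  have one: "ennreal ((t / 2) powr (- 1 / p)) * ennreal ((t / 2) powr (1 / p)) = 1"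
    using t by (simp add: ennreal_mult[symmetric] powr_add[symmetric])
  have const: "(t / 2) powr (- 1 / p) * 2 powr (1 / enn2real q) = 2 powr (1 / p) * 2 powr (1 / enn2real q) * t powr (- 1 / p)"
    using t by (simp add: powr_divide powr_minus field_simps)
  have "rearrangement \<Omega> g t = ennreal ((t / 2) powr (- 1 / p)) * (ennreal ((t / 2) powr (1 / p)) * rearrangement \<Omega> g t)"
    by (simp only: mult.assoc[symmetric] one mult_1_left)
  also note le
  also have "ennreal ((t / 2) powr (- 1 / p)) * (ennreal (2 powr (1 / enn2real q)) * lorentz_norm \<Omega> I p q g)
      = ennreal ((t / 2) powr (- 1 / p) * 2 powr (1 / enn2real q)) * lorentz_norm \<Omega> I p q g"
    by (subst ennreal_mult) (simp_all only: powr_ge_zero mult.assoc)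
  finally show ?thesis by (simp only: const)
qed

lemma sets_level:
  fixes G :: "'a::euclidean_space \<Rightarrow> ennreal"
  assumes G: "G \<in> borel_measurable lebesgue" and \<Omega>: "\<Omega> \<in> sets lebesgue"
  shows "{x\<in>\<Omega>. l < G x} \<in> sets lebesgue"
proof -
  have "{x\<in>\<Omega>. l < G x} = \<Omega> \<inter> (G -` {l<..} \<inter> space lebesgue)" by auto
  also have "\<dots> \<in> sets lebesgue" by (intro sets.Int \<Omega> measurable_sets[OF G]) simp
  finally show ?thesis .
qed

lemma emeasure_level_le:
  fixes G :: "'a::euclidean_space \<Rightarrow> ennreal"
  assumes G: "G \<in> borel_measurable lebesgue" and \<Omega>: "\<Omega> \<in> sets lebesgue" and lt: "rearrangement \<Omega> G t < c"
  shows "emeasure lebesgue {x\<in>\<Omega>. G x > c} \<le> ennreal t"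
proof -
  obtain l where l: "l < c" "emeasure lebesgue {x\<in>\<Omega>. G x > l} \<le> ennreal t"
    using lt unfolding rearrangement_def Inf_less_iff by auto
  have "emeasure lebesgue {x\<in>\<Omega>. G x > c} \<le> emeasure lebesgue {x\<in>\<Omega>. G x > l}"
    using l sets_level[OF G \<Omega>] by (intro emeasure_mono) auto
  then show ?thesis using l(2) by simp
qed

text \<open>A discrete layer-cake formula: for the least n with y \<le> 2^n c, the levels below
  \<open>y\<close> add up to c + (c + 2 c + ... + 2^{n-1} c) = 2^n c.\<close>

lemma ennreal_le_dyadic_sum:
  fixes y c :: real
  assumes c: "0 < c"
  shows "ennreal y \<le> ennreal c + (\<Sum>j. ennreal (2 ^ j * c) * (if ennreal (2 ^ j * c) < ennreal y then 1 else 0))"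
proof (cases "y \<le> c")
  case True
  then have "ennreal y \<le> ennreal c" by (rule ennreal_leI)
  then show ?thesis by (rule add_increasing2[rotated]) simp
next
  case False
  have "\<exists>n. y \<le> 2 ^ n * c"
  proof -
    obtain n where "y / c < 2 ^ n" using real_arch_pow[of 2 "y / c"] by auto
    then show ?thesis using c by (intro exI[of _ n]) (simp add: field_simps)
  qed
  define n where "n = (LEAST n. y \<le> 2 ^ n * c)"
  have n: "y \<le> 2 ^ n * c" unfolding n_def by (rule LeastI_ex) fact
  have n': "2 ^ j * c < y" if "j < n" for j
    using not_less_Least[OF that[unfolded n_def]] by simp
  have "c + (\<Sum>j<n. 2 ^ j * c) = 2 ^ n * c"
    by (induction n) (auto simp: algebra_simps)
  then have "ennreal y \<le> ennreal (c + (\<Sum>j<n. 2 ^ j * c))" using n by (simp add: ennreal_leI)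
  also have "\<dots> = ennreal c + (\<Sum>j<n. ennreal (2 ^ j * c))"
    using c by (simp add: sum_ennreal ennreal_plus sum_nonneg)
  also have "(\<Sum>j<n. ennreal (2 ^ j * c)) = (\<Sum>j<n. ennreal (2 ^ j * c) * (if ennreal (2 ^ j * c) < ennreal y then 1 else 0))"
    using n' c by (intro sum.cong) (auto simp: ennreal_less_iff)
  also have "\<dots> \<le> (\<Sum>j. ennreal (2 ^ j * c) * (if ennreal (2 ^ j * c) < ennreal y then 1 else 0))"
    by (intro sum_le_suminf) auto
  finally show ?thesis by (simp add: add_left_mono)
qed

text \<open>Up to the level c the set \<open>E\<close> contributes c \<mu>. Above it, |g| > 2^j c
  holds on a set of measure at most 2^{-pj} v, so the dyadic layers form a geometric series of ratio
  2^{1-p}, convergent because p > 1.\<close>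

lemma integral_le_weak:
  fixes g :: "'a::euclidean_space \<Rightarrow> real"
  assumes g: "g \<in> borel_measurable lebesgue" and \<Omega>: "\<Omega> \<in> sets lebesgue" and p: "1 < p" and A: "0 < A" and v: "0 < v"
    and re: "\<And>t. 0 < t \<Longrightarrow> t \<le> v \<Longrightarrow> rearrangement \<Omega> (\<lambda>x. ennreal \<bar>g x\<bar>) t \<le> ennreal (A * t powr (- 1 / p))"
    and E: "E \<in> sets lebesgue" "E \<subseteq> \<Omega>" "emeasure lebesgue E = ennreal \<mu>" "0 \<le> \<mu>"
  shows "(\<integral>\<^sup>+x\<in>E. ennreal \<bar>g x\<bar> \<partial>lebesgue) \<le> ennreal (2 / (1 - 2 powr (1 - p)) * A * v powr (- 1 / p) * (\<mu> + v))"
proof -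
  \<comment> \<open>The factor 2 makes the comparison of the rearrangement with 2^j c strict, as
    \<open>emeasure_level_le\<close> requires.\<close>
  define c where "c = 2 * A * v powr (- 1 / p)"
  have c: "0 < c" using A v by (simp add: c_def)
  define G where "G x = ennreal \<bar>g x\<bar>" for x
  have G[measurable]: "G \<in> borel_measurable lebesgue" unfolding G_def using g by measurable
  have [measurable]: "E \<in> sets lebesgue" by fact
  define B where "B j = {x\<in>\<Omega>. ennreal (2 ^ j * c) < G x}" for j :: nat
  have Bm[measurable]: "B j \<in> sets lebesgue" for j
    unfolding B_def by (rule sets_level[OF G \<Omega>])
  define r where "r = (2::real) powr (1 - p)"
  have r: "0 < r" "r < 1" using p by (auto simp: r_def powr_less_one)
  have Bj: "ennreal (2 ^ j * c) * emeasure lebesgue (B j) \<le> ennreal (c * v * r ^ j)" for j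
  proof -
    define t where "t = (2 powr (- p)) ^ j * v"
    have "2 powr (- p) \<le> (2::real) powr 0" using p by (intro powr_mono) auto
    then have "(2 powr (- p)) ^ j \<le> (1::real)" by (intro power_le_one) auto
    then have t: "0 < t" "t \<le> v" using v by (auto simp: t_def mult_left_le_one_le)
    have "t powr (- 1 / p) = 2 ^ j * v powr (- 1 / p)"
    proof -
      have "((2 powr (- p)) ^ j) powr (- 1 / p) = (2::real) ^ j"
        using p by (simp add: powr_realpow[symmetric] powr_powr)
      then show ?thesis using v by (simp add: t_def powr_mult)
    qed
    then have "A * t powr (- 1 / p) < 2 ^ j * c" using A v by (simp add: c_def)
    then have "rearrangement \<Omega> G t < ennreal (2 ^ j * c)"
      using re[OF t] A t unfolding G_def by (auto simp: ennreal_less_iff intro: order.strict_trans1)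
    then have "emeasure lebesgue (B j) \<le> ennreal t"
      unfolding B_def by (rule emeasure_level_le[OF G \<Omega>])
    then have "ennreal (2 ^ j * c) * emeasure lebesgue (B j) \<le> ennreal (2 ^ j * c) * ennreal t"
      by (rule mult_left_mono) simp
    also have "\<dots> = ennreal (2 ^ j * c * t)" using c t by (simp add: ennreal_mult)
    also have "2 ^ j * c * t = c * v * (2 * 2 powr (- p)) ^ j" by (simp add: t_def power_mult_distrib)
    also have "2 * 2 powr (- p) = r" by (simp add: r_def powr_diff powr_minus field_simps)
    finally show ?thesis .
  qed
  have "(\<integral>\<^sup>+x\<in>E. ennreal \<bar>g x\<bar> \<partial>lebesgue)
      \<le> (\<integral>\<^sup>+x. ennreal c * indicator E x + (\<Sum>j. ennreal (2 ^ j * c) * indicator (B j) x) \<partial>lebesgue)"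
  proof (rule nn_integral_mono)
    fix x
    show "ennreal \<bar>g x\<bar> * indicator E x \<le> ennreal c * indicator E x + (\<Sum>j. ennreal (2 ^ j * c) * indicator (B j) x)"
    proof (cases "x \<in> E")
      case True
      then have "indicator (B j) x = (if ennreal (2 ^ j * c) < ennreal \<bar>g x\<bar> then 1 else (0::ennreal))" for j
        using E by (auto simp: B_def G_def)
      then show ?thesis using True ennreal_le_dyadic_sum[OF c, of "\<bar>g x\<bar>"] by simp
    qed simp
  qed
  also have "\<dots> = ennreal c * ennreal \<mu> + (\<Sum>j. ennreal (2 ^ j * c) * emeasure lebesgue (B j))"
    by (subst nn_integral_add, simp, simp, subst nn_integral_suminf, simp)
       (simp add: nn_integral_cmult_indicator E)
  also have "\<dots> \<le> ennreal c * ennreal \<mu> + (\<Sum>j. ennreal (c * v * r ^ j))"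
    by (intro add_left_mono suminf_le Bj) auto
  also have "(\<Sum>j. ennreal (c * v * r ^ j)) = ennreal (\<Sum>j. c * v * r ^ j)"
    using c v r by (intro suminf_ennreal2) (auto intro!: summable_mult summable_geometric)
  also have "(\<Sum>j. c * v * r ^ j) = c * v * (1 / (1 - r))"
    using r by (subst suminf_mult) (auto simp: suminf_geometric summable_geometric)
  also have "ennreal c * ennreal \<mu> + ennreal (c * v * (1 / (1 - r))) = ennreal (c * \<mu> + c * v * (1 / (1 - r)))"
    using c v r E by (simp add: ennreal_mult)
  also have "\<dots> \<le> ennreal (2 / (1 - r) * A * v powr (- 1 / p) * (\<mu> + v))"
  proof (rule ennreal_leI)
    have "c * \<mu> * 1 \<le> c * \<mu> * (1 / (1 - r))" using c E r by (intro mult_left_mono) auto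
    then have "c * \<mu> + c * v * (1 / (1 - r)) \<le> c * (1 / (1 - r)) * (\<mu> + v)"
      by (simp add: algebra_simps add_divide_distrib)
    also have "c * (1 / (1 - r)) = 2 / (1 - r) * A * v powr (- 1 / p)" by (simp add: c_def)
    finally show "c * \<mu> + c * v * (1 / (1 - r)) \<le> 2 / (1 - r) * A * v powr (- 1 / p) * (\<mu> + v)" .
  qed
  finally show ?thesis by (simp add: r_def)
qed

text \<open>The weak bound is used only for t \<le> v = c \<mu>, at the price of a factor c^{-1/p}.
  A small \<open>c\<close> thus admits the range (0,1) even for sets of measure above 1.\<close>

lemma integral_le_lorentz:
  assumes p: "1 < p" and q: "0 < q" and c: "0 < c" "c \<le> 1"
  obtains K where "0 < K"
    "\<And>(g::'a::euclidean_space \<Rightarrow> real) \<Omega> I N E \<mu>. g \<in> borel_measurable lebesgue \<Longrightarrow> \<Omega> \<in> sets lebesgue \<Longrightarrow> 0 < N \<Longrightarrow>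
      lorentz_norm \<Omega> I p q (\<lambda>x. ennreal \<bar>g x\<bar>) \<le> ennreal N \<Longrightarrow> E \<in> sets lebesgue \<Longrightarrow> E \<subseteq> \<Omega> \<Longrightarrow>
      emeasure lebesgue E = ennreal \<mu> \<Longrightarrow> 0 \<le> \<mu> \<Longrightarrow> {0<..c * \<mu>} \<subseteq> I \<Longrightarrow>
      (\<integral>\<^sup>+x\<in>E. ennreal \<bar>g x\<bar> \<partial>lebesgue) \<le> ennreal (K * N * \<mu> powr (1 - 1 / p))"
proof -
  define A0 where "A0 = 2 powr (1 / p) * 2 powr (1 / enn2real q)"
  define B where "B = 2 / (1 - 2 powr (1 - p))"
  have B: "0 < B" using p by (simp add: B_def powr_less_one)
  have A0: "0 < A0" by (simp add: A0_def)
  define K where "K = B * A0 * c powr (- 1 / p) * 2"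
  have K: "0 < K" using B A0 c by (simp add: K_def)
  have "(\<integral>\<^sup>+x\<in>E. ennreal \<bar>g x\<bar> \<partial>lebesgue) \<le> ennreal (K * N * \<mu> powr (1 - 1 / p))"
    if g: "g \<in> borel_measurable lebesgue" and \<Omega>: "\<Omega> \<in> sets lebesgue" and N: "0 < N"
      "lorentz_norm \<Omega> I p q (\<lambda>x. ennreal \<bar>g x\<bar>) \<le> ennreal N" and E: "E \<in> sets lebesgue" "E \<subseteq> \<Omega>"
      "emeasure lebesgue E = ennreal \<mu>" "0 \<le> \<mu>" and I: "{0<..c * \<mu>} \<subseteq> I"
    for g :: "'a \<Rightarrow> real" and \<Omega> I N E \<mu>
  proof (cases "\<mu> = 0")
    case True
    then have "E \<in> null_sets lebesgue" using E by auto
    then show ?thesis by (simp add: nn_integral_null_set)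
  next
    case False
    then have \<mu>: "0 < \<mu>" using E by simp
    define v where "v = c * \<mu>"
    have v: "0 < v" "v \<le> \<mu>" using c \<mu> by (auto simp: v_def)
    have "(\<integral>\<^sup>+x\<in>E. ennreal \<bar>g x\<bar> \<partial>lebesgue) \<le> ennreal (B * (A0 * N) * v powr (- 1 / p) * (\<mu> + v))"
      unfolding B_def
    proof (rule integral_le_weak[OF g \<Omega> p _ v(1) _ E])
      fix t assume t: "0 < t" "t \<le> v"
      have "rearrangement \<Omega> (\<lambda>x. ennreal \<bar>g x\<bar>) t \<le> ennreal (A0 * t powr (- 1 / p)) * lorentz_norm \<Omega> I p q (\<lambda>x. ennreal \<bar>g x\<bar>)"
        unfolding A0_def using p t I v by (intro rearrangement_le_lorentz q) (auto simp: v_def)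
      also have "\<dots> \<le> ennreal (A0 * t powr (- 1 / p)) * ennreal N" by (intro mult_left_mono N) simp
      also have "\<dots> = ennreal (A0 * N * t powr (- 1 / p))"
        using A0 N by (simp add: ennreal_mult[symmetric] mult_ac)
      finally show "rearrangement \<Omega> (\<lambda>x. ennreal \<bar>g x\<bar>) t \<le> ennreal (A0 * N * t powr (- 1 / p))" .
    qed (use A0 N in auto)
    also have "\<dots> \<le> ennreal (K * N * \<mu> powr (1 - 1 / p))"
    proof (rule ennreal_leI)
      have veq: "v powr (- 1 / p) = c powr (- 1 / p) * \<mu> powr (- 1 / p)"
        using c \<mu> by (simp add: v_def powr_mult)
      have "B * (A0 * N) * v powr (- 1 / p) * (\<mu> + v) \<le> B * (A0 * N) * v powr (- 1 / p) * (2 * \<mu>)"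
        using B A0 N v by (intro mult_left_mono) auto
      also have "\<dots> = B * (A0 * N) * (c powr (- 1 / p) * \<mu> powr (- 1 / p)) * (2 * \<mu>)" by (simp only: veq)
      also have "\<dots> = K * N * (\<mu> powr 1 * \<mu> powr (- 1 / p))"
        using \<mu> by (simp add: K_def)
      also have "\<mu> powr 1 * \<mu> powr (- 1 / p) = \<mu> powr (1 - 1 / p)"
        unfolding powr_add[symmetric] by simp
      finally show "B * (A0 * N) * v powr (- 1 / p) * (\<mu> + v) \<le> K * N * \<mu> powr (1 - 1 / p)" .
    qed
    finally show ?thesis .
  qed
  then show thesis using that[OF K] by blast
qed

section \<open>Translations, null sets and transfer of the bound on differences\<close>

lemma translation_lebesgue_measurable [measurable]:
  "(\<lambda>x. x + t) \<in> lebesgue \<rightarrow>\<^sub>M (lebesgue :: 'a::euclidean_space measure)"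
proof -
  have "(\<lambda>x. t + (\<Sum>j\<in>Basis. (1 * (x \<bullet> j)) *\<^sub>R j)) \<in> lebesgue \<rightarrow>\<^sub>M (lebesgue :: 'a measure)"
    by (rule lebesgue_affine_measurable) simp
  then show ?thesis by (simp add: euclidean_representation add.commute)
qed

lemma fdiff_funpow_lebesgue_measurable:
  fixes f :: "'a::euclidean_space \<Rightarrow> real"
  assumes f: "f \<in> borel_measurable lebesgue"
  shows "(fdiff h ^^ n) f \<in> borel_measurable lebesgue"
proof (induction n)
  case (Suc n)
  have "(\<lambda>x. (fdiff h ^^ n) f (x + h)) \<in> borel_measurable lebesgue"
    using measurable_compose[OF translation_lebesgue_measurable Suc] by simp
  with Suc show ?case by (simp add: fdiff_def[abs_def])
qed (use f in simp)

lemma AE_lborel_translate: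
  fixes t :: "'a::euclidean_space"
  assumes "AE x in lborel. P x"
  shows "AE x in lborel. P (x + t)"
proof -
  obtain N where N: "N \<in> null_sets lborel" "{x. \<not> P x} \<subseteq> N"
    using assms by (auto simp: eventually_ae_filter)
  have "emeasure lborel ((+) t -` N \<inter> space lborel) = emeasure (distr lborel borel ((+) t)) N"
    using N by (subst emeasure_distr) auto
  also have "\<dots> = 0" using N by (simp only: lborel_distr_plus) auto
  finally have "(+) t -` N \<inter> space lborel \<in> null_sets lborel"
    using N by (intro null_setsI measurable_sets[of _ lborel borel]) auto
  then show ?thesis by (rule AE_I') (use N in \<open>auto simp: add.commute\<close>)
qed

lemma segment_points_in:
  assumes Q: "convex Q" and x: "x \<in> Q" "x + real k *\<^sub>R h \<in> Q" and j: "j \<le> k"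
  shows "x + real j *\<^sub>R h \<in> Q"
proof (cases "k = 0")
  case True then show ?thesis using x j by simp
next
  case False
  have "x + real j *\<^sub>R h = (1 - real j / real k) *\<^sub>R x + (real j / real k) *\<^sub>R (x + real k *\<^sub>R h)"
    using False by (simp add: algebra_simps)
  also have "\<dots> \<in> Q"
    by (rule convexD[OF Q]) (use x j False in auto)
  finally show ?thesis .
qed

lemma fdiff_funpow_cong:
  fixes f g :: "'a::euclidean_space \<Rightarrow> real"
  assumes "\<And>j. j \<le> k \<Longrightarrow> f (x + real j *\<^sub>R h) = g (x + real j *\<^sub>R h)"
  shows "(fdiff h ^^ k) f x = (fdiff h ^^ k) g x"
proof -
  obtain c :: "nat \<Rightarrow> real" where
    c: "\<And>(f::'a \<Rightarrow> real) h x. (fdiff h ^^ k) f x = (\<Sum>j\<le>k. c j * f (x + real j *\<^sub>R h))"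
    using fdiff_funpow_expand[of k, where 'a='a] by blast
  show ?thesis unfolding c using assms by simp
qed

text \<open>Translates of a null set are null, so for almost every \<open>x\<close> the two
  functions agree at all points x + j h with j \<le> k that lie in \<open>Q\<close>; convexity puts
  these points in \<open>Q\<close> for x in \<open>E\<close>.\<close>

lemma fdiff_bound_AE_cong:
  fixes f g :: "'a::euclidean_space \<Rightarrow> real"
  assumes bd: "fdiff_bound Q k p u W f" and Q: "convex Q" and eq: "AE x in lborel. x \<in> Q \<longrightarrow> f x = g x"
  shows "fdiff_bound Q k p u W g"
  unfolding fdiff_bound_def
proof (intro allI impI)
  fix h :: 'a and E
  assume h: "norm h \<le> u" and E: "E \<in> sets borel" "E \<subseteq> {x \<in> Q. x + real k *\<^sub>R h \<in> Q}"
  have "AE x in lborel. \<forall>j\<le>k. x + real j *\<^sub>R h \<in> Q \<longrightarrow> f (x + real j *\<^sub>R h) = g (x + real j *\<^sub>R h)"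
    using AE_lborel_translate[OF eq] by (simp add: AE_all_countable)
  then have "AE x in lborel. ennreal \<bar>(fdiff h ^^ k) g x\<bar> * indicator E x = ennreal \<bar>(fdiff h ^^ k) f x\<bar> * indicator E x"
  proof eventually_elim
    case (elim x)
    show ?case
    proof (cases "x \<in> E")
      case True
      then have "f (x + real j *\<^sub>R h) = g (x + real j *\<^sub>R h)" if "j \<le> k" for j
        using elim segment_points_in[OF Q, of x k h j] E that by auto
      then show ?thesis using fdiff_funpow_cong[of k f x h g] by simp
    qed simp
  qed
  then have "(\<integral>\<^sup>+x\<in>E. ennreal \<bar>(fdiff h ^^ k) g x\<bar> \<partial>lborel) = (\<integral>\<^sup>+x\<in>E. ennreal \<bar>(fdiff h ^^ k) f x\<bar> \<partial>lborel)"
    by (rule nn_integral_cong_AE)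
  then show "(\<integral>\<^sup>+x\<in>E. ennreal \<bar>(fdiff h ^^ k) g x\<bar> \<partial>lborel) \<le> ennreal (W * measure lborel E powr (1 - 1 / p))"
    using fdiff_boundD[OF bd h E] by simp
qed

text \<open>\<open>integral_le_lorentz\<close> applied to the difference on the set where it is
  defined. A subset of the cube has measure at most L^d, so a single condition on the range
  \<open>I\<close> serves all sets \<open>E\<close>.\<close>

lemma fdiff_bound_of_modulus:
  assumes p: "1 < p" and q: "0 < q" and c: "0 < c" "c \<le> 1"
  obtains K where "0 < K"
    "\<And>(f::'a::euclidean_space \<Rightarrow> real) \<Omega> I N u a L. f \<in> borel_measurable lebesgue \<Longrightarrow> \<Omega> \<in> sets borel \<Longrightarrow> 0 < N \<Longrightarrow>
      modulus \<Omega> I k p q f u \<le> ennreal N \<Longrightarrow> 0 < L \<Longrightarrow> cube a L \<subseteq> \<Omega> \<Longrightarrow> {0<..c * L ^ DIM('a)} \<subseteq> I \<Longrightarrow>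
      fdiff_bound (cube a L) k p u (K * N) f"
proof -
  obtain K where K: "0 < K" and le:
    "\<And>(g::'a \<Rightarrow> real) \<Omega> I N E \<mu>. g \<in> borel_measurable lebesgue \<Longrightarrow> \<Omega> \<in> sets lebesgue \<Longrightarrow> 0 < N \<Longrightarrow>
      lorentz_norm \<Omega> I p q (\<lambda>x. ennreal \<bar>g x\<bar>) \<le> ennreal N \<Longrightarrow> E \<in> sets lebesgue \<Longrightarrow> E \<subseteq> \<Omega> \<Longrightarrow>
      emeasure lebesgue E = ennreal \<mu> \<Longrightarrow> 0 \<le> \<mu> \<Longrightarrow> {0<..c * \<mu>} \<subseteq> I \<Longrightarrow>
      (\<integral>\<^sup>+x\<in>E. ennreal \<bar>g x\<bar> \<partial>lebesgue) \<le> ennreal (K * N * \<mu> powr (1 - 1 / p))"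
    using integral_le_lorentz[OF p q c, where 'a='a] by blast
  have "fdiff_bound (cube a L) k p u (K * N) f"
    if f: "f \<in> borel_measurable lebesgue" and \<Omega>: "\<Omega> \<in> sets borel" and N: "0 < N"
      "modulus \<Omega> I k p q f u \<le> ennreal N" and L: "0 < L" and sub: "cube a L \<subseteq> \<Omega>" and I: "{0<..c * L ^ DIM('a)} \<subseteq> I"
    for f :: "'a \<Rightarrow> real" and \<Omega> I N u a L
    unfolding fdiff_bound_def
  proof (intro allI impI)
    fix h :: 'a and E
    assume h: "norm h \<le> u" and E: "E \<in> sets borel" "E \<subseteq> {x \<in> cube a L. x + real k *\<^sub>R h \<in> cube a L}"
    define \<Omega>h where "\<Omega>h = {x. x \<in> \<Omega> \<and> x + real k *\<^sub>R h \<in> \<Omega>}"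
    have [measurable]: "\<Omega> \<in> sets borel" by fact
    have "\<Omega>h \<in> sets borel" unfolding \<Omega>h_def by measurable
    then have \<Omega>h: "\<Omega>h \<in> sets lebesgue" by simp
    have "lorentz_norm \<Omega>h I p q (\<lambda>x. ennreal \<bar>(fdiff h ^^ k) f x\<bar>) \<le> modulus \<Omega> I k p q f u"
      unfolding modulus_def \<Omega>h_def using h by (intro SUP_upper) auto
    then have lor: "lorentz_norm \<Omega>h I p q (\<lambda>x. ennreal \<bar>(fdiff h ^^ k) f x\<bar>) \<le> ennreal N"
      using N by simp
    have eE: "emeasure lborel E \<le> ennreal (L ^ DIM('a))"
      using emeasure_mono[of E "cube a L" lborel] E L by (auto simp: emeasure_cube)
    then have fin: "emeasure lborel E = ennreal (measure lborel E)"
      by (intro emeasure_eq_ennreal_measure) (auto simp: top_unique)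
    have mE: "measure lborel E \<le> L ^ DIM('a)" using eE fin L by simp
    have "(\<integral>\<^sup>+x\<in>E. ennreal \<bar>(fdiff h ^^ k) f x\<bar> \<partial>lebesgue) \<le> ennreal (K * N * measure lborel E powr (1 - 1 / p))"
    proof (rule le[OF fdiff_funpow_lebesgue_measurable[OF f] \<Omega>h N(1) lor])
      have "c * measure lborel E \<le> c * L ^ DIM('a)" using c mE by (intro mult_left_mono) auto
      then show "{0<..c * measure lborel E} \<subseteq> I" using I by (auto intro: order_trans)
    qed (use E sub fin in \<open>auto simp: \<Omega>h_def\<close>)
    then show "(\<integral>\<^sup>+x\<in>E. ennreal \<bar>(fdiff h ^^ k) f x\<bar> \<partial>lborel) \<le> ennreal (K * N * measure lborel E powr (1 - 1 / p))"
      by (simp add: nn_integral_completion)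
  qed
  then show thesis using that[OF K] by blast
qed

section \<open>From integrable Borel functions to locally integrable functions\<close>

lemma borel_representative:
  fixes f :: "'a::euclidean_space \<Rightarrow> real"
  assumes f: "f \<in> borel_measurable lebesgue" and Q: "Q \<in> sets borel"
    and fin: "(\<integral>\<^sup>+x\<in>Q. ennreal \<bar>f x\<bar> \<partial>lebesgue) < \<infinity>"
  obtains g where "integrable lborel g" "AE x in lborel. x \<in> Q \<longrightarrow> f x = g x"
proof -
  define f0 where "f0 x = indicator Q x * f x" for x
  have f0: "f0 \<in> borel_measurable lebesgue"
    unfolding f0_def[abs_def] using f Q by (intro borel_measurable_times borel_measurable_indicator) auto
  obtain g where g: "g \<in> borel_measurable lborel" "AE x in lborel. f0 x = g x"
    using completion_ex_borel_measurable_real[OF f0] by blast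
  have "(\<integral>\<^sup>+x. ennreal (norm (g x)) \<partial>lborel) = (\<integral>\<^sup>+x. ennreal (norm (f0 x)) \<partial>lborel)"
    by (rule nn_integral_cong_AE) (use g(2) in \<open>eventually_elim, simp\<close>)
  also have "\<dots> = (\<integral>\<^sup>+x\<in>Q. ennreal \<bar>f x\<bar> \<partial>lborel)"
    by (intro nn_integral_cong) (auto simp: f0_def indicator_def)
  also have "\<dots> < \<infinity>" using fin by (simp add: nn_integral_completion)
  finally have "integrable lborel g" using g by (intro integrableI_bounded) auto
  moreover have "AE x in lborel. x \<in> Q \<longrightarrow> f x = g x"
    using g(2) by eventually_elim (auto simp: f0_def)
  ultimately show thesis by (rule that)
qed

lemma mean_osc_AE_cong:
  fixes f g :: "'a::euclidean_space \<Rightarrow> real"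
  assumes f: "f \<in> borel_measurable lebesgue" and g: "g \<in> borel_measurable lebesgue" and Q: "Q \<in> sets lebesgue"
    and eq: "AE x in lborel. x \<in> Q \<longrightarrow> f x = g x"
  shows "mean_osc f Q = mean_osc g Q"
proof -
  have eq': "AE x in lebesgue. x \<in> Q \<longrightarrow> f x = g x" using eq by (rule AE_completion)
  have "set_lebesgue_integral lebesgue Q f = set_lebesgue_integral lebesgue Q g"
    unfolding set_lebesgue_integral_def
  proof (rule integral_cong_AE)
    show "AE x in lebesgue. indicator Q x *\<^sub>R f x = indicator Q x *\<^sub>R g x"
      using eq' by eventually_elim (auto simp: indicator_def)
  qed (use f g Q in auto)
  then have av: "average f Q = average g Q" by (simp add: average_def)
  have "(\<integral>\<^sup>+y\<in>Q. ennreal \<bar>f y - average f Q\<bar> \<partial>lebesgue) = (\<integral>\<^sup>+y\<in>Q. ennreal \<bar>g y - average g Q\<bar> \<partial>lebesgue)"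
    unfolding av by (rule nn_integral_cong_AE) (use eq' in \<open>eventually_elim, auto simp: indicator_def\<close>)
  then show ?thesis by (simp add: mean_osc_def)
qed

text \<open>All quantities in the estimates depend only on the almost-everywhere class of
  \<open>f\<close> on the cube, so results obtained for integrable Borel functions carry
  over.\<close>

lemma cube_representative:
  fixes f :: "'a::euclidean_space \<Rightarrow> real"
  assumes f: "f \<in> borel_measurable lebesgue"
    and fin: "(\<integral>\<^sup>+x\<in>cube a0 L. ennreal \<bar>f x\<bar> \<partial>lebesgue) < \<infinity>"
  obtains g where "integrable lborel g"
    "\<And>p k u W. fdiff_bound (cube a0 L) k p u W f \<Longrightarrow> fdiff_bound (cube a0 L) k p u W g"
    "\<And>a l. cube a l \<subseteq> cube a0 L \<Longrightarrow> mean_osc f (cube a l) = mean_osc g (cube a l)"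
    "\<And>x. sharp (cube a0 L) f x = sharp (cube a0 L) g x"
proof -
  obtain g where g: "integrable lborel g" "AE x in lborel. x \<in> cube a0 L \<longrightarrow> f x = g x"
    using borel_representative[OF f _ fin] by auto
  have "g \<in> borel_measurable lborel" using g by auto
  then have gm: "g \<in> borel_measurable lebesgue" by (rule measurable_completion)
  have osc: "mean_osc f (cube a l) = mean_osc g (cube a l)" if "cube a l \<subseteq> cube a0 L" for a l
    using g(2) that by (intro mean_osc_AE_cong f gm) (auto elim!: eventually_mono)
  have "sharp (cube a0 L) f x = sharp (cube a0 L) g x" for x
    unfolding sharp_eq by (intro SUP_cong refl) (auto simp: cubes_eq osc)
  then show thesis
    using that[OF g(1)] osc fdiff_bound_AE_cong[OF _ convex_cube g(2)] by blast
qed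

section \<open>Rearrangement of the sharp maximal function\<close>

text \<open>A non-measurable level set is harmless here: its \<^const>\<open>emeasure\<close> is the junk value 0.\<close>

lemma rearrangement_le_cover:
  fixes G :: "'a::euclidean_space \<Rightarrow> ennreal"
  assumes "{x\<in>\<Omega>. c < G x} \<subseteq> Y" "Y \<in> sets borel" "emeasure lborel Y \<le> ennreal t"
  shows "rearrangement \<Omega> G t \<le> c"
proof -
  have "emeasure lebesgue {x\<in>\<Omega>. c < G x} \<le> ennreal t"
  proof (cases "{x\<in>\<Omega>. c < G x} \<in> sets lebesgue")
    case True
    have "emeasure lebesgue {x\<in>\<Omega>. c < G x} \<le> emeasure lebesgue Y"
      using assms by (intro emeasure_mono) auto
    also have "\<dots> = emeasure lborel Y" using assms by simp
    finally show ?thesis using assms by simp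
  qed (simp add: emeasure_notin_sets)
  then show ?thesis unfolding rearrangement_def by (intro Inf_lower) simp
qed

lemma sharp_level_set_lebesgue:
  assumes k: "1 \<le> k" and p: "1 \<le> p"
  obtains C where "0 < C"
    "\<And>(f::'a::euclidean_space \<Rightarrow> real) a0 L t S. f \<in> borel_measurable lebesgue \<Longrightarrow>
      (\<integral>\<^sup>+x\<in>cube a0 L. ennreal \<bar>f x\<bar> \<partial>lebesgue) < \<infinity> \<Longrightarrow> 0 < t \<Longrightarrow> t \<le> L \<Longrightarrow> 0 < S \<Longrightarrow>
      (\<And>u. t \<le> u \<Longrightarrow> u \<le> L \<Longrightarrow> fdiff_bound (cube a0 L) k p u (S * u powr (real DIM('a) / p)) f) \<Longrightarrow>
      \<exists>Y\<in>sets borel. {x \<in> cube a0 L. ennreal C * (ennreal S + mean_osc f (cube a0 L)) < sharp (cube a0 L) f x} \<subseteq> Y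
        \<and> emeasure lborel Y \<le> ennreal (t ^ DIM('a))"
proof -
  obtain C where C: "0 < C" and sharp:
    "\<And>(f::'a::euclidean_space \<Rightarrow> real) a0 L t S. integrable lborel f \<Longrightarrow> 0 < t \<Longrightarrow> t \<le> L \<Longrightarrow> 0 < S \<Longrightarrow>
      (\<And>u. t \<le> u \<Longrightarrow> u \<le> L \<Longrightarrow> fdiff_bound (cube a0 L) k p u (S * u powr (real DIM('a) / p)) f) \<Longrightarrow>
      \<exists>Y\<in>sets borel. {x \<in> cube a0 L. ennreal C * (ennreal S + mean_osc f (cube a0 L)) < sharp (cube a0 L) f x} \<subseteq> Y
        \<and> emeasure lborel Y \<le> ennreal (t ^ DIM('a))"
    using sharp_level_set[OF k p, where 'a='a] by blast
  show thesis
  proof (rule that[OF C])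
    fix f :: "'a \<Rightarrow> real" and a0 L t S
    assume f: "f \<in> borel_measurable lebesgue" "(\<integral>\<^sup>+x\<in>cube a0 L. ennreal \<bar>f x\<bar> \<partial>lebesgue) < \<infinity>"
      and t: "0 < t" "t \<le> L" "0 < S"
      and bd: "\<And>u. t \<le> u \<Longrightarrow> u \<le> L \<Longrightarrow> fdiff_bound (cube a0 L) k p u (S * u powr (real DIM('a) / p)) f"
    obtain g where g: "integrable lborel g"
      "\<And>p k u W. fdiff_bound (cube a0 L) k p u W f \<Longrightarrow> fdiff_bound (cube a0 L) k p u W g"
      "\<And>a l. cube a l \<subseteq> cube a0 L \<Longrightarrow> mean_osc f (cube a l) = mean_osc g (cube a l)"
      "\<And>x. sharp (cube a0 L) f x = sharp (cube a0 L) g x"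
      using cube_representative[OF f] by blast
    obtain Y where Y: "Y \<in> sets borel" "emeasure lborel Y \<le> ennreal (t ^ DIM('a))"
      "{x \<in> cube a0 L. ennreal C * (ennreal S + mean_osc g (cube a0 L)) < sharp (cube a0 L) g x} \<subseteq> Y"
      using sharp[OF g(1) t g(2)[OF bd]] by blast
    show "\<exists>Y\<in>sets borel. {x \<in> cube a0 L. ennreal C * (ennreal S + mean_osc f (cube a0 L)) < sharp (cube a0 L) f x} \<subseteq> Y
        \<and> emeasure lborel Y \<le> ennreal (t ^ DIM('a))"
      unfolding g(3)[OF order.refl] g(4) using Y by blast
  qed
qed

lemma mean_osc_large_cubes_lebesgue:
  assumes k: "1 \<le> k" and p: "1 \<le> p"
  obtains D where "0 < D"
    "\<And>(f::'a::euclidean_space \<Rightarrow> real) a0 L t S a l. f \<in> borel_measurable lebesgue \<Longrightarrow>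
      (\<integral>\<^sup>+x\<in>cube a0 L. ennreal \<bar>f x\<bar> \<partial>lebesgue) < \<infinity> \<Longrightarrow> 0 < t \<Longrightarrow> 0 \<le> S \<Longrightarrow>
      (\<And>u. t \<le> u \<Longrightarrow> u \<le> L \<Longrightarrow> fdiff_bound (cube a0 L) k p u (S * u powr (real DIM('a) / p)) f) \<Longrightarrow>
      cube a l \<subseteq> cube a0 L \<Longrightarrow> t \<le> l \<Longrightarrow> l \<le> L \<Longrightarrow>
      mean_osc f (cube a l) \<le> ennreal D * (ennreal S + mean_osc f (cube a0 L))"
proof -
  obtain D where D: "0 < D" and large:
    "\<And>(f::'a \<Rightarrow> real) a0 L t S a l. integrable lborel f \<Longrightarrow> 0 < t \<Longrightarrow> 0 \<le> S \<Longrightarrow>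
      (\<And>u. t \<le> u \<Longrightarrow> u \<le> L \<Longrightarrow> fdiff_bound (cube a0 L) k p u (S * u powr (real DIM('a) / p)) f) \<Longrightarrow>
      cube a l \<subseteq> cube a0 L \<Longrightarrow> t \<le> l \<Longrightarrow> l \<le> L \<Longrightarrow>
      mean_osc f (cube a l) \<le> ennreal D * (ennreal S + mean_osc f (cube a0 L))"
    using mean_osc_large_cubes[OF k p, where 'a='a] by blast
  show thesis
  proof (rule that[OF D])
    fix f :: "'a \<Rightarrow> real" and a0 L t S a l
    assume f: "f \<in> borel_measurable lebesgue" "(\<integral>\<^sup>+x\<in>cube a0 L. ennreal \<bar>f x\<bar> \<partial>lebesgue) < \<infinity>"
      and t: "0 < t" "0 \<le> S"
      and bd: "\<And>u. t \<le> u \<Longrightarrow> u \<le> L \<Longrightarrow> fdiff_bound (cube a0 L) k p u (S * u powr (real DIM('a) / p)) f"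
      and l: "cube a l \<subseteq> cube a0 L" "t \<le> l" "l \<le> L"
    obtain g where g: "integrable lborel g"
      "\<And>p k u W. fdiff_bound (cube a0 L) k p u W f \<Longrightarrow> fdiff_bound (cube a0 L) k p u W g"
      "\<And>a l. cube a l \<subseteq> cube a0 L \<Longrightarrow> mean_osc f (cube a l) = mean_osc g (cube a l)"
      "\<And>x. sharp (cube a0 L) f x = sharp (cube a0 L) g x"
      using cube_representative[OF f] by blast
    have "mean_osc g (cube a l) \<le> ennreal D * (ennreal S + mean_osc g (cube a0 L))"
      by (rule large[OF g(1) t g(2)[OF bd] l])
    then show "mean_osc f (cube a l) \<le> ennreal D * (ennreal S + mean_osc f (cube a0 L))"
      using g(3) l by simp
  qed
qed

section \<open>Passage from centred cubes to the whole space\<close>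

definition ccube :: "nat \<Rightarrow> 'a::euclidean_space set" where
  "ccube n = cube (- real n *\<^sub>R (\<Sum>Basis)) (2 * real n)"

lemma bounded_subset_ccube:
  fixes B :: "'a::euclidean_space set"
  assumes "bounded B"
  obtains n0 where "\<And>n. n0 \<le> n \<Longrightarrow> B \<subseteq> ccube n"
proof -
  obtain R where R: "\<And>x. x \<in> B \<Longrightarrow> norm x \<le> R" using assms by (auto simp: bounded_iff)
  show thesis
  proof (rule that[of "nat \<lceil>R\<rceil>"])
    fix n assume "nat \<lceil>R\<rceil> \<le> n"
    then have n: "R \<le> real n" by linarith
    show "B \<subseteq> ccube n"
    proof
      fix x assume x: "x \<in> B"
      show "x \<in> ccube n" unfolding ccube_def mem_cube
      proof
        fix b :: 'a assume b: "b \<in> Basis"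
        have "\<bar>x \<bullet> b\<bar> \<le> real n" using Basis_le_norm[OF b, of x] R[OF x] n by linarith
        then show "- real n *\<^sub>R \<Sum>Basis \<bullet> b \<le> x \<bullet> b \<and> x \<bullet> b \<le> - real n *\<^sub>R \<Sum>Basis \<bullet> b + 2 * real n"
          unfolding inner_scaleR_left sum_Basis_inner[OF b] by linarith
      qed
    qed
  qed
qed

lemma bounded_cube: "bounded (cube a l)"
  by (simp add: cube_def)

lemma ccube_eventually:
  fixes f :: "'a::euclidean_space \<Rightarrow> real"
  assumes S: "0 < S" and lim: "(\<lambda>n. mean_osc f (ccube n)) \<longlonglongrightarrow> 0"
  obtains n0 where "1 \<le> n0" "\<And>n. n0 \<le> n \<Longrightarrow> mean_osc f (ccube n) \<le> ennreal S \<and> t \<le> 2 * real n"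
proof -
    have "\<forall>\<^sub>F n in sequentially. mean_osc f (ccube n) < ennreal S"
      by (rule order_tendstoD[OF lim]) (use S in simp)
    moreover have "\<forall>\<^sub>F n in sequentially. nat \<lceil>t\<rceil> \<le> n" by (rule eventually_ge_at_top)
    moreover have "\<forall>\<^sub>F n in sequentially. 1 \<le> n" by (rule eventually_ge_at_top)
    ultimately have "\<forall>\<^sub>F n in sequentially. 1 \<le> n \<and> mean_osc f (ccube n) \<le> ennreal S \<and> t \<le> 2 * real n"
    proof eventually_elim
      case (elim n)
      then have "t \<le> real n" by linarith
      with elim show ?case by auto
    qed
    then obtain N where "\<And>n. N \<le> n \<Longrightarrow> 1 \<le> n \<and> mean_osc f (ccube n) \<le> ennreal S \<and> t \<le> 2 * real n"
      by (auto simp: eventually_sequentially)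
    then show thesis by (intro that[of "max 1 N"]) auto
qed

text \<open>The estimate on centred cubes exhausting the space; the oscillation on the last cube is
  eventually at most \<open>S\<close> and is absorbed into a factor 2.\<close>

lemma rearrangement_sharp_UNIV:
  assumes k: "1 \<le> k" and p: "1 \<le> p"
  obtains C where "0 < C"
    "\<And>(f::'a::euclidean_space \<Rightarrow> real) t S. f \<in> borel_measurable lebesgue \<Longrightarrow>
      (\<And>a L. (\<integral>\<^sup>+x\<in>cube a L. ennreal \<bar>f x\<bar> \<partial>lebesgue) < \<infinity>) \<Longrightarrow> 0 < t \<Longrightarrow> 0 < S \<Longrightarrow>
      (\<And>u a L. t \<le> u \<Longrightarrow> 0 < L \<Longrightarrow> fdiff_bound (cube a L) k p u (S * u powr (real DIM('a) / p)) f) \<Longrightarrow>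
      (\<lambda>n. mean_osc f (ccube n)) \<longlonglongrightarrow> 0 \<Longrightarrow>
      rearrangement UNIV (sharp UNIV f) (t ^ DIM('a)) \<le> ennreal (C * S)"
proof -
  obtain C where C: "0 < C" and sharp:
    "\<And>(f::'a::euclidean_space \<Rightarrow> real) a0 L t S. f \<in> borel_measurable lebesgue \<Longrightarrow>
      (\<integral>\<^sup>+x\<in>cube a0 L. ennreal \<bar>f x\<bar> \<partial>lebesgue) < \<infinity> \<Longrightarrow> 0 < t \<Longrightarrow> t \<le> L \<Longrightarrow> 0 < S \<Longrightarrow>
      (\<And>u. t \<le> u \<Longrightarrow> u \<le> L \<Longrightarrow> fdiff_bound (cube a0 L) k p u (S * u powr (real DIM('a) / p)) f) \<Longrightarrow>
      \<exists>Y\<in>sets borel. {x \<in> cube a0 L. ennreal C * (ennreal S + mean_osc f (cube a0 L)) < sharp (cube a0 L) f x} \<subseteq> Y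
        \<and> emeasure lborel Y \<le> ennreal (t ^ DIM('a))"
    using sharp_level_set_lebesgue[OF k p, where 'a='a] by blast
  have part1: "rearrangement UNIV (sharp UNIV f) (t ^ DIM('a)) \<le> ennreal (2 * C * S)"
    if f: "f \<in> borel_measurable lebesgue" and int: "\<And>a L. (\<integral>\<^sup>+x\<in>cube a L. ennreal \<bar>f x\<bar> \<partial>lebesgue) < \<infinity>"
      and t: "0 < t" and S: "0 < S"
      and bd: "\<And>u a L. t \<le> u \<Longrightarrow> 0 < L \<Longrightarrow> fdiff_bound (cube a L) k p u (S * u powr (real DIM('a) / p)) f"
      and lim: "(\<lambda>n. mean_osc f (ccube n)) \<longlonglongrightarrow> 0" for f :: "'a \<Rightarrow> real" and t S
  proof -
    obtain n0 where n0: "1 \<le> n0" "\<And>n. n0 \<le> n \<Longrightarrow> mean_osc f (ccube n) \<le> ennreal S \<and> t \<le> 2 * real n"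
      using ccube_eventually[OF S lim, of t] by blast
    have "\<exists>Y\<in>sets borel. {x \<in> ccube n. ennreal (2 * C * S) < sharp (ccube n) f x} \<subseteq> Y
        \<and> emeasure lborel Y \<le> ennreal (t ^ DIM('a))" if n: "n0 \<le> n" for n
    proof -
      obtain Y where Y: "Y \<in> sets borel" "emeasure lborel Y \<le> ennreal (t ^ DIM('a))"
        "{x \<in> ccube n. ennreal C * (ennreal S + mean_osc f (ccube n)) < sharp (ccube n) f x} \<subseteq> Y"
        using sharp[OF f int t _ S bd, of "2 * real n" "- real n *\<^sub>R \<Sum>Basis"] n0 n
        unfolding ccube_def[symmetric] by fastforce
      have "ennreal C * (ennreal S + mean_osc f (ccube n)) \<le> ennreal C * (ennreal S + ennreal S)"
        using n0 n by (intro mult_left_mono add_left_mono) auto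
      also have "\<dots> = ennreal (2 * C * S)" using C S by (simp add: ennreal_mult[symmetric] ennreal_plus[symmetric] mult_ac del: ennreal_plus)
      finally have "{x \<in> ccube n. ennreal (2 * C * S) < sharp (ccube n) f x} \<subseteq> Y"
        by (intro order_trans[OF _ Y(3)]) (blast intro: order.strict_trans1)
      with Y(1,2) show ?thesis by blast
    qed
    then have "\<forall>n\<in>{n0..}. \<exists>Y. Y \<in> sets borel \<and> {x \<in> ccube n. ennreal (2 * C * S) < sharp (ccube n) f x} \<subseteq> Y
        \<and> emeasure lborel Y \<le> ennreal (t ^ DIM('a))" by fastforce
    from bchoice[OF this] obtain Y where Y: "\<And>n. n0 \<le> n \<Longrightarrow> Y n \<in> sets borel"
      "\<And>n. n0 \<le> n \<Longrightarrow> {x \<in> ccube n. ennreal (2 * C * S) < sharp (ccube n) f x} \<subseteq> Y n"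
      "\<And>n. n0 \<le> n \<Longrightarrow> emeasure lborel (Y n) \<le> ennreal (t ^ DIM('a))" by auto
    \<comment> \<open>The covers of different cubes are unrelated, so their lower limit is taken: an
      increasing union of sets of measure at most t^d. It catches each point of the level set,
      because the cube witnessing the large oscillation lies in all sufficiently large centred
      cubes.\<close>
    define Z where "Z n = (\<Inter>m\<in>{n0 + n..}. Y m)" for n
    have Zm: "Z n \<in> sets borel" for n unfolding Z_def using Y(1) by (intro sets.countable_INT'') auto
    have "incseq Z" unfolding incseq_def Z_def by (auto intro!: INT_anti_mono)
    have "emeasure lborel (\<Union>n. Z n) = (SUP n. emeasure lborel (Z n))"
      using Zm \<open>incseq Z\<close> by (intro SUP_emeasure_incseq[symmetric]) auto
    also have "\<dots> \<le> ennreal (t ^ DIM('a))"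
    proof (rule SUP_least)
      fix n
      have "emeasure lborel (Z n) \<le> emeasure lborel (Y (n0 + n))"
        using Y(1) by (intro emeasure_mono) (auto simp: Z_def)
      then show "emeasure lborel (Z n) \<le> ennreal (t ^ DIM('a))" using Y(3)[of "n0 + n"] by simp
    qed
    finally have Zle: "emeasure lborel (\<Union>n. Z n) \<le> ennreal (t ^ DIM('a))" .
    show ?thesis
    proof (rule rearrangement_le_cover[OF _ _ Zle])
      show "(\<Union>n. Z n) \<in> sets borel" using Zm by auto
      show "{x \<in> UNIV. ennreal (2 * C * S) < sharp UNIV f x} \<subseteq> (\<Union>n. Z n)"
      proof
        fix x assume "x \<in> {x \<in> UNIV. ennreal (2 * C * S) < sharp UNIV f x}"
        then obtain Q where Q: "Q \<in> cubes" "x \<in> Q" "ennreal (2 * C * S) < mean_osc f Q"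
          unfolding sharp_eq by (auto simp: less_SUP_iff)
        have "bounded Q" using Q(1) by (auto simp: cubes_eq bounded_cube)
        then obtain n1 where n1: "\<And>n. n1 \<le> n \<Longrightarrow> Q \<subseteq> ccube n" using bounded_subset_ccube by blast
        have "x \<in> Y m" if m: "n0 + n1 \<le> m" for m
        proof -
          have "mean_osc f Q \<le> sharp (ccube m) f x"
            unfolding sharp_eq using Q n1[of m] m by (intro SUP_upper) auto
          with Q(3) have "ennreal (2 * C * S) < sharp (ccube m) f x" by (rule order.strict_trans2)
          moreover have "x \<in> ccube m" using n1[of m] m Q by auto
          ultimately show ?thesis using Y(2)[of m] m by auto
        qed
        then show "x \<in> (\<Union>n. Z n)" unfolding Z_def by auto
      qed
    qed
  qed
  have "0 < 2 * C" using C by simp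
  then show thesis by (rule that) (rule part1)
qed

text \<open>The same limit for the oscillation on one cube. It will be applied to differences of
  test functions.\<close>

lemma mean_osc_le_UNIV:
  assumes k: "1 \<le> k" and p: "1 \<le> p"
  obtains C where "0 < C"
    "\<And>(f::'a::euclidean_space \<Rightarrow> real) t S a l. f \<in> borel_measurable lebesgue \<Longrightarrow>
      (\<And>a L. (\<integral>\<^sup>+x\<in>cube a L. ennreal \<bar>f x\<bar> \<partial>lebesgue) < \<infinity>) \<Longrightarrow> 0 < t \<Longrightarrow> 0 < S \<Longrightarrow>
      (\<And>u a L. t \<le> u \<Longrightarrow> 0 < L \<Longrightarrow> fdiff_bound (cube a L) k p u (S * u powr (real DIM('a) / p)) f) \<Longrightarrow>
      (\<lambda>n. mean_osc f (ccube n)) \<longlonglongrightarrow> 0 \<Longrightarrow> t \<le> l \<Longrightarrow>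
      mean_osc f (cube a l) \<le> ennreal (C * S)"
proof -
  obtain C where C: "0 < C" and large:
    "\<And>(f::'a::euclidean_space \<Rightarrow> real) a0 L t S a l. f \<in> borel_measurable lebesgue \<Longrightarrow>
      (\<integral>\<^sup>+x\<in>cube a0 L. ennreal \<bar>f x\<bar> \<partial>lebesgue) < \<infinity> \<Longrightarrow> 0 < t \<Longrightarrow> 0 \<le> S \<Longrightarrow>
      (\<And>u. t \<le> u \<Longrightarrow> u \<le> L \<Longrightarrow> fdiff_bound (cube a0 L) k p u (S * u powr (real DIM('a) / p)) f) \<Longrightarrow>
      cube a l \<subseteq> cube a0 L \<Longrightarrow> t \<le> l \<Longrightarrow> l \<le> L \<Longrightarrow>
      mean_osc f (cube a l) \<le> ennreal C * (ennreal S + mean_osc f (cube a0 L))"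
    using mean_osc_large_cubes_lebesgue[OF k p, where 'a='a] by blast
  have part2: "mean_osc f (cube a l) \<le> ennreal (2 * C * S)"
    if f: "f \<in> borel_measurable lebesgue" and int: "\<And>a L. (\<integral>\<^sup>+x\<in>cube a L. ennreal \<bar>f x\<bar> \<partial>lebesgue) < \<infinity>"
      and t: "0 < t" and S: "0 < S"
      and bd: "\<And>u a L. t \<le> u \<Longrightarrow> 0 < L \<Longrightarrow> fdiff_bound (cube a L) k p u (S * u powr (real DIM('a) / p)) f"
      and lim: "(\<lambda>n. mean_osc f (ccube n)) \<longlonglongrightarrow> 0" and l: "t \<le> l" for f :: "'a \<Rightarrow> real" and t S a l
  proof -
    obtain n0 where n0: "1 \<le> n0" "\<And>n. n0 \<le> n \<Longrightarrow> mean_osc f (ccube n) \<le> ennreal S \<and> l \<le> 2 * real n"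
      using ccube_eventually[OF S lim, of l] by blast
    obtain n1 where n1: "\<And>n. n1 \<le> n \<Longrightarrow> cube a l \<subseteq> ccube n" using bounded_subset_ccube[OF bounded_cube] by blast
    define n where "n = max n0 n1"
    have n: "1 \<le> n" "mean_osc f (ccube n) \<le> ennreal S" "l \<le> 2 * real n" "cube a l \<subseteq> ccube n"
      using n0 n1 by (auto simp: n_def)
    have "mean_osc f (cube a l) \<le> ennreal C * (ennreal S + mean_osc f (ccube n))"
      unfolding ccube_def using S n l by (intro large[OF f int t _ bd]) (auto simp: ccube_def)
    also have "\<dots> \<le> ennreal C * (ennreal S + ennreal S)"
      using n by (intro mult_left_mono add_left_mono) auto
    also have "\<dots> = ennreal (2 * C * S)" using C S by (simp add: ennreal_mult[symmetric] ennreal_plus[symmetric] mult_ac del: ennreal_plus)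
    finally show ?thesis .
  qed
  have "0 < 2 * C" using C by simp
  then show thesis by (rule that) (rule part2)
qed

section \<open>Mean oscillation of elements of the homogeneous Besov space\<close>

lemma tendsto_0_le_ennreal:
  fixes g h :: "nat \<Rightarrow> ennreal"
  assumes h: "h \<longlonglongrightarrow> 0" and le: "\<And>n. 1 \<le> n \<Longrightarrow> g n \<le> h n"
  shows "g \<longlonglongrightarrow> 0"
proof (rule tendsto_sandwich[OF _ _ tendsto_const h])
  show "\<forall>\<^sub>F n in sequentially. 0 \<le> g n" by simp
  show "\<forall>\<^sub>F n in sequentially. g n \<le> h n"
    unfolding eventually_sequentially using le by blast
qed

text \<open>The oscillation is at most twice the mean of |\<psi>|, whose integral stays bounded
  while the volume grows.\<close>

lemma tendsto_mean_osc_ccube: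
  fixes \<psi> :: "'a::euclidean_space \<Rightarrow> real"
  assumes "integrable lborel \<psi>"
  shows "(\<lambda>n. mean_osc \<psi> (ccube n)) \<longlonglongrightarrow> 0"
proof -
  define J where "J = (\<integral>x. \<bar>\<psi> x\<bar> \<partial>lborel)"
  have J: "(\<integral>\<^sup>+x. ennreal \<bar>\<psi> x\<bar> \<partial>lborel) = ennreal J" "0 \<le> J"
    unfolding J_def using assms by (auto intro!: nn_integral_eq_integral)
  have "mean_osc \<psi> (ccube n) \<le> ennreal (2 * J / real n)" if n: "1 \<le> n" for n
  proof -
    have n0: "0 < 2 * real n" using n by simp
    have "mean_osc \<psi> (ccube n) \<le> 2 * (\<integral>\<^sup>+y\<in>ccube n. ennreal \<bar>\<psi> y - 0\<bar> \<partial>lborel) / ennreal ((2 * real n) ^ DIM('a))"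
      unfolding ccube_def by (rule mean_osc_le[OF assms n0])
    also have "\<dots> \<le> 2 * ennreal J / ennreal ((2 * real n) ^ DIM('a))"
    proof (intro divide_right_mono_ennreal mult_left_mono)
      show "(\<integral>\<^sup>+y\<in>ccube n. ennreal \<bar>\<psi> y - 0\<bar> \<partial>lborel) \<le> ennreal J"
        unfolding J(1)[symmetric] by (intro nn_integral_mono) (auto simp: indicator_def)
    qed simp
    also have "\<dots> = ennreal (2 * J / (2 * real n) ^ DIM('a))"
    proof -
      have "2 * ennreal J = ennreal (2 * J)" using J by (subst ennreal_mult) auto
      then show ?thesis using J n0 by (simp add: divide_ennreal del: of_nat_0_less_iff)
    qed
    also have "\<dots> \<le> ennreal (2 * J / real n)"
    proof (intro ennreal_leI divide_left_mono)
      have "(2 * real n) ^ 1 \<le> (2 * real n) ^ DIM('a)" using n by (intro power_increasing) auto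
      then show "real n \<le> (2 * real n) ^ DIM('a)" by simp
    qed (use J n in auto)
    finally show ?thesis .
  qed
  note le = this
  have "(\<lambda>n. ennreal (2 * J / real n)) \<longlonglongrightarrow> ennreal 0"
    by (intro tendsto_ennrealI lim_const_over_n)
  then show ?thesis unfolding ennreal_0 by (rule tendsto_0_le_ennreal) (rule le)
qed

lemma test_function_integrable:
  assumes "\<phi> \<in> test_functions"
  shows "integrable lborel (\<phi> :: 'a::euclidean_space \<Rightarrow> real)"
proof -
  have "C_k 0 \<phi>" and S: "compact (closure {x. \<phi> x \<noteq> 0})"
    using assms by (auto simp: test_functions_def)
  then have "continuous_on UNIV \<phi>" by simp
  then have "integrable lborel (\<lambda>x. indicator (closure {x. \<phi> x \<noteq> 0}) x *\<^sub>R \<phi> x)"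
    using S by (intro borel_integrable_compact) (auto intro: continuous_on_subset)
  also have "(\<lambda>x. indicator (closure {x. \<phi> x \<noteq> 0}) x *\<^sub>R \<phi> x) = \<phi>"
    using closure_subset[of "{x. \<phi> x \<noteq> 0}"] by (auto simp: fun_eq_iff indicator_def)
  finally show ?thesis .
qed

lemma mean_osc_le_lebesgue:
  fixes f :: "'a::euclidean_space \<Rightarrow> real"
  assumes f: "f \<in> borel_measurable lebesgue" and fin: "(\<integral>\<^sup>+x\<in>cube a l. ennreal \<bar>f x\<bar> \<partial>lebesgue) < \<infinity>"
    and l: "0 < l"
  shows "mean_osc f (cube a l) \<le> 2 * (\<integral>\<^sup>+y\<in>cube a l. ennreal \<bar>f y - c\<bar> \<partial>lborel) / ennreal (l ^ DIM('a))"
proof -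
  obtain g where g: "integrable lborel g" "AE x in lborel. x \<in> cube a l \<longrightarrow> f x = g x"
    using borel_representative[OF f _ fin] by auto
  have "g \<in> borel_measurable lborel" using g by auto
  then have gm: "g \<in> borel_measurable lebesgue" by (rule measurable_completion)
  have "mean_osc f (cube a l) = mean_osc g (cube a l)"
    using g(2) by (intro mean_osc_AE_cong f gm) auto
  also have "\<dots> \<le> 2 * (\<integral>\<^sup>+y\<in>cube a l. ennreal \<bar>g y - c\<bar> \<partial>lborel) / ennreal (l ^ DIM('a))"
    by (rule mean_osc_le[OF g(1) l])
  also have "(\<integral>\<^sup>+y\<in>cube a l. ennreal \<bar>g y - c\<bar> \<partial>lborel) = (\<integral>\<^sup>+y\<in>cube a l. ennreal \<bar>f y - c\<bar> \<partial>lborel)"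
    by (rule nn_integral_cong_AE) (use g(2) in \<open>eventually_elim, auto simp: indicator_def\<close>)
  finally show ?thesis .
qed

text \<open>The sum of the means of \<open>g\<close> and \<open>h\<close> serves as the constant for
  \<open>f\<close>; here \<open>g + h\<close> will be an approximant of \<open>f\<close> in L_1 of
  the cube.\<close>

lemma mean_osc_triangle:
  fixes f :: "'a::euclidean_space \<Rightarrow> real"
  assumes f: "f \<in> borel_measurable lebesgue" and fin: "(\<integral>\<^sup>+x\<in>cube a l. ennreal \<bar>f x\<bar> \<partial>lebesgue) < \<infinity>"
    and l: "0 < l" and g: "g \<in> borel_measurable borel" and h: "h \<in> borel_measurable borel"
  shows "mean_osc f (cube a l) \<le>
    2 * (\<integral>\<^sup>+y\<in>cube a l. ennreal \<bar>g y + h y - f y\<bar> \<partial>lebesgue) / ennreal (l ^ DIM('a))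
    + 2 * mean_osc g (cube a l) + 2 * mean_osc h (cube a l)"
proof -
  define Q where "Q = cube a l"
  have [measurable]: "Q \<in> sets borel" by (simp add: Q_def)
  have Q': "Q \<in> sets lebesgue" by simp
  have gm: "g \<in> borel_measurable lebesgue" "h \<in> borel_measurable lebesgue"
    using g h by (auto intro!: measurable_completion)
  note [measurable] = f gm Q'
  define \<alpha> where "\<alpha> = average g Q"
  define \<beta> where "\<beta> = average h Q"
  have "(\<integral>\<^sup>+y\<in>Q. ennreal \<bar>f y - (\<alpha> + \<beta>)\<bar> \<partial>lborel) = (\<integral>\<^sup>+y\<in>Q. ennreal \<bar>f y - (\<alpha> + \<beta>)\<bar> \<partial>lebesgue)"
    by (simp add: nn_integral_completion)
  also have "\<dots> \<le> (\<integral>\<^sup>+y. ennreal \<bar>g y + h y - f y\<bar> * indicator Q y + (ennreal \<bar>g y - \<alpha>\<bar> * indicator Q y + ennreal \<bar>h y - \<beta>\<bar> * indicator Q y) \<partial>lebesgue)"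
  proof (rule nn_integral_mono)
    fix y
    have "ennreal \<bar>f y - (\<alpha> + \<beta>)\<bar> \<le> ennreal (\<bar>g y + h y - f y\<bar> + (\<bar>g y - \<alpha>\<bar> + \<bar>h y - \<beta>\<bar>))"
      by (rule ennreal_leI) linarith
    also have "\<dots> = ennreal \<bar>g y + h y - f y\<bar> + (ennreal \<bar>g y - \<alpha>\<bar> + ennreal \<bar>h y - \<beta>\<bar>)" by simp
    finally show "ennreal \<bar>f y - (\<alpha> + \<beta>)\<bar> * indicator Q y \<le>
      ennreal \<bar>g y + h y - f y\<bar> * indicator Q y + (ennreal \<bar>g y - \<alpha>\<bar> * indicator Q y + ennreal \<bar>h y - \<beta>\<bar> * indicator Q y)"
      by (cases "y \<in> Q") auto
  qed
  also have "\<dots> = (\<integral>\<^sup>+y\<in>Q. ennreal \<bar>g y + h y - f y\<bar> \<partial>lebesgue) + ((\<integral>\<^sup>+y\<in>Q. ennreal \<bar>g y - \<alpha>\<bar> \<partial>lebesgue) + (\<integral>\<^sup>+y\<in>Q. ennreal \<bar>h y - \<beta>\<bar> \<partial>lebesgue))"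
    by (subst nn_integral_add, measurable, subst nn_integral_add) measurable
  also have "(\<integral>\<^sup>+y\<in>Q. ennreal \<bar>g y - \<alpha>\<bar> \<partial>lebesgue) = mean_osc g Q * ennreal (l ^ DIM('a))"
    unfolding \<alpha>_def Q_def using nn_integral_cube_average[OF l, where a=a and f=g] by (simp add: nn_integral_completion)
  also have "(\<integral>\<^sup>+y\<in>Q. ennreal \<bar>h y - \<beta>\<bar> \<partial>lebesgue) = mean_osc h Q * ennreal (l ^ DIM('a))"
    unfolding \<beta>_def Q_def using nn_integral_cube_average[OF l, where a=a and f=h] by (simp add: nn_integral_completion)
  finally have *: "(\<integral>\<^sup>+y\<in>Q. ennreal \<bar>f y - (\<alpha> + \<beta>)\<bar> \<partial>lborel) \<le>
     (\<integral>\<^sup>+y\<in>Q. ennreal \<bar>g y + h y - f y\<bar> \<partial>lebesgue) + (mean_osc g Q + mean_osc h Q) * ennreal (l ^ DIM('a))"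
    by (simp add: distrib_right)
  have "mean_osc f Q \<le> 2 * (\<integral>\<^sup>+y\<in>Q. ennreal \<bar>f y - (\<alpha> + \<beta>)\<bar> \<partial>lborel) / ennreal (l ^ DIM('a))"
    unfolding Q_def by (rule mean_osc_le_lebesgue[OF f fin l])
  also have "\<dots> \<le> 2 * ((\<integral>\<^sup>+y\<in>Q. ennreal \<bar>g y + h y - f y\<bar> \<partial>lebesgue) + (mean_osc g Q + mean_osc h Q) * ennreal (l ^ DIM('a))) / ennreal (l ^ DIM('a))"
    by (intro divide_right_mono_ennreal mult_left_mono *) simp
  also have "\<dots> = 2 * (\<integral>\<^sup>+y\<in>Q. ennreal \<bar>g y + h y - f y\<bar> \<partial>lebesgue) / ennreal (l ^ DIM('a))
      + (2 * (mean_osc g Q + mean_osc h Q)) * ennreal (l ^ DIM('a)) / ennreal (l ^ DIM('a))"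
    by (subst distrib_left) (simp only: add_divide_distrib_ennreal mult.assoc)
  also have "(2 * (mean_osc g Q + mean_osc h Q)) * ennreal (l ^ DIM('a)) / ennreal (l ^ DIM('a)) = 2 * (mean_osc g Q + mean_osc h Q)"
    using l by (intro mult_divide_eq_ennreal) auto
  finally show ?thesis by (simp add: Q_def distrib_left add.assoc)
qed

lemma modulus_mono: "t \<le> u \<Longrightarrow> modulus \<Omega> I k p q f t \<le> modulus \<Omega> I k p q f u"
  unfolding modulus_def by (intro SUP_subset_mono) auto

text \<open>Monotonicity of the modulus turns its value at \<open>u\<close> into a lower bound on
  the window [u, 2u].\<close>

lemma modulus_le_Lq_dtt:
  assumes r: "0 < r" and s: "0 \<le> s" and u: "0 < u" "{u..2 * u} \<subseteq> I'"
  shows "modulus \<Omega> I k p q f u \<le> ennreal (2 powr (1 / enn2real r) * (2 * u) powr s) *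
     Lq_dtt I' r (\<lambda>t. ennreal (t powr (- s)) * modulus \<Omega> I k p q f t)"
proof -
  have "ennreal ((2 * u) powr (- s)) * modulus \<Omega> I k p q f u \<le> ennreal (2 powr (1 / enn2real r)) *
     Lq_dtt I' r (\<lambda>t. ennreal (t powr (- s)) * modulus \<Omega> I k p q f t)"
  proof (rule le_Lq_dtt[OF r u])
    fix t assume t: "t \<in> {u..2 * u}"
    then show "ennreal ((2 * u) powr (- s)) * modulus \<Omega> I k p q f u \<le> ennreal (t powr (- s)) * modulus \<Omega> I k p q f t"
      using s u by (intro mult_mono modulus_mono ennreal_leI powr_mono2') auto
  qed
  then have "ennreal ((2 * u) powr s) * (ennreal ((2 * u) powr (- s)) * modulus \<Omega> I k p q f u) \<le>
     ennreal ((2 * u) powr s) * (ennreal (2 powr (1 / enn2real r)) *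
     Lq_dtt I' r (\<lambda>t. ennreal (t powr (- s)) * modulus \<Omega> I k p q f t))"
    by (rule mult_left_mono) simp
  moreover have "ennreal ((2 * u) powr s) * ennreal ((2 * u) powr (- s)) = 1"
    using u by (simp add: ennreal_mult[symmetric] powr_add[symmetric])
  moreover have "ennreal (2 powr (1 / enn2real r) * (2 * u) powr s) = ennreal ((2 * u) powr s) * ennreal (2 powr (1 / enn2real r))"
    by (subst ennreal_mult[symmetric]) (simp_all add: mult.commute)
  ultimately show ?thesis by (simp only: mult.assoc[symmetric] mult_1_left)
qed

lemma hom_besov_locally_integrable:
  fixes f :: "'a::euclidean_space \<Rightarrow> real"
  assumes "f \<in> hom_besov s r p q k"
  shows "f \<in> borel_measurable lebesgue" "(\<integral>\<^sup>+x\<in>cube a L. ennreal \<bar>f x\<bar> \<partial>lebesgue) < \<infinity>"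
proof -
  obtain \<phi> where f: "f \<in> borel_measurable lebesgue" and \<phi>: "\<And>n. \<phi> n \<in> test_functions" and
    lim: "\<And>K. compact K \<Longrightarrow> (\<lambda>n. \<integral>\<^sup>+x\<in>K. ennreal \<bar>\<phi> n x - f x\<bar> \<partial>lebesgue) \<longlonglongrightarrow> 0"
    using assms by (auto simp: hom_besov_def)
  show "f \<in> borel_measurable lebesgue" by fact
  define K where "K = cube a L"
  have K: "compact K" "K \<in> sets borel" by (auto simp: K_def cube_def)
  have "\<forall>\<^sub>F n in sequentially. (\<integral>\<^sup>+x\<in>K. ennreal \<bar>\<phi> n x - f x\<bar> \<partial>lebesgue) < 1"
    by (rule order_tendstoD[OF lim[OF K(1)]]) simp
  then obtain n where n: "(\<integral>\<^sup>+x\<in>K. ennreal \<bar>\<phi> n x - f x\<bar> \<partial>lebesgue) < 1"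
    by (auto simp: eventually_sequentially)
  have int: "integrable lborel (\<phi> n)" by (rule test_function_integrable[OF \<phi>])
  have \<phi>m: "\<phi> n \<in> borel_measurable lebesgue" using int by (auto intro!: measurable_completion)
  have "(\<integral>\<^sup>+x\<in>K. ennreal \<bar>f x\<bar> \<partial>lebesgue) \<le> (\<integral>\<^sup>+x. ennreal \<bar>\<phi> n x - f x\<bar> * indicator K x + ennreal \<bar>\<phi> n x\<bar> \<partial>lebesgue)"
  proof (rule nn_integral_mono)
    fix x
    have "ennreal \<bar>f x\<bar> \<le> ennreal (\<bar>\<phi> n x - f x\<bar> + \<bar>\<phi> n x\<bar>)" by (rule ennreal_leI) linarith
    then show "ennreal \<bar>f x\<bar> * indicator K x \<le> ennreal \<bar>\<phi> n x - f x\<bar> * indicator K x + ennreal \<bar>\<phi> n x\<bar>"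
      by (cases "x \<in> K") auto
  qed
  also have "\<dots> = (\<integral>\<^sup>+x\<in>K. ennreal \<bar>\<phi> n x - f x\<bar> \<partial>lebesgue) + (\<integral>\<^sup>+x. ennreal \<bar>\<phi> n x\<bar> \<partial>lebesgue)"
  proof -
    have K': "K \<in> sets lebesgue" using K by simp
    note [measurable] = f \<phi>m K'
    show ?thesis by (rule nn_integral_add) measurable
  qed
  also have "(\<integral>\<^sup>+x. ennreal \<bar>\<phi> n x\<bar> \<partial>lebesgue) = (\<integral>\<^sup>+x. ennreal \<bar>\<phi> n x\<bar> \<partial>lborel)"
    by (rule nn_integral_completion)
  also have "(\<integral>\<^sup>+x\<in>K. ennreal \<bar>\<phi> n x - f x\<bar> \<partial>lebesgue) + (\<integral>\<^sup>+x. ennreal \<bar>\<phi> n x\<bar> \<partial>lborel) < \<infinity>"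
    using n int by (auto simp: integrable_iff_bounded intro: order.strict_trans)
  finally show "(\<integral>\<^sup>+x\<in>cube a L. ennreal \<bar>f x\<bar> \<partial>lebesgue) < \<infinity>" by (simp add: K_def)
qed

text \<open>A finite quasi-norm alone does not give this: a nonconstant polynomial of degree below
  \<open>k\<close> has quasi-norm 0. An approximant is split as \<open>\<psi> m + \<phi> N\<close>.
  The oscillation of \<open>\<psi> m\<close>, whose quasi-norm is below 1, is O(l^{-\<epsilon>}) on
  cubes of side l, uniformly in \<open>m\<close>; that of the fixed integrable
  \<open>\<phi> N\<close> tends to 0.\<close>

lemma hom_besov_mean_osc_tendsto:
  fixes f :: "'a::euclidean_space \<Rightarrow> real"
  assumes p: "1 < p" and q: "0 < q" and r: "0 < r" and k: "1 \<le> k" and \<epsilon>: "0 < \<epsilon>" "\<epsilon> < real DIM('a) / p"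
    and f: "f \<in> hom_besov (real DIM('a) / p - \<epsilon>) r p q k"
  shows "(\<lambda>n. mean_osc f (ccube n)) \<longlonglongrightarrow> 0"
proof -
  define s where "s = real DIM('a) / p - \<epsilon>"
  have s: "0 \<le> s" using \<epsilon> by (simp add: s_def)
  obtain \<phi> where \<phi>: "\<And>n. \<phi> n \<in> test_functions" and
    cauchy: "\<And>e. 0 < e \<Longrightarrow> \<exists>N. \<forall>m\<ge>N. \<forall>n\<ge>N. hom_besov_norm s r p q k (\<lambda>x. \<phi> m x - \<phi> n x) < e" and
    lim: "\<And>K. compact K \<Longrightarrow> (\<lambda>n. \<integral>\<^sup>+x\<in>K. ennreal \<bar>\<phi> n x - f x\<bar> \<partial>lebesgue) \<longlonglongrightarrow> 0"
    using f by (auto simp: hom_besov_def s_def)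
  have fm: "f \<in> borel_measurable lebesgue" and fint: "\<And>a L. (\<integral>\<^sup>+x\<in>cube a L. ennreal \<bar>f x\<bar> \<partial>lebesgue) < \<infinity>"
    using hom_besov_locally_integrable[OF f] by auto
  \<comment> \<open>The single tolerance 1 suffices: decay comes from l^{-\<epsilon>}, while the
    Cauchy property supplies the uniform bound.\<close>
  obtain N where N: "\<And>m. N \<le> m \<Longrightarrow> hom_besov_norm s r p q k (\<lambda>x. \<phi> m x - \<phi> N x) < 1"
    using cauchy[of 1] by auto
  have \<phi>int: "integrable lborel (\<phi> m)" for m by (rule test_function_integrable[OF \<phi>])
  have \<phi>m: "\<phi> m \<in> borel_measurable borel" for m using \<phi>int[of m] by auto
  define \<psi> where "\<psi> m x = \<phi> m x - \<phi> N x" for m x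
  have \<psi>int: "integrable lborel (\<psi> m)" for m unfolding \<psi>_def using \<phi>int by auto
  have \<psi>b: "\<psi> m \<in> borel_measurable borel" for m using \<psi>int[of m] by auto
  have \<psi>m: "\<psi> m \<in> borel_measurable lebesgue" for m using \<psi>int[of m] by (auto intro!: measurable_completion)
  obtain K where K: "0 < K" and bd:
    "\<And>(f::'a::euclidean_space \<Rightarrow> real) \<Omega> I N u a L. f \<in> borel_measurable lebesgue \<Longrightarrow> \<Omega> \<in> sets borel \<Longrightarrow> 0 < N \<Longrightarrow>
      modulus \<Omega> I k p q f u \<le> ennreal N \<Longrightarrow> 0 < L \<Longrightarrow> cube a L \<subseteq> \<Omega> \<Longrightarrow> {0<..1 * L ^ DIM('a)} \<subseteq> I \<Longrightarrow>
      fdiff_bound (cube a L) k p u (K * N) f"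
    using fdiff_bound_of_modulus[OF p q, of 1 k, where 'a='a] by auto
  obtain C where C: "0 < C" and osc:
    "\<And>(f::'a::euclidean_space \<Rightarrow> real) t S a l. f \<in> borel_measurable lebesgue \<Longrightarrow>
      (\<And>a L. (\<integral>\<^sup>+x\<in>cube a L. ennreal \<bar>f x\<bar> \<partial>lebesgue) < \<infinity>) \<Longrightarrow> 0 < t \<Longrightarrow> 0 < S \<Longrightarrow>
      (\<And>u a L. t \<le> u \<Longrightarrow> 0 < L \<Longrightarrow> fdiff_bound (cube a L) k p u (S * u powr (real DIM('a) / p)) f) \<Longrightarrow>
      (\<lambda>n. mean_osc f (ccube n)) \<longlonglongrightarrow> 0 \<Longrightarrow> t \<le> l \<Longrightarrow>
      mean_osc f (cube a l) \<le> ennreal (C * S)"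
    using mean_osc_le_UNIV[OF k less_imp_le[OF p], where 'a='a] by blast
  define A where "A = 2 powr (1 / enn2real r) * 2 powr s"
  have A: "0 < A" by (simp add: A_def)
  have \<psi>_osc: "mean_osc (\<psi> m) (cube a l) \<le> ennreal (C * (K * A * l powr (- \<epsilon>)))" if m: "N \<le> m" and l: "0 < l" for m a l
  proof (rule osc[OF \<psi>m _ l])
    show "(\<integral>\<^sup>+x\<in>cube a L. ennreal \<bar>\<psi> m x\<bar> \<partial>lebesgue) < \<infinity>" for a L
    proof -
      have "(\<integral>\<^sup>+x\<in>cube a L. ennreal \<bar>\<psi> m x\<bar> \<partial>lebesgue) = (\<integral>\<^sup>+x\<in>cube a L. ennreal \<bar>\<psi> m x\<bar> \<partial>lborel)"
        by (rule nn_integral_completion)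
      also have "\<dots> \<le> (\<integral>\<^sup>+x. ennreal (norm (\<psi> m x)) \<partial>lborel)"
        by (intro nn_integral_mono) (auto simp: indicator_def)
      also have "\<dots> < \<infinity>" using \<psi>int[of m] by (simp add: integrable_iff_bounded)
      finally show ?thesis .
    qed
    show "0 < K * A * l powr (- \<epsilon>)" using K A l by simp
    show "(\<lambda>n. mean_osc (\<psi> m) (ccube n)) \<longlonglongrightarrow> 0" by (rule tendsto_mean_osc_ccube[OF \<psi>int])
    fix u :: real and a :: 'a and L :: real assume u: "l \<le> u" and L: "0 < L"
    have u0: "0 < u" using l u by simp
    have "modulus UNIV {0<..} k p q (\<psi> m) u \<le> ennreal (2 powr (1 / enn2real r) * (2 * u) powr s) * hom_besov_norm s r p q k (\<psi> m)"
      unfolding hom_besov_norm_def using r s u0 by (intro modulus_le_Lq_dtt) auto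
    also have "\<dots> \<le> ennreal (2 powr (1 / enn2real r) * (2 * u) powr s) * 1"
      using N[OF m] by (intro mult_left_mono) (simp_all add: \<psi>_def[abs_def] less_imp_le)
    also have "2 powr (1 / enn2real r) * (2 * u) powr s = A * u powr s" using u0 by (simp add: A_def powr_mult)
    finally have "modulus UNIV {0<..} k p q (\<psi> m) u \<le> ennreal (A * u powr s)" by simp
    then have "fdiff_bound (cube a L) k p u (K * (A * u powr s)) (\<psi> m)"
      using A u0 L by (intro bd[OF \<psi>m, of UNIV]) auto
    moreover have "K * (A * u powr s) \<le> K * A * l powr (- \<epsilon>) * u powr (real DIM('a) / p)"
    proof -
      \<comment> \<open>The gap \<epsilon> between the smoothness and d/p becomes decay in the side
        length.\<close>
      have "u powr s = u powr (- \<epsilon>) * u powr (real DIM('a) / p)" by (simp add: s_def powr_add[symmetric])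
      also have "\<dots> \<le> l powr (- \<epsilon>) * u powr (real DIM('a) / p)"
        using u l \<epsilon> by (intro mult_right_mono powr_mono2') auto
      finally show ?thesis using K A by simp
    qed
    ultimately show "fdiff_bound (cube a L) k p u (K * A * l powr (- \<epsilon>) * u powr (real DIM('a) / p)) (\<psi> m)"
      by (rule fdiff_bound_mono)
  qed simp
  \<comment> \<open>For given \<open>n\<close> an approximant \<open>\<phi> m\<close> close to
    \<open>f\<close> on this cube is chosen; the bound on \<open>\<psi> m\<close> does not depend on
    that choice.\<close>
  have main: "mean_osc f (ccube n) \<le> ennreal (2 * (C * (K * A)) * (2 * real n) powr (- \<epsilon>)) + 2 * mean_osc (\<phi> N) (ccube n)" if n: "1 \<le> n" for n
  proof (rule ennreal_le_epsilon)
    fix e :: real assume e: "0 < e"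
    have n0: "0 < 2 * real n" using n by simp
    define l where "l = 2 * real n"
    define a :: 'a where "a = - real n *\<^sub>R \<Sum>Basis"
    have Q: "ccube n = cube a l" by (simp add: ccube_def a_def l_def)
    have l0: "0 < l" using n0 by (simp add: l_def)
    have "\<forall>\<^sub>F m in sequentially. (\<integral>\<^sup>+x\<in>ccube n. ennreal \<bar>\<phi> m x - f x\<bar> \<partial>lebesgue) < ennreal (e * l ^ DIM('a) / 2)"
      by (rule order_tendstoD[OF lim]) (use e l0 in \<open>auto simp: Q cube_def\<close>)
    moreover have "\<forall>\<^sub>F m in sequentially. N \<le> m" by (rule eventually_ge_at_top)
    ultimately have "\<forall>\<^sub>F m in sequentially. N \<le> m \<and> (\<integral>\<^sup>+x\<in>ccube n. ennreal \<bar>\<phi> m x - f x\<bar> \<partial>lebesgue) < ennreal (e * l ^ DIM('a) / 2)"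
      by eventually_elim auto
    then obtain m where m: "N \<le> m" "(\<integral>\<^sup>+x\<in>ccube n. ennreal \<bar>\<phi> m x - f x\<bar> \<partial>lebesgue) < ennreal (e * l ^ DIM('a) / 2)"
      by (auto simp: eventually_sequentially)
    have "mean_osc f (ccube n) \<le> 2 * (\<integral>\<^sup>+y\<in>ccube n. ennreal \<bar>\<psi> m y + \<phi> N y - f y\<bar> \<partial>lebesgue) / ennreal (l ^ DIM('a))
      + 2 * mean_osc (\<psi> m) (ccube n) + 2 * mean_osc (\<phi> N) (ccube n)"
      unfolding Q by (rule mean_osc_triangle[OF fm fint l0 \<psi>b \<phi>m])
    also have "(\<integral>\<^sup>+y\<in>ccube n. ennreal \<bar>\<psi> m y + \<phi> N y - f y\<bar> \<partial>lebesgue) = (\<integral>\<^sup>+x\<in>ccube n. ennreal \<bar>\<phi> m x - f x\<bar> \<partial>lebesgue)"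
      by (simp add: \<psi>_def)
    also have "2 * (\<integral>\<^sup>+x\<in>ccube n. ennreal \<bar>\<phi> m x - f x\<bar> \<partial>lebesgue) / ennreal (l ^ DIM('a)) \<le> 2 * ennreal (e * l ^ DIM('a) / 2) / ennreal (l ^ DIM('a))"
      using m(2) by (intro divide_right_mono_ennreal mult_left_mono) auto
    also have "2 * ennreal (e * l ^ DIM('a) / 2) = ennreal (2 * (e * l ^ DIM('a) / 2))"
      using e l0 by (subst ennreal_mult) auto
    also have "ennreal (2 * (e * l ^ DIM('a) / 2)) / ennreal (l ^ DIM('a)) = ennreal e"
      using e l0 by (subst divide_ennreal) auto
    also have "mean_osc (\<psi> m) (ccube n) \<le> ennreal (C * (K * A * l powr (- \<epsilon>)))"
      unfolding Q by (rule \<psi>_osc[OF m(1) l0])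
    also have "2 * ennreal (C * (K * A * l powr (- \<epsilon>))) = ennreal (2 * (C * (K * A)) * l powr (- \<epsilon>))"
      using C K A by (subst ennreal_numeral[symmetric], subst ennreal_mult[symmetric]) (auto simp: mult_ac)
    finally show "mean_osc f (ccube n) \<le> ennreal (2 * (C * (K * A)) * (2 * real n) powr (- \<epsilon>)) + 2 * mean_osc (\<phi> N) (ccube n) + ennreal e"
      by (simp add: l_def add_ac mult_left_mono add_mono)
  qed
  have "(\<lambda>n. (2 * real n) powr (- \<epsilon>)) \<longlonglongrightarrow> 0"
  proof (rule tendsto_neg_powr)
    show "filterlim (\<lambda>n. 2 * real n) at_top sequentially"
      by (rule filterlim_tendsto_pos_mult_at_top[OF tendsto_const _ filterlim_real_sequentially]) simp
  qed (use \<epsilon> in simp)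
  then have "(\<lambda>n. ennreal (2 * (C * (K * A)) * (2 * real n) powr (- \<epsilon>))) \<longlonglongrightarrow> ennreal (2 * (C * (K * A)) * 0)"
    by (intro tendsto_ennrealI tendsto_mult tendsto_const)
  moreover have "(\<lambda>n. 2 * mean_osc (\<phi> N) (ccube n)) \<longlonglongrightarrow> 2 * 0"
    by (intro ennreal_tendsto_cmult tendsto_mean_osc_ccube \<phi>int) simp
  ultimately have "(\<lambda>n. ennreal (2 * (C * (K * A)) * (2 * real n) powr (- \<epsilon>)) + 2 * mean_osc (\<phi> N) (ccube n)) \<longlonglongrightarrow> 0"
    using tendsto_add by fastforce
  then show ?thesis by (rule tendsto_0_le_ennreal) (rule main)
qed

section \<open>Dilating the step of a difference\<close>

lemma fdiff_scaleR:
  "fdiff (real n *\<^sub>R h) g x = (\<Sum>m<n. fdiff h g (x + real m *\<^sub>R h))"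
  by (induction n) (auto simp: fdiff_def algebra_simps)

lemma fdiff_funpow_commute:
  "(fdiff h ^^ j) (fdiff h' g) = fdiff h' ((fdiff h ^^ j) g)"
  by (induction j) (auto simp: fdiff_def fun_eq_iff add_ac)

lemma fdiff_borel_measurable:
  fixes g :: "'a::euclidean_space \<Rightarrow> real"
  assumes [measurable]: "g \<in> borel_measurable borel"
  shows "fdiff h g \<in> borel_measurable borel"
  unfolding fdiff_def[abs_def] by measurable

lemma integral_translate:
  fixes v :: "'a::euclidean_space"
  assumes [measurable]: "F \<in> borel_measurable borel" "E \<in> sets borel"
  shows "(\<integral>\<^sup>+x\<in>E. F (x + v) \<partial>lborel) = (\<integral>\<^sup>+y\<in>{y. y - v \<in> E}. F y \<partial>lborel)"
    and "measure lborel {y. y - v \<in> E} = measure lborel E"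
    and "{y. y - v \<in> E} \<in> sets borel"
proof -
  show E': "{y. y - v \<in> E} \<in> sets borel" by measurable
  have tr: "(\<integral>\<^sup>+x\<in>E. H (x + v) \<partial>lborel) = (\<integral>\<^sup>+y\<in>{y. y - v \<in> E}. H y \<partial>lborel)"
    if [measurable]: "H \<in> borel_measurable borel" for H :: "'a \<Rightarrow> ennreal"
  proof -
    have "(\<integral>\<^sup>+y\<in>{y. y - v \<in> E}. H y \<partial>lborel) = (\<integral>\<^sup>+x. H (v + 1 *\<^sub>R x) * indicator {y. y - v \<in> E} (v + 1 *\<^sub>R x) \<partial>lborel)"
      using E' by (subst nn_integral_lborel_affine[of _ 1 v]) auto
    also have "\<dots> = (\<integral>\<^sup>+x\<in>E. H (x + v) \<partial>lborel)"
      by (intro nn_integral_cong) (auto simp: indicator_def add.commute)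
    finally show ?thesis by simp
  qed
  then show "(\<integral>\<^sup>+x\<in>E. F (x + v) \<partial>lborel) = (\<integral>\<^sup>+y\<in>{y. y - v \<in> E}. F y \<partial>lborel)" by simp
  have "emeasure lborel E = emeasure lborel {y. y - v \<in> E}"
    using tr[of "\<lambda>_. 1"] E' by (simp add: nn_integral_indicator)
  then show "measure lborel {y. y - v \<in> E} = measure lborel E" by (simp add: measure_def)
qed

text \<open>Factors with step \<open>h\<close> are exchanged for factors with step
  \<open>n h\<close> one at a time. By telescoping, a long step is a sum of \<open>n\<close>
  translates of a short one, and the bound is translation invariant, so each exchange costs a factor
  \<open>n\<close>. The bound is assumed on all cubes because the translates leave
  \<open>E\<close>.\<close>

lemma fdiff_bound_multiple_step:
  fixes g :: "'a::euclidean_space \<Rightarrow> real"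
  assumes g: "g \<in> borel_measurable borel" and W: "0 \<le> W" and h: "norm h \<le> t"
    and bd: "\<And>a L. 0 < L \<Longrightarrow> fdiff_bound (cube a L) k p t W g"
    and E: "E \<in> sets borel" "bounded E" and j: "j \<le> k"
  shows "(\<integral>\<^sup>+x\<in>E. ennreal \<bar>(fdiff (real n *\<^sub>R h) ^^ j) ((fdiff h ^^ (k - j)) g) x\<bar> \<partial>lborel)
    \<le> ennreal (real n ^ j * W * measure lborel E powr (1 - 1 / p))"
  using j E
proof (induction j arbitrary: E)
  case 0
  have "bounded ((+) (real k *\<^sub>R h) ` E)" using 0 by (intro bounded_translation)
  then have "bounded (E \<union> (+) (real k *\<^sub>R h) ` E)" using 0 by simp
  then obtain n0 where n0: "\<And>n. n0 \<le> n \<Longrightarrow> E \<union> (+) (real k *\<^sub>R h) ` E \<subseteq> ccube n"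
    using bounded_subset_ccube by blast
  have "E \<union> (+) (real k *\<^sub>R h) ` E \<subseteq> ccube (Suc n0)" by (rule n0) simp
  then have "E \<subseteq> {x \<in> ccube (Suc n0). x + real k *\<^sub>R h \<in> ccube (Suc n0)}" by (auto simp: add.commute)
  then have "(\<integral>\<^sup>+x\<in>E. ennreal \<bar>(fdiff h ^^ k) g x\<bar> \<partial>lborel) \<le> ennreal (W * measure lborel E powr (1 - 1 / p))"
    unfolding ccube_def using 0 h by (intro fdiff_boundD[OF bd]) auto
  then show ?case by simp
next
  case (Suc j)
  define G where "G = (fdiff (real n *\<^sub>R h) ^^ j) ((fdiff h ^^ (k - Suc j)) g)"
  have G: "G \<in> borel_measurable borel"
    unfolding G_def by (intro fdiff_funpow_measurable(2) g)
  have hG[measurable]: "fdiff h G \<in> borel_measurable borel" by (rule fdiff_borel_measurable[OF G])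
  have [measurable]: "E \<in> sets borel" by fact
  have hG_eq: "fdiff h G = (fdiff (real n *\<^sub>R h) ^^ j) ((fdiff h ^^ (k - j)) g)"
  proof -
    have "k - j = Suc (k - Suc j)" using Suc.prems by simp
    then show ?thesis by (simp add: G_def fdiff_funpow_commute)
  qed
  have "(\<integral>\<^sup>+x\<in>E. ennreal \<bar>(fdiff (real n *\<^sub>R h) ^^ Suc j) ((fdiff h ^^ (k - Suc j)) g) x\<bar> \<partial>lborel)
      = (\<integral>\<^sup>+x\<in>E. ennreal \<bar>\<Sum>m<n. fdiff h G (x + real m *\<^sub>R h)\<bar> \<partial>lborel)"
    by (simp add: G_def fdiff_scaleR)
  also have "\<dots> \<le> (\<integral>\<^sup>+x. (\<Sum>m<n. ennreal \<bar>fdiff h G (x + real m *\<^sub>R h)\<bar> * indicator E x) \<partial>lborel)"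
  proof (rule nn_integral_mono)
    fix x
    have "ennreal \<bar>\<Sum>m<n. fdiff h G (x + real m *\<^sub>R h)\<bar> \<le> ennreal (\<Sum>m<n. \<bar>fdiff h G (x + real m *\<^sub>R h)\<bar>)"
      by (intro ennreal_leI sum_abs)
    also have "\<dots> = (\<Sum>m<n. ennreal \<bar>fdiff h G (x + real m *\<^sub>R h)\<bar>)" by simp
    finally show "ennreal \<bar>\<Sum>m<n. fdiff h G (x + real m *\<^sub>R h)\<bar> * indicator E x
      \<le> (\<Sum>m<n. ennreal \<bar>fdiff h G (x + real m *\<^sub>R h)\<bar> * indicator E x)"
      by (simp add: sum_distrib_right[symmetric] mult_right_mono del: sum_ennreal)
  qed
  also have "\<dots> = (\<Sum>m<n. \<integral>\<^sup>+x\<in>E. ennreal \<bar>fdiff h G (x + real m *\<^sub>R h)\<bar> \<partial>lborel)"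
    by (rule nn_integral_sum) measurable
  also have "\<dots> \<le> (\<Sum>m<n. ennreal (real n ^ j * W * measure lborel E powr (1 - 1 / p)))"
  proof (rule sum_mono)
    fix m
    define v where "v = real m *\<^sub>R h"
    have "(\<integral>\<^sup>+x\<in>E. ennreal \<bar>fdiff h G (x + v)\<bar> \<partial>lborel) = (\<integral>\<^sup>+y\<in>{y. y - v \<in> E}. ennreal \<bar>fdiff h G y\<bar> \<partial>lborel)"
      by (rule integral_translate(1)[of "\<lambda>y. ennreal \<bar>fdiff h G y\<bar>"]) measurable
    also have "\<dots> \<le> ennreal (real n ^ j * W * measure lborel {y. y - v \<in> E} powr (1 - 1 / p))"
      unfolding hG_eq
    proof (rule Suc.IH)
      show "{y. y - v \<in> E} \<in> sets borel" by measurable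
      have "{y. y - v \<in> E} = (+) v ` E" by (auto simp: image_iff intro!: bexI[of _ "x - v" for x])
      then show "bounded {y. y - v \<in> E}" using bounded_translation[OF Suc.prems(3)] by simp
    qed (use Suc.prems in simp)
    also have "measure lborel {y. y - v \<in> E} = measure lborel E"
      by (rule integral_translate(2)[of "\<lambda>_. 0"]) auto
    finally show "(\<integral>\<^sup>+x\<in>E. ennreal \<bar>fdiff h G (x + real m *\<^sub>R h)\<bar> \<partial>lborel) \<le> ennreal (real n ^ j * W * measure lborel E powr (1 - 1 / p))"
      by (simp add: v_def)
  qed
  also have "\<dots> = ennreal (\<Sum>m<n. real n ^ j * W * measure lborel E powr (1 - 1 / p))"
    using W by (intro sum_ennreal) auto
  also have "(\<Sum>m<n. real n ^ j * W * measure lborel E powr (1 - 1 / p)) = real n ^ Suc j * W * measure lborel E powr (1 - 1 / p)"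
    by simp
  finally show ?case .
qed

text \<open>A step of length at most \<open>u\<close> is cut into \<lceil>u/t\<rceil> \<le> 2u/t
  pieces of length at most \<open>t\<close>. For k = d/p the growth in \<open>u\<close> is exactly
  that of the weight u^{d/p}.\<close>

lemma fdiff_bound_scale:
  fixes f :: "'a::euclidean_space \<Rightarrow> real"
  assumes f: "f \<in> borel_measurable lebesgue" and W: "0 \<le> W" and t: "0 < t" "t \<le> u"
    and bd: "\<And>a L. 0 < L \<Longrightarrow> fdiff_bound (cube a L) k p t W f" and L: "0 < L"
  shows "fdiff_bound (cube a L) k p u (W * (2 * u / t) ^ k) f"
proof -
  obtain g where gb: "g \<in> borel_measurable lborel" and ae: "AE x in lborel. f x = g x"
    using completion_ex_borel_measurable_real[OF f] by blast
  have g: "g \<in> borel_measurable borel" using gb by simp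
  have fg: "AE x in lborel. x \<in> Q \<longrightarrow> f x = g x" and gf: "AE x in lborel. x \<in> Q \<longrightarrow> g x = f x" for Q
    using ae by (auto elim: eventually_mono)
  have bdg: "fdiff_bound (cube a L) k p t W g" if "0 < L" for a L
    by (rule fdiff_bound_AE_cong[OF bd[OF that] convex_cube fg])
  have "fdiff_bound (cube a L) k p u (W * (2 * u / t) ^ k) g"
    unfolding fdiff_bound_def
  proof (intro allI impI)
    fix h :: 'a and E
    assume h: "norm h \<le> u" and E: "E \<in> sets borel" "E \<subseteq> {x \<in> cube a L. x + real k *\<^sub>R h \<in> cube a L}"
    define n where "n = nat \<lceil>u / t\<rceil>"
    have ut: "1 \<le> u / t" using t by simp
    have n1: "u / t \<le> real n" unfolding n_def by linarith
    have n2: "real n \<le> 2 * u / t"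
    proof -
      have "real n \<le> u / t + 1" unfolding n_def using ut by linarith
      then show ?thesis using ut by simp
    qed
    have n0: "0 < real n" using n1 ut by linarith
    define h' where "h' = (1 / real n) *\<^sub>R h"
    have hh': "h = real n *\<^sub>R h'" using n0 by (simp add: h'_def)
    have "norm h' = norm h / real n" by (simp add: h'_def)
    also have "\<dots> \<le> u / real n" using h n0 by (intro divide_right_mono) auto
    also have "\<dots> \<le> t" using n1 n0 t by (simp add: field_simps)
    finally have h': "norm h' \<le> t" .
    have "bounded E" using E bounded_cube[of a L] by (auto intro: bounded_subset)
    then have "(\<integral>\<^sup>+x\<in>E. ennreal \<bar>(fdiff (real n *\<^sub>R h') ^^ k) ((fdiff h' ^^ (k - k)) g) x\<bar> \<partial>lborel)
      \<le> ennreal (real n ^ k * W * measure lborel E powr (1 - 1 / p))"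
      by (intro fdiff_bound_multiple_step[OF g W h' bdg E(1)]) auto
    also have "\<dots> \<le> ennreal (W * (2 * u / t) ^ k * measure lborel E powr (1 - 1 / p))"
    proof (intro ennreal_leI mult_right_mono)
      have "W * real n ^ k \<le> W * (2 * u / t) ^ k"
        using W n2 by (intro mult_left_mono power_mono) auto
      then show "real n ^ k * W \<le> W * (2 * u / t) ^ k" by (simp add: mult.commute)
    qed simp
    finally show "(\<integral>\<^sup>+x\<in>E. ennreal \<bar>(fdiff h ^^ k) g x\<bar> \<partial>lborel) \<le> ennreal (W * (2 * u / t) ^ k * measure lborel E powr (1 - 1 / p))"
      by (simp add: hh'[symmetric])
  qed
  then show ?thesis by (rule fdiff_bound_AE_cong[OF _ convex_cube gf])
qed

section \<open>Hardy-type inequalities\<close>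

text \<open>Superlevel sets are upward closed, hence open or closed rays, empty, or everything. The
  modulus, a supremum over uncountably many steps, gets its measurability from here.\<close>

lemma borel_measurable_mono_ennreal:
  fixes \<omega> :: "real \<Rightarrow> ennreal"
  assumes "mono \<omega>"
  shows "\<omega> \<in> borel_measurable borel"
proof (rule borel_measurableI_greater)
  fix y
  define S where "S = {x. y < \<omega> x}"
  have up: "z \<in> S" if "x \<in> S" "x \<le> z" for x z
    using that monoD[OF assms, of x z] by (auto simp: S_def intro: order.strict_trans2)
  have "S \<in> sets borel"
  proof (cases "S = {} \<or> \<not> bdd_below S")
    case True
    then have "S = {} \<or> S = UNIV"
      using up unfolding bdd_below_def by (metis UNIV_eq_I linear)
    then show ?thesis by auto
  next
    case False
    define a where "a = Inf S"
    have "{a<..} \<subseteq> S"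
    proof
      fix z assume "z \<in> {a<..}"
      then obtain x where "x \<in> S" "x < z" using False cInf_less_iff[of S z] by (auto simp: a_def)
      then show "z \<in> S" using up by auto
    qed
    moreover have "S \<subseteq> {a..}" using False by (auto simp: a_def intro: cInf_lower)
    ultimately have "S = {a..} \<or> S = {a<..}" by (cases "a \<in> S") (auto simp: less_le subset_iff; blast)+
    then show ?thesis by auto
  qed
  then show "{x \<in> space borel. y < \<omega> x} \<in> sets borel" by (simp add: S_def)
qed

lemma nn_integral_powr_from_0:
  assumes a: "0 < a" and c: "0 \<le> c"
  shows "(\<integral>\<^sup>+t\<in>{0..c}. ennreal (t powr (a - 1)) \<partial>lborel) = ennreal (c powr a / a)"
  using nn_integral_has_integral_lebesgue'[OF _ has_integral_powr_from_0[of "a - 1" c]] a c by simp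

text \<open>The power is invertible and increasing, so the bound can be carried to the exponent 1/a,
  where it is an ordinary upper bound of the family.\<close>

lemma epowr_SUP_le:
  assumes "0 < a" "\<And>i. i \<in> A \<Longrightarrow> epowr (f i) a \<le> c"
  shows "epowr (SUP i\<in>A. f i) a \<le> c"
proof -
  have ia: "0 < 1 / a" using assms by simp
  have c: "epowr (epowr c (1 / a)) a = c" using epowr_inverse[OF ia, of c] by simp
  have "f i \<le> epowr c (1 / a)" if "i \<in> A" for i
    using assms(2)[OF that] epowr_le_iff[OF assms(1), of "f i" "epowr c (1 / a)"] c by simp
  then have "(SUP i\<in>A. f i) \<le> epowr c (1 / a)" by (rule SUP_least)
  then have "epowr (SUP i\<in>A. f i) a \<le> epowr (epowr c (1 / a)) a" using assms(1) by (intro epowr_mono) auto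
  then show ?thesis by (simp only: c)
qed

text \<open>Bounding the sum by twice the maximum works for exponents below and above 1 alike, which
  covers quasi-norms with r < 1.\<close>

lemma epowr_add_le:
  assumes "0 < a"
  shows "epowr (x + y) a \<le> ennreal (2 powr a) * (epowr x a + epowr y a)"
proof -
  have "x + y \<le> 2 * max x y" by (simp add: mult_2 add_mono)
  then have "epowr (x + y) a \<le> epowr (ennreal 2 * max x y) a" using assms by (intro epowr_mono) auto
  also have "\<dots> = ennreal (2 powr a) * epowr (max x y) a" using assms by (simp add: epowr_mult epowr_ennreal del: ennreal_numeral)
  also have "\<dots> \<le> ennreal (2 powr a) * (epowr x a + epowr y a)"
    by (intro mult_left_mono) (auto simp: max_def add_increasing add_increasing2)
  finally show ?thesis .
qed

text \<open>For fixed \<open>u\<close> the variable \<open>t\<close> runs at most up to u^d, and the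
  integral of t^{a-1} there is u^{d a}/a. With a = \<epsilon> r/d this 1/a is the source of the loss
  \<epsilon>^{-1/r}.\<close>

lemma integral_tail_Tonelli:
  fixes G :: "real \<Rightarrow> ennreal"
  assumes G[measurable]: "G \<in> borel_measurable borel" and I[measurable]: "I \<in> sets borel" and I0: "I \<subseteq> {0<..}"
    and a: "0 < a" and d: "0 < d"
  shows "(\<integral>\<^sup>+t\<in>I. (ennreal (t powr (a - 1)) * (\<integral>\<^sup>+u\<in>I \<inter> {t powr (1 / d)..}. G u \<partial>lborel)) \<partial>lborel)
    \<le> ennreal (1 / a) * (\<integral>\<^sup>+u\<in>I. (ennreal (u powr (d * a)) * G u) \<partial>lborel)"
proof -
  define H where "H t u = ennreal (t powr (a - 1)) * G u * (indicator I t * (indicator I u * (if t powr (1 / d) \<le> u then 1 else 0)))" for t u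
  have H[measurable]: "(\<lambda>(t, u). H t u) \<in> borel_measurable (lborel \<Otimes>\<^sub>M lborel)"
    unfolding H_def case_prod_beta by measurable
  have "(\<integral>\<^sup>+t\<in>I. (ennreal (t powr (a - 1)) * (\<integral>\<^sup>+u\<in>I \<inter> {t powr (1 / d)..}. G u \<partial>lborel)) \<partial>lborel)
      = (\<integral>\<^sup>+t. (\<integral>\<^sup>+u. H t u \<partial>lborel) \<partial>lborel)"
  proof (rule nn_integral_cong)
    fix t
    have "(\<integral>\<^sup>+u. H t u \<partial>lborel) = (\<integral>\<^sup>+u. (ennreal (t powr (a - 1)) * indicator I t) * (G u * indicator (I \<inter> {t powr (1 / d)..}) u) \<partial>lborel)"
      by (intro nn_integral_cong) (auto simp: H_def indicator_def)
    also have "\<dots> = (ennreal (t powr (a - 1)) * indicator I t) * (\<integral>\<^sup>+u\<in>I \<inter> {t powr (1 / d)..}. G u \<partial>lborel)"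
      by (rule nn_integral_cmult) measurable
    finally show "ennreal (t powr (a - 1)) * (\<integral>\<^sup>+u\<in>I \<inter> {t powr (1 / d)..}. G u \<partial>lborel) * indicator I t = (\<integral>\<^sup>+u. H t u \<partial>lborel)"
      by (simp add: mult_ac)
  qed
  also have "\<dots> = (\<integral>\<^sup>+u. (\<integral>\<^sup>+t. H t u \<partial>lborel) \<partial>lborel)"
    by (rule lborel_pair.Fubini'[OF H, symmetric])
  also have "\<dots> \<le> (\<integral>\<^sup>+u. ennreal (1 / a) * (ennreal (u powr (d * a)) * G u * indicator I u) \<partial>lborel)"
  proof (rule nn_integral_mono)
    fix u :: real
    show "(\<integral>\<^sup>+t. H t u \<partial>lborel) \<le> ennreal (1 / a) * (ennreal (u powr (d * a)) * G u * indicator I u)"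
    proof (cases "u \<in> I")
      case True
      then have u: "0 < u" using I0 by auto
      have "(\<integral>\<^sup>+t. H t u \<partial>lborel) \<le> (\<integral>\<^sup>+t. G u * (ennreal (t powr (a - 1)) * indicator {0..u powr d} t) \<partial>lborel)"
      proof (rule nn_integral_mono)
        fix t
        show "H t u \<le> G u * (ennreal (t powr (a - 1)) * indicator {0..u powr d} t)"
        proof (cases "t \<in> I \<and> t powr (1 / d) \<le> u")
          case True
          then have t: "0 < t" using I0 by auto
          have "(t powr (1 / d)) powr d \<le> u powr d" using True d by (intro powr_mono2) auto
          then have "t \<in> {0..u powr d}" using t d by (simp add: powr_powr)
          then show ?thesis by (auto simp: H_def indicator_def mult_ac)
        qed (auto simp: H_def)
      qed
      also have "\<dots> = G u * ennreal ((u powr d) powr a / a)"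
        using nn_integral_powr_from_0[OF a, of "u powr d"] by (subst nn_integral_cmult) auto
      also have "ennreal ((u powr d) powr a / a) = ennreal (1 / a) * ennreal (u powr (d * a))"
        using a by (simp add: powr_powr ennreal_mult[symmetric])
      finally show ?thesis using True by (simp add: mult_ac)
    qed (simp add: H_def)
  qed
  also have "\<dots> = ennreal (1 / a) * (\<integral>\<^sup>+u\<in>I. (ennreal (u powr (d * a)) * G u) \<partial>lborel)"
    by (rule nn_integral_cmult) measurable
  finally show ?thesis .
qed

text \<open>For fixed \<open>u\<close> the admissible \<open>t\<close> lie in [(u/2)^d, u^d], where
  dt/t has mass at most 2^d: no factor depending on \<epsilon> arises.\<close>

lemma integral_window_Tonelli:
  fixes G :: "real \<Rightarrow> ennreal"
  assumes G[measurable]: "G \<in> borel_measurable borel" and d: "0 < d"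
  shows "(\<integral>\<^sup>+t\<in>{0<..}. (ennreal (1 / t) * (\<integral>\<^sup>+u\<in>{t powr (1 / d)..2 * t powr (1 / d)}. G u \<partial>lborel)) \<partial>lborel)
    \<le> ennreal (2 powr d) * (\<integral>\<^sup>+u\<in>{0<..}. G u \<partial>lborel)"
proof -
  define H where "H t u = ennreal (1 / t) * G u * (indicator {0<..} t * (if t powr (1 / d) \<le> u \<and> u \<le> 2 * t powr (1 / d) then 1 else 0))" for t u
  have H[measurable]: "(\<lambda>(t, u). H t u) \<in> borel_measurable (lborel \<Otimes>\<^sub>M lborel)"
    unfolding H_def case_prod_beta by measurable
  have "(\<integral>\<^sup>+t\<in>{0<..}. (ennreal (1 / t) * (\<integral>\<^sup>+u\<in>{t powr (1 / d)..2 * t powr (1 / d)}. G u \<partial>lborel)) \<partial>lborel)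
      = (\<integral>\<^sup>+t. (\<integral>\<^sup>+u. H t u \<partial>lborel) \<partial>lborel)"
  proof (rule nn_integral_cong)
    fix t :: real
    have "(\<integral>\<^sup>+u. H t u \<partial>lborel) = (\<integral>\<^sup>+u. (ennreal (1 / t) * indicator {0<..} t) * (G u * indicator {t powr (1 / d)..2 * t powr (1 / d)} u) \<partial>lborel)"
      by (intro nn_integral_cong) (auto simp: H_def indicator_def)
    also have "\<dots> = (ennreal (1 / t) * indicator {0<..} t) * (\<integral>\<^sup>+u\<in>{t powr (1 / d)..2 * t powr (1 / d)}. G u \<partial>lborel)"
      by (rule nn_integral_cmult) measurable
    finally show "ennreal (1 / t) * (\<integral>\<^sup>+u\<in>{t powr (1 / d)..2 * t powr (1 / d)}. G u \<partial>lborel) * indicator {0<..} t = (\<integral>\<^sup>+u. H t u \<partial>lborel)"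
      by (simp add: mult_ac)
  qed
  also have "\<dots> = (\<integral>\<^sup>+u. (\<integral>\<^sup>+t. H t u \<partial>lborel) \<partial>lborel)"
    by (rule lborel_pair.Fubini'[OF H, symmetric])
  also have "\<dots> \<le> (\<integral>\<^sup>+u. ennreal (2 powr d) * (G u * indicator {0<..} u) \<partial>lborel)"
  proof (rule nn_integral_mono)
    fix u :: real
    show "(\<integral>\<^sup>+t. H t u \<partial>lborel) \<le> ennreal (2 powr d) * (G u * indicator {0<..} u)"
    proof (cases "0 < u")
      case True
      define c where "c = (u / 2) powr d"
      have c: "0 < c" using True by (simp add: c_def)
      have "(\<integral>\<^sup>+t. H t u \<partial>lborel) \<le> (\<integral>\<^sup>+t. (G u * ennreal (1 / c)) * indicator {0..u powr d} t \<partial>lborel)"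
      proof (rule nn_integral_mono)
        fix t
        show "H t u \<le> (G u * ennreal (1 / c)) * indicator {0..u powr d} t"
        proof (cases "0 < t \<and> t powr (1 / d) \<le> u \<and> u \<le> 2 * t powr (1 / d)")
          case 1: True
          have "(t powr (1 / d)) powr d \<le> u powr d" using 1 d by (intro powr_mono2) auto
          then have tu: "t \<le> u powr d" using 1 d by (simp add: powr_powr)
          have "(u / 2) powr d \<le> (t powr (1 / d)) powr d" using 1 d True by (intro powr_mono2) auto
          then have "c \<le> t" using 1 d by (simp add: powr_powr c_def)
          then have "ennreal (1 / t) \<le> ennreal (1 / c)" using c by (intro ennreal_leI divide_left_mono) auto
          then show ?thesis using 1 tu by (simp add: H_def mult.commute mult_left_mono)
        qed (auto simp: H_def)
      qed
      also have "\<dots> = (G u * ennreal (1 / c)) * emeasure lborel {0..u powr d}"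
        by (rule nn_integral_cmult_indicator) simp
      also have "\<dots> = G u * ennreal (u powr d / c)" using c by (simp add: mult.assoc ennreal_mult[symmetric])
      also have "u powr d / c = 2 powr d" using True by (simp add: c_def powr_divide)
      finally show ?thesis using True by (simp add: mult.commute)
    next
      case False
      have "H t u = 0" for t
        using False by (auto simp: H_def indicator_def dest: order.strict_trans2[OF powr_gt_zero[THEN iffD2], rotated])
      then show ?thesis by simp
    qed
  qed
  also have "\<dots> = ennreal (2 powr d) * (\<integral>\<^sup>+u\<in>{0<..}. G u \<partial>lborel)"
    by (rule nn_integral_cmult) measurable
  finally show ?thesis .
qed

lemma enn2real_one_divide: "0 < r \<Longrightarrow> r \<noteq> \<infinity> \<Longrightarrow> enn2real (1 / r) = 1 / enn2real r"
proof (cases r)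
  case (real x)
  assume "0 < r"
  then have "0 < x" using real by simp
  then have "1 / ennreal x = ennreal (1 / x)" using divide_ennreal[of 1 x] by simp
  then show ?thesis using real \<open>0 < x\<close> by simp
qed simp

lemma weight_powr:
  assumes u: "0 < u" and r': "0 < r'"
  shows "epowr (ennreal (u powr (- (\<sigma> - \<epsilon>))) * w) r' = ennreal (u powr (\<epsilon> * r')) * epowr (ennreal (u powr (- \<sigma>)) * w) r'"
proof -
  have "ennreal (u powr (- (\<sigma> - \<epsilon>))) * w = ennreal (u powr \<epsilon>) * (ennreal (u powr (- \<sigma>)) * w)"
    using u by (simp add: mult.assoc[symmetric] ennreal_mult[symmetric] powr_add[symmetric])
  then show ?thesis using u r' by (simp add: epowr_mult epowr_ennreal powr_powr)
qed

text \<open>\<open>J\<close> holds the \<open>u\<close> whose window [u, 2u] stays in the range; on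
  it the monotone \<omega> bounds its value at \<open>u\<close> by an integral, so the supremum is
  dominated by the tail integral \<open>T\<close>. \<open>F\<close> is the lower-order term: 0 on
  the whole space, the norm of \<open>f\<close> on a cube, where t^{a-1} is integrable over (0,1) at
  the same cost 1/a.\<close>

lemma Lq_dtt_sup_le:
  assumes r: "0 < r" and d: "0 < d" and \<sigma>: "0 \<le> \<sigma>" and C: "0 < C"
  obtains K where "0 < K"
    "\<And>\<epsilon> \<phi> \<omega> F I J. 0 < \<epsilon> \<Longrightarrow> mono \<omega> \<Longrightarrow> I \<in> sets borel \<Longrightarrow> I \<subseteq> {0<..} \<Longrightarrow> J \<subseteq> I \<Longrightarrow>
      (\<And>u. u \<in> J \<Longrightarrow> {u..2 * u} \<subseteq> I) \<Longrightarrow> F = 0 \<or> I = {0<..<1} \<Longrightarrow>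
      (\<And>t. t \<in> I \<Longrightarrow> \<phi> t \<le> ennreal C * ((SUP u\<in>{u\<in>J. t powr (1 / d) \<le> u}. ennreal (u powr (- \<sigma>)) * \<omega> u) + F)) \<Longrightarrow>
      Lq_dtt I r (\<lambda>t. ennreal (t powr (\<epsilon> / d)) * \<phi> t)
        \<le> ennreal (K * \<epsilon> powr (- enn2real (1 / r))) * (F + Lq_dtt I r (\<lambda>u. ennreal (u powr (- (\<sigma> - \<epsilon>))) * \<omega> u))"
proof (cases "r = \<infinity>")
  case True
  show thesis
  proof (rule that[OF C])
    fix \<epsilon> :: real and \<phi> \<omega> :: "real \<Rightarrow> ennreal" and F I J
    assume \<epsilon>: "0 < \<epsilon>" and I: "I \<subseteq> {0<..}" and J: "J \<subseteq> I" and F: "F = 0 \<or> I = {0<..<1}"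
      and \<phi>: "\<And>t. t \<in> I \<Longrightarrow> \<phi> t \<le> ennreal C * ((SUP u\<in>{u\<in>J. t powr (1 / d) \<le> u}. ennreal (u powr (- \<sigma>)) * \<omega> u) + F)"
    define N where "N = (SUP u\<in>I. ennreal (u powr (- (\<sigma> - \<epsilon>))) * \<omega> u)"
    have "ennreal (t powr (\<epsilon> / d)) * \<phi> t \<le> ennreal C * (F + N)" if t: "t \<in> I" for t
    proof -
      have t0: "0 < t" using t I by auto
      have "ennreal (t powr (\<epsilon> / d)) * \<phi> t \<le> ennreal (t powr (\<epsilon> / d)) *
          (ennreal C * ((SUP u\<in>{u\<in>J. t powr (1 / d) \<le> u}. ennreal (u powr (- \<sigma>)) * \<omega> u) + F))"
        by (intro mult_left_mono \<phi> t) simp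
      also have "\<dots> = ennreal C * (ennreal (t powr (\<epsilon> / d)) * (SUP u\<in>{u\<in>J. t powr (1 / d) \<le> u}. ennreal (u powr (- \<sigma>)) * \<omega> u) + ennreal (t powr (\<epsilon> / d)) * F)"
        by (simp only: distrib_left mult.left_commute[of "ennreal (t powr (\<epsilon> / d))"])
      also have "\<dots> \<le> ennreal C * (N + F)"
      proof (intro mult_left_mono add_mono)
        show "ennreal (t powr (\<epsilon> / d)) * (SUP u\<in>{u\<in>J. t powr (1 / d) \<le> u}. ennreal (u powr (- \<sigma>)) * \<omega> u) \<le> N"
          unfolding SUP_mult_left_ennreal
        proof (rule SUP_least)
          fix u assume "u \<in> {u\<in>J. t powr (1 / d) \<le> u}"
          then have u: "u \<in> I" "0 < u" "t powr (1 / d) \<le> u" using J I by auto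
          have "(t powr (1 / d)) powr \<epsilon> \<le> u powr \<epsilon>" using u \<epsilon> by (intro powr_mono2) auto
          then have "t powr (\<epsilon> / d) * u powr (- \<sigma>) \<le> u powr \<epsilon> * u powr (- \<sigma>)"
            by (intro mult_right_mono) (auto simp: powr_powr)
          also have "\<dots> = u powr (- (\<sigma> - \<epsilon>))" by (simp add: powr_add[symmetric])
          finally have "ennreal (t powr (\<epsilon> / d)) * ennreal (u powr (- \<sigma>)) \<le> ennreal (u powr (- (\<sigma> - \<epsilon>)))"
            by (simp add: ennreal_mult[symmetric] ennreal_leI)
          then have "ennreal (t powr (\<epsilon> / d)) * (ennreal (u powr (- \<sigma>)) * \<omega> u) \<le> ennreal (u powr (- (\<sigma> - \<epsilon>))) * \<omega> u"
            unfolding mult.assoc[symmetric] by (rule mult_right_mono) simp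
          also have "\<dots> \<le> N" unfolding N_def using u by (intro SUP_upper) auto
          finally show "ennreal (t powr (\<epsilon> / d)) * (ennreal (u powr (- \<sigma>)) * \<omega> u) \<le> N" .
        qed
        show "ennreal (t powr (\<epsilon> / d)) * F \<le> F"
          using F
        proof
          assume "I = {0<..<1}"
          then have "t \<le> 1" using t by auto
          then have "t powr (\<epsilon> / d) \<le> 1 powr (\<epsilon> / d)" using t0 \<epsilon> d by (intro powr_mono2) auto
          then have "ennreal (t powr (\<epsilon> / d)) \<le> 1" by (simp add: ennreal_leI)
          then show ?thesis using mult_right_mono[of _ 1 F] by simp
        qed simp
      qed simp
      finally show ?thesis by (simp add: add.commute)
    qed
    then show "Lq_dtt I r (\<lambda>t. ennreal (t powr (\<epsilon> / d)) * \<phi> t)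
        \<le> ennreal (C * \<epsilon> powr (- enn2real (1 / r))) * (F + Lq_dtt I r (\<lambda>u. ennreal (u powr (- (\<sigma> - \<epsilon>))) * \<omega> u))"
      \<comment> \<open>For r = \<infinity> the weights compare pointwise, and
        \<open>enn2real (1 / r) = 0\<close> makes the power of \<epsilon> equal to 1.\<close>
      using True \<epsilon> by (auto simp: Lq_dtt_def N_def intro!: SUP_least)
  qed
next
  case False
  define r' where "r' = enn2real r"
  have r': "0 < r'" using enn2real_pos r False by (simp add: r'_def)
  define K1 where "K1 = C powr r' * 2 powr r'"
  \<comment> \<open>The window costs a factor 2, and the weight u^{-\<sigma>} changes by at most
    2^\<sigma> across it.\<close>
  define A where "A = 2 * 2 powr (\<sigma> * r')"
  have K1: "0 < K1" using C by (simp add: K1_def)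
  have A: "1 \<le> A"
  proof -
    have "1 \<le> 2 powr (\<sigma> * r')" using \<sigma> r' by (intro ge_one_powr_ge_zero) auto
    then show ?thesis by (simp add: A_def)
  qed
  \<comment> \<open>Chosen so that (2 K1 A/a)^{1/r'} = K \<epsilon>^{-1/r'} for a = \<epsilon> r'/d.
    The leading 2 merges the contributions of \<open>F\<close> and of the Besov integral.\<close>
  define K where "K = (2 * K1 * A * d / r') powr (1 / r')"
  have K: "0 < K" using K1 A d r' by (simp add: K_def)
  show thesis
  proof (rule that[OF K])
    fix \<epsilon> :: real and \<phi> \<omega> :: "real \<Rightarrow> ennreal" and F I J
    assume \<epsilon>: "0 < \<epsilon>" and \<omega>: "mono \<omega>" and I[measurable]: "I \<in> sets borel" and I0: "I \<subseteq> {0<..}" and J: "J \<subseteq> I"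
      and J2: "\<And>u. u \<in> J \<Longrightarrow> {u..2 * u} \<subseteq> I" and F: "F = 0 \<or> I = {0<..<1}"
      and \<phi>: "\<And>t. t \<in> I \<Longrightarrow> \<phi> t \<le> ennreal C * ((SUP u\<in>{u\<in>J. t powr (1 / d) \<le> u}. ennreal (u powr (- \<sigma>)) * \<omega> u) + F)"
    have [measurable]: "\<omega> \<in> borel_measurable borel" by (rule borel_measurable_mono_ennreal[OF \<omega>])
    define N where "N = Lq_dtt I r (\<lambda>u. ennreal (u powr (- (\<sigma> - \<epsilon>))) * \<omega> u)"
    define G where "G u = epowr (ennreal (u powr (- \<sigma>)) * \<omega> u) r' * ennreal (1 / u)" for u
    have G[measurable]: "G \<in> borel_measurable borel" unfolding G_def[abs_def] by measurable
    define T where "T t = (\<integral>\<^sup>+u\<in>I \<inter> {t powr (1 / d)..}. G u \<partial>lborel)" for t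
    have T[measurable]: "T \<in> borel_measurable borel"
    proof -
      have "(\<lambda>(t, u). G u * (indicator I u * (if t powr (1 / d) \<le> u then 1 else 0))) \<in> borel_measurable (borel \<Otimes>\<^sub>M lborel)"
        by measurable
      then have "(\<lambda>t. \<integral>\<^sup>+u. G u * (indicator I u * (if t powr (1 / d) \<le> u then 1 else 0)) \<partial>lborel) \<in> borel_measurable borel"
        by (rule lborel.borel_measurable_nn_integral)
      also have "(\<lambda>t. \<integral>\<^sup>+u. G u * (indicator I u * (if t powr (1 / d) \<le> u then 1 else 0)) \<partial>lborel) = T"
        unfolding T_def by (intro ext nn_integral_cong) (auto simp: indicator_def)
      finally show ?thesis .
    qed
    define a where "a = \<epsilon> * r' / d"
    have a: "0 < a" using \<epsilon> r' d by (simp add: a_def)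
    define Fr where "Fr = epowr F r'"
    have X: "epowr (SUP u\<in>{u\<in>J. t powr (1 / d) \<le> u}. ennreal (u powr (- \<sigma>)) * \<omega> u) r' \<le> ennreal A * T t" for t
    proof (rule epowr_SUP_le[OF r'])
      fix u0 assume "u0 \<in> {u\<in>J. t powr (1 / d) \<le> u}"
      then have u0: "u0 \<in> J" "t powr (1 / d) \<le> u0" "0 < u0" using J I0 by auto
      have "epowr (ennreal (u0 powr (- \<sigma>)) * \<omega> u0) r' \<le> 2 * (\<integral>\<^sup>+u\<in>I \<inter> {t powr (1 / d)..}. ((ennreal (2 powr (\<sigma> * r')) * epowr (ennreal (u powr (- \<sigma>)) * \<omega> u) r') * ennreal (1 / u)) \<partial>lborel)"
      proof (rule le_integral_dtt[OF u0(3)])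
        show "{u0..2 * u0} \<subseteq> I \<inter> {t powr (1 / d)..}" using J2[OF u0(1)] u0 by auto
        fix s assume s: "s \<in> {u0..2 * u0}"
        have "u0 powr (- \<sigma>) \<le> 2 powr \<sigma> * s powr (- \<sigma>)"
        proof -
          have "(2 * u0) powr (- \<sigma>) \<le> s powr (- \<sigma>)" using s u0 \<sigma> by (intro powr_mono2') auto
          then have "2 powr \<sigma> * (2 * u0) powr (- \<sigma>) \<le> 2 powr \<sigma> * s powr (- \<sigma>)" by (intro mult_left_mono) auto
          moreover have "2 powr \<sigma> * (2 * u0) powr (- \<sigma>) = u0 powr (- \<sigma>)"
            using u0 by (simp add: powr_mult mult.assoc[symmetric] powr_add[symmetric])
          ultimately show ?thesis by simp
        qed
        then have "ennreal (u0 powr (- \<sigma>)) * \<omega> u0 \<le> ennreal (2 powr \<sigma> * s powr (- \<sigma>)) * \<omega> s"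
          using s monoD[OF \<omega>, of u0 s] by (intro mult_mono ennreal_leI) auto
        also have "\<dots> = ennreal (2 powr \<sigma>) * (ennreal (s powr (- \<sigma>)) * \<omega> s)"
          by (simp add: ennreal_mult mult.assoc)
        finally have "epowr (ennreal (u0 powr (- \<sigma>)) * \<omega> u0) r' \<le> epowr (ennreal (2 powr \<sigma>) * (ennreal (s powr (- \<sigma>)) * \<omega> s)) r'"
          using r' by (intro epowr_mono) auto
        also have "\<dots> = ennreal (2 powr (\<sigma> * r')) * epowr (ennreal (s powr (- \<sigma>)) * \<omega> s) r'"
          by (subst epowr_mult[OF r']) (simp add: epowr_ennreal powr_powr)
        finally show "epowr (ennreal (u0 powr (- \<sigma>)) * \<omega> u0) r' \<le> ennreal (2 powr (\<sigma> * r')) * epowr (ennreal (s powr (- \<sigma>)) * \<omega> s) r'" .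
      qed
      also have "(\<integral>\<^sup>+u\<in>I \<inter> {t powr (1 / d)..}. ((ennreal (2 powr (\<sigma> * r')) * epowr (ennreal (u powr (- \<sigma>)) * \<omega> u) r') * ennreal (1 / u)) \<partial>lborel)
          = (\<integral>\<^sup>+u. ennreal (2 powr (\<sigma> * r')) * (G u * indicator (I \<inter> {t powr (1 / d)..}) u) \<partial>lborel)"
        by (intro nn_integral_cong) (simp add: G_def mult.assoc)
      also have "\<dots> = ennreal (2 powr (\<sigma> * r')) * T t"
        unfolding T_def by (rule nn_integral_cmult) measurable
      also have "2 * (ennreal (2 powr (\<sigma> * r')) * T t) = ennreal A * T t"
        unfolding A_def by (simp add: ennreal_mult mult.assoc)
      finally show "epowr (ennreal (u0 powr (- \<sigma>)) * \<omega> u0) r' \<le> ennreal A * T t" .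
    qed
    have i1: "(\<integral>\<^sup>+t\<in>I. (ennreal (t powr (a - 1)) * T t) \<partial>lborel) \<le> ennreal (1 / a) * epowr N r'"
    proof -
      have "(\<integral>\<^sup>+t\<in>I. (ennreal (t powr (a - 1)) * T t) \<partial>lborel) \<le> ennreal (1 / a) * (\<integral>\<^sup>+u\<in>I. (ennreal (u powr (d * a)) * G u) \<partial>lborel)"
        unfolding T_def by (rule integral_tail_Tonelli[OF G I I0 a d])
      also have "(\<integral>\<^sup>+u\<in>I. (ennreal (u powr (d * a)) * G u) \<partial>lborel)
          = (\<integral>\<^sup>+u\<in>I. (epowr (ennreal (u powr (- (\<sigma> - \<epsilon>))) * \<omega> u) r' * ennreal (1 / u)) \<partial>lborel)"
      proof (rule nn_integral_cong)
        fix u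
        show "ennreal (u powr (d * a)) * G u * indicator I u = epowr (ennreal (u powr (- (\<sigma> - \<epsilon>))) * \<omega> u) r' * ennreal (1 / u) * indicator I u"
        proof (cases "u \<in> I")
          case True
          then have u: "0 < u" using I0 by auto
          show ?thesis unfolding weight_powr[OF u r'] using d by (simp add: G_def a_def mult.assoc)
        qed simp
      qed
      also have "\<dots> = epowr N r'"
        using epowr_inverse[of "1 / r'" "\<integral>\<^sup>+u\<in>I. (epowr (ennreal (u powr (- (\<sigma> - \<epsilon>))) * \<omega> u) r' * ennreal (1 / u)) \<partial>lborel"] r' False
        by (simp add: N_def Lq_dtt_def r'_def)
      finally show ?thesis .
    qed
    have i2: "Fr * (\<integral>\<^sup>+t\<in>I. ennreal (t powr (a - 1)) \<partial>lborel) \<le> Fr * ennreal (1 / a)"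
      using F
    proof
        assume "F = 0"
        then have "Fr = 0" by (simp add: Fr_def epowr_def)
        then show ?thesis by simp
      next
        assume "I = {0<..<1}"
        then have "(\<integral>\<^sup>+t\<in>I. ennreal (t powr (a - 1)) \<partial>lborel) \<le> (\<integral>\<^sup>+t\<in>{0..1}. ennreal (t powr (a - 1)) \<partial>lborel)"
          by (intro nn_integral_mono) (auto simp: indicator_def)
        also have "\<dots> = ennreal (1 / a)" using nn_integral_powr_from_0[OF a, of 1] by simp
        finally show ?thesis by (rule mult_left_mono) simp
      qed
    have "(\<integral>\<^sup>+t\<in>I. (epowr (ennreal (t powr (\<epsilon> / d)) * \<phi> t) r' * ennreal (1 / t)) \<partial>lborel)
      \<le> (\<integral>\<^sup>+t. ennreal K1 * (ennreal A * (ennreal (t powr (a - 1)) * T t * indicator I t) + Fr * (ennreal (t powr (a - 1)) * indicator I t)) \<partial>lborel)"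
    proof (rule nn_integral_mono)
      fix t
      show "epowr (ennreal (t powr (\<epsilon> / d)) * \<phi> t) r' * ennreal (1 / t) * indicator I t
        \<le> ennreal K1 * (ennreal A * (ennreal (t powr (a - 1)) * T t * indicator I t) + Fr * (ennreal (t powr (a - 1)) * indicator I t))"
      proof (cases "t \<in> I")
        case True
        then have t: "0 < t" using I0 by auto
        have "epowr (\<phi> t) r' \<le> epowr (ennreal C * ((SUP u\<in>{u\<in>J. t powr (1 / d) \<le> u}. ennreal (u powr (- \<sigma>)) * \<omega> u) + F)) r'"
          using r' by (intro epowr_mono \<phi> True) auto
        also have "\<dots> \<le> ennreal (C powr r') * (ennreal (2 powr r') * (epowr (SUP u\<in>{u\<in>J. t powr (1 / d) \<le> u}. ennreal (u powr (- \<sigma>)) * \<omega> u) r' + Fr))"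
          using C r' unfolding Fr_def by (subst epowr_mult[OF r']) (auto simp: epowr_ennreal intro!: mult_left_mono epowr_add_le)
        also have "\<dots> \<le> ennreal (C powr r') * (ennreal (2 powr r') * (ennreal A * T t + Fr))"
          by (intro mult_left_mono add_right_mono X) auto
        also have "\<dots> = ennreal K1 * (ennreal A * T t + Fr)" by (simp add: K1_def ennreal_mult mult.assoc)
        finally have 1: "epowr (\<phi> t) r' \<le> ennreal K1 * (ennreal A * T t + Fr)" .
        have "epowr (ennreal (t powr (\<epsilon> / d)) * \<phi> t) r' * ennreal (1 / t) = (ennreal (t powr a) * ennreal (1 / t)) * epowr (\<phi> t) r'"
          using r' by (simp add: epowr_mult epowr_ennreal powr_powr a_def mult_ac)
        also have "ennreal (t powr a) * ennreal (1 / t) = ennreal (t powr (a - 1))"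
          using t by (simp add: ennreal_mult[symmetric] powr_diff)
        also have "ennreal (t powr (a - 1)) * epowr (\<phi> t) r' \<le> ennreal (t powr (a - 1)) * (ennreal K1 * (ennreal A * T t + Fr))"
          by (intro mult_left_mono 1) simp
        also have "\<dots> = ennreal K1 * (ennreal A * (ennreal (t powr (a - 1)) * T t) + Fr * ennreal (t powr (a - 1)))"
          by (simp add: distrib_left mult_ac)
        finally show ?thesis using True by simp
      qed simp
    qed
    also have "\<dots> = ennreal K1 * (ennreal A * (\<integral>\<^sup>+t\<in>I. (ennreal (t powr (a - 1)) * T t) \<partial>lborel) + Fr * (\<integral>\<^sup>+t\<in>I. ennreal (t powr (a - 1)) \<partial>lborel))"
      by (subst nn_integral_cmult, measurable, subst nn_integral_add, measurable, subst nn_integral_cmult, measurable, subst nn_integral_cmult, measurable)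
    also have "\<dots> \<le> ennreal K1 * (ennreal A * (ennreal (1 / a) * epowr N r') + Fr * ennreal (1 / a))"
      by (rule mult_left_mono[OF add_mono[OF mult_left_mono[OF i1] i2]]) simp_all
    also have "\<dots> \<le> ennreal K1 * (ennreal A * (ennreal (1 / a) * epowr (F + N) r') + ennreal A * (ennreal (1 / a) * epowr (F + N) r'))"
    proof (intro mult_left_mono add_mono)
      show "epowr N r' \<le> epowr (F + N) r'" using r' by (intro epowr_mono) (auto simp: add_increasing)
      have "Fr \<le> epowr (F + N) r'" unfolding Fr_def using r' by (intro epowr_mono) auto
      then have "ennreal (1 / a) * Fr \<le> ennreal (1 / a) * epowr (F + N) r'" by (rule mult_left_mono) simp
      then have "Fr * ennreal (1 / a) \<le> 1 * (ennreal (1 / a) * epowr (F + N) r')" by (simp add: mult.commute)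
      also have "\<dots> \<le> ennreal A * (ennreal (1 / a) * epowr (F + N) r')"
        using A by (intro mult_right_mono) auto
      finally show "Fr * ennreal (1 / a) \<le> ennreal A * (ennreal (1 / a) * epowr (F + N) r')" .
    qed auto
    also have "\<dots> = ennreal (2 * K1 * A / a) * epowr (F + N) r'"
    proof -
      have "ennreal (2 * K1 * A / a) = ennreal (K1 * (2 * (A * (1 / a))))" by (simp add: mult_ac)
      also have "\<dots> = ennreal K1 * (ennreal 2 * (ennreal A * ennreal (1 / a)))"
        using K1 A a by (subst ennreal_mult, simp, simp, subst ennreal_mult, simp, simp, subst ennreal_mult) auto
      finally have e: "ennreal (2 * K1 * A / a) = ennreal K1 * (ennreal 2 * (ennreal A * ennreal (1 / a)))" .
      show ?thesis by (subst e) (simp only: ennreal_numeral mult_2 mult.assoc distrib_left distrib_right)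
    qed
    finally have "Lq_dtt I r (\<lambda>t. ennreal (t powr (\<epsilon> / d)) * \<phi> t) \<le> epowr (ennreal (2 * K1 * A / a) * epowr (F + N) r') (1 / r')"
      using False r' by (auto simp: Lq_dtt_def r'_def intro!: epowr_mono)
    also have "\<dots> = ennreal ((2 * K1 * A / a) powr (1 / r')) * (F + N)"
      using r' K1 A a by (subst epowr_mult) (auto simp: epowr_ennreal epowr_inverse)
    also have "(2 * K1 * A / a) powr (1 / r') = K * \<epsilon> powr (- enn2real (1 / r))"
    proof -
      have "2 * K1 * A / a = (2 * K1 * A * d / r') * \<epsilon> powr (-1)"
        using \<epsilon> d r' by (simp add: a_def powr_minus field_simps)
      then have "(2 * K1 * A / a) powr (1 / r') = K * (\<epsilon> powr (-1)) powr (1 / r')"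
        using K1 A d r' by (simp only: K_def powr_mult)
      also have "(\<epsilon> powr (-1)) powr (1 / r') = \<epsilon> powr (- (1 / r'))" by (subst powr_powr) simp
      finally show ?thesis using enn2real_one_divide[OF r False] by (simp add: r'_def)
    qed
    finally show "Lq_dtt I r (\<lambda>t. ennreal (t powr (\<epsilon> / d)) * \<phi> t)
        \<le> ennreal (K * \<epsilon> powr (- enn2real (1 / r))) * (F + Lq_dtt I r (\<lambda>u. ennreal (u powr (- (\<sigma> - \<epsilon>))) * \<omega> u))"
      by (simp add: N_def)
  qed
qed

text \<open>In effect the substitution u = t^{1/d}. The nonlinear change of variables is avoided:
  the value at v = t^{1/d} is dominated by an integral over [v, 2v], and Tonelli's theorem is
  applied to this window.\<close>

lemma Lq_dtt_pointwise_le: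
  assumes r: "0 < r" and d: "0 < d" and C: "0 < C"
  obtains K where "0 < K"
    "\<And>\<epsilon> \<phi> \<omega>. 0 < \<epsilon> \<Longrightarrow> \<epsilon> < \<sigma> \<Longrightarrow> mono \<omega> \<Longrightarrow>
      (\<And>t. 0 < t \<Longrightarrow> \<phi> t \<le> ennreal C * (ennreal (t powr (- \<sigma> / d)) * \<omega> (t powr (1 / d)))) \<Longrightarrow>
      Lq_dtt {0<..} r (\<lambda>t. ennreal (t powr (\<epsilon> / d)) * \<phi> t)
        \<le> ennreal K * Lq_dtt {0<..} r (\<lambda>u. ennreal (u powr (- (\<sigma> - \<epsilon>))) * \<omega> u)"
proof -
  have pointwise: "ennreal (t powr (\<epsilon> / d)) * \<phi> t
      \<le> ennreal C * (ennreal ((t powr (1 / d)) powr (- (\<sigma> - \<epsilon>))) * \<omega> (t powr (1 / d)))"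
    if \<phi>: "\<phi> t \<le> ennreal C * (ennreal (t powr (- \<sigma> / d)) * \<omega> (t powr (1 / d)))" and t: "0 < t"
    for \<epsilon> t and \<phi> \<omega> :: "real \<Rightarrow> ennreal"
  proof -
    have "ennreal (t powr (\<epsilon> / d)) * \<phi> t \<le> ennreal (t powr (\<epsilon> / d)) * (ennreal C * (ennreal (t powr (- \<sigma> / d)) * \<omega> (t powr (1 / d))))"
      by (intro mult_left_mono \<phi>) simp
    also have "\<dots> = ennreal C * ((ennreal (t powr (\<epsilon> / d)) * ennreal (t powr (- \<sigma> / d))) * \<omega> (t powr (1 / d)))"
      by (simp only: mult.left_commute mult.assoc)
    also have "ennreal (t powr (\<epsilon> / d)) * ennreal (t powr (- \<sigma> / d)) = ennreal ((t powr (1 / d)) powr (- (\<sigma> - \<epsilon>)))"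
      using t by (simp add: ennreal_mult[symmetric] powr_add[symmetric] powr_powr diff_divide_distrib)
    finally show ?thesis .
  qed
  show thesis
  proof (cases "r = \<infinity>")
    case True
    show thesis
    proof (rule that[OF C])
      fix \<epsilon> :: real and \<phi> \<omega> :: "real \<Rightarrow> ennreal"
      assume \<phi>: "\<And>t. 0 < t \<Longrightarrow> \<phi> t \<le> ennreal C * (ennreal (t powr (- \<sigma> / d)) * \<omega> (t powr (1 / d)))"
      have "ennreal (t powr (\<epsilon> / d)) * \<phi> t \<le> ennreal C * (SUP u\<in>{0<..}. ennreal (u powr (- (\<sigma> - \<epsilon>))) * \<omega> u)" if t: "0 < t" for t
      proof -
        note pointwise[where \<phi>=\<phi> and \<omega>=\<omega> and t=t and \<epsilon>=\<epsilon>, OF \<phi>[OF t] t]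
        also have "ennreal C * (ennreal ((t powr (1 / d)) powr (- (\<sigma> - \<epsilon>))) * \<omega> (t powr (1 / d)))
            \<le> ennreal C * (SUP u\<in>{0<..}. ennreal (u powr (- (\<sigma> - \<epsilon>))) * \<omega> u)"
          using t by (intro mult_left_mono SUP_upper) auto
        finally show ?thesis .
      qed
      then show "Lq_dtt {0<..} r (\<lambda>t. ennreal (t powr (\<epsilon> / d)) * \<phi> t)
        \<le> ennreal C * Lq_dtt {0<..} r (\<lambda>u. ennreal (u powr (- (\<sigma> - \<epsilon>))) * \<omega> u)"
        using True by (auto simp: Lq_dtt_def intro!: SUP_least)
    qed
  next
    case False
    define r' where "r' = enn2real r"
    have r': "0 < r'" using enn2real_pos r False by (simp add: r'_def)
    \<comment> \<open>The weight exponent \<sigma> - \<epsilon> is replaced by its upper bound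
      \<sigma>, which keeps the constant independent of \<epsilon>.\<close>
    define A where "A = 2 * 2 powr (\<sigma> * r')"
    have A: "0 < A" by (simp add: A_def)
    define K where "K = (C powr r' * A * 2 powr d) powr (1 / r')"
    have K: "0 < K" using C A by (simp add: K_def)
    show thesis
    proof (rule that[OF K])
      fix \<epsilon> :: real and \<phi> \<omega> :: "real \<Rightarrow> ennreal"
      assume \<epsilon>: "0 < \<epsilon>" "\<epsilon> < \<sigma>" and \<omega>: "mono \<omega>"
        and \<phi>: "\<And>t. 0 < t \<Longrightarrow> \<phi> t \<le> ennreal C * (ennreal (t powr (- \<sigma> / d)) * \<omega> (t powr (1 / d)))"
      define \<tau> where "\<tau> = \<sigma> - \<epsilon>"
      have \<tau>: "0 \<le> \<tau>" "\<tau> \<le> \<sigma>" using \<epsilon> by (auto simp: \<tau>_def)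
      have [measurable]: "\<omega> \<in> borel_measurable borel" by (rule borel_measurable_mono_ennreal[OF \<omega>])
      define G where "G u = epowr (ennreal (u powr (- \<tau>)) * \<omega> u) r' * ennreal (1 / u)" for u
      have G[measurable]: "G \<in> borel_measurable borel" unfolding G_def[abs_def] by measurable
      define T where "T t = (\<integral>\<^sup>+u\<in>{t powr (1 / d)..2 * t powr (1 / d)}. G u \<partial>lborel)" for t
      have T[measurable]: "T \<in> borel_measurable borel"
      proof -
        have "(\<lambda>(t, u). G u * (if t powr (1 / d) \<le> u \<and> u \<le> 2 * t powr (1 / d) then 1 else 0)) \<in> borel_measurable (borel \<Otimes>\<^sub>M lborel)"
          by measurable
        then have "(\<lambda>t. \<integral>\<^sup>+u. G u * (if t powr (1 / d) \<le> u \<and> u \<le> 2 * t powr (1 / d) then 1 else 0) \<partial>lborel) \<in> borel_measurable borel"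
          by (rule lborel.borel_measurable_nn_integral)
        also have "(\<lambda>t. \<integral>\<^sup>+u. G u * (if t powr (1 / d) \<le> u \<and> u \<le> 2 * t powr (1 / d) then 1 else 0) \<partial>lborel) = T"
          unfolding T_def by (intro ext nn_integral_cong) (auto simp: indicator_def)
        finally show ?thesis .
      qed
      have X: "epowr (ennreal (v powr (- \<tau>)) * \<omega> v) r' \<le> ennreal A * (\<integral>\<^sup>+u\<in>{v..2 * v}. G u \<partial>lborel)" if v: "0 < v" for v
      proof -
        have "epowr (ennreal (v powr (- \<tau>)) * \<omega> v) r' \<le> 2 * (\<integral>\<^sup>+u\<in>{v..2 * v}. ((ennreal (2 powr (\<sigma> * r')) * epowr (ennreal (u powr (- \<tau>)) * \<omega> u) r') * ennreal (1 / u)) \<partial>lborel)"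
        proof (rule le_integral_dtt[OF v order.refl])
          fix s assume s: "s \<in> {v..2 * v}"
          have "v powr (- \<tau>) \<le> 2 powr \<sigma> * s powr (- \<tau>)"
          proof -
            have "(2 * v) powr (- \<tau>) \<le> s powr (- \<tau>)" using s v \<tau> by (intro powr_mono2') auto
            then have "2 powr \<tau> * (2 * v) powr (- \<tau>) \<le> 2 powr \<tau> * s powr (- \<tau>)" by (intro mult_left_mono) auto
            moreover have "2 powr \<tau> * (2 * v) powr (- \<tau>) = v powr (- \<tau>)"
              using v by (simp add: powr_mult mult.assoc[symmetric] powr_add[symmetric])
            moreover have "2 powr \<tau> * s powr (- \<tau>) \<le> 2 powr \<sigma> * s powr (- \<tau>)"
              using \<tau> by (intro mult_right_mono powr_mono) auto
            ultimately show ?thesis by linarith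
          qed
          then have "ennreal (v powr (- \<tau>)) * \<omega> v \<le> ennreal (2 powr \<sigma> * s powr (- \<tau>)) * \<omega> s"
            using s monoD[OF \<omega>, of v s] by (intro mult_mono ennreal_leI) auto
          also have "\<dots> = ennreal (2 powr \<sigma>) * (ennreal (s powr (- \<tau>)) * \<omega> s)"
            by (simp add: ennreal_mult mult.assoc)
          finally have "epowr (ennreal (v powr (- \<tau>)) * \<omega> v) r' \<le> epowr (ennreal (2 powr \<sigma>) * (ennreal (s powr (- \<tau>)) * \<omega> s)) r'"
            using r' by (intro epowr_mono) auto
          also have "\<dots> = ennreal (2 powr (\<sigma> * r')) * epowr (ennreal (s powr (- \<tau>)) * \<omega> s) r'"
            by (subst epowr_mult[OF r']) (simp add: epowr_ennreal powr_powr)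
          finally show "epowr (ennreal (v powr (- \<tau>)) * \<omega> v) r' \<le> ennreal (2 powr (\<sigma> * r')) * epowr (ennreal (s powr (- \<tau>)) * \<omega> s) r'" .
        qed
        also have "(\<integral>\<^sup>+u\<in>{v..2 * v}. ((ennreal (2 powr (\<sigma> * r')) * epowr (ennreal (u powr (- \<tau>)) * \<omega> u) r') * ennreal (1 / u)) \<partial>lborel)
            = (\<integral>\<^sup>+u. ennreal (2 powr (\<sigma> * r')) * (G u * indicator {v..2 * v} u) \<partial>lborel)"
          by (intro nn_integral_cong) (simp add: G_def mult.assoc)
        also have "\<dots> = ennreal (2 powr (\<sigma> * r')) * (\<integral>\<^sup>+u\<in>{v..2 * v}. G u \<partial>lborel)"
          by (rule nn_integral_cmult) measurable
        also have "2 * (ennreal (2 powr (\<sigma> * r')) * (\<integral>\<^sup>+u\<in>{v..2 * v}. G u \<partial>lborel)) = ennreal A * (\<integral>\<^sup>+u\<in>{v..2 * v}. G u \<partial>lborel)"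
          unfolding A_def by (simp add: ennreal_mult mult.assoc)
        finally show ?thesis .
      qed
      have "(\<integral>\<^sup>+t\<in>{0<..}. (epowr (ennreal (t powr (\<epsilon> / d)) * \<phi> t) r' * ennreal (1 / t)) \<partial>lborel)
        \<le> (\<integral>\<^sup>+t. ennreal (C powr r' * A) * (ennreal (1 / t) * T t * indicator {0<..} t) \<partial>lborel)"
      proof (rule nn_integral_mono)
        fix t :: real
        show "epowr (ennreal (t powr (\<epsilon> / d)) * \<phi> t) r' * ennreal (1 / t) * indicator {0<..} t
          \<le> ennreal (C powr r' * A) * (ennreal (1 / t) * T t * indicator {0<..} t)"
        proof (cases "0 < t")
          case True
          have "epowr (ennreal (t powr (\<epsilon> / d)) * \<phi> t) r'
              \<le> epowr (ennreal C * (ennreal ((t powr (1 / d)) powr (- \<tau>)) * \<omega> (t powr (1 / d)))) r'"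
            unfolding \<tau>_def using r' by (intro epowr_mono pointwise[where \<phi>=\<phi> and \<omega>=\<omega>, OF \<phi>[OF True] True]) auto
          also have "\<dots> \<le> ennreal (C powr r') * (ennreal A * T t)"
            unfolding epowr_mult[OF r', of "ennreal C"] T_def
            using C X[of "t powr (1 / d)"] True by (auto simp: epowr_ennreal intro!: mult_left_mono)
          also have "\<dots> = ennreal (C powr r' * A) * T t" using A by (simp add: ennreal_mult mult.assoc)
          finally have "epowr (ennreal (t powr (\<epsilon> / d)) * \<phi> t) r' * ennreal (1 / t) \<le> ennreal (C powr r' * A) * T t * ennreal (1 / t)"
            by (rule mult_right_mono) simp
          then show ?thesis using True by (simp add: mult_ac)
        qed simp
      qed
      also have "\<dots> = ennreal (C powr r' * A) * (\<integral>\<^sup>+t\<in>{0<..}. (ennreal (1 / t) * T t) \<partial>lborel)"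
        by (rule nn_integral_cmult) measurable
      also have "\<dots> \<le> ennreal (C powr r' * A) * (ennreal (2 powr d) * (\<integral>\<^sup>+u\<in>{0<..}. G u \<partial>lborel))"
        unfolding T_def by (intro mult_left_mono integral_window_Tonelli G d) simp
      also have "\<dots> = ennreal (C powr r' * A * 2 powr d) * (\<integral>\<^sup>+u\<in>{0<..}. G u \<partial>lborel)"
        using A by (simp add: ennreal_mult mult.assoc)
      finally have "Lq_dtt {0<..} r (\<lambda>t. ennreal (t powr (\<epsilon> / d)) * \<phi> t) \<le> epowr (ennreal (C powr r' * A * 2 powr d) * (\<integral>\<^sup>+u\<in>{0<..}. G u \<partial>lborel)) (1 / r')"
        using False r' by (auto simp: Lq_dtt_def r'_def intro!: epowr_mono)
      also have "\<dots> = ennreal K * Lq_dtt {0<..} r (\<lambda>u. ennreal (u powr (- \<tau>)) * \<omega> u)"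
        using r' A False by (subst epowr_mult) (auto simp: epowr_ennreal K_def G_def Lq_dtt_def r'_def)
      finally show "Lq_dtt {0<..} r (\<lambda>t. ennreal (t powr (\<epsilon> / d)) * \<phi> t)
        \<le> ennreal K * Lq_dtt {0<..} r (\<lambda>u. ennreal (u powr (- (\<sigma> - \<epsilon>))) * \<omega> u)"
        by (simp add: \<tau>_def)
    qed
  qed
qed

section \<open>Estimates on the whole space\<close>

text \<open>Reduction to finite positive upper bounds, since the estimates on oscillation take a
  real constant S > 0. The slack e/C takes care of x = 0.\<close>

lemma ennreal_le_cmult_of_upper_bounds:
  fixes x y :: ennreal
  assumes C: "0 < C" and le: "\<And>s. 0 < s \<Longrightarrow> x \<le> ennreal s \<Longrightarrow> y \<le> ennreal (C * s)"
  shows "y \<le> ennreal C * x"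
proof (cases x)
  case (real z)
  have "y \<le> ennreal (C * z)"
  proof (rule ennreal_le_epsilon)
    fix e :: real assume e: "0 < e"
    have "y \<le> ennreal (C * (z + e / C))"
      using real e C by (intro le) (auto intro!: ennreal_leI add_nonneg_pos)
    also have "C * (z + e / C) = C * z + e" using C by (simp add: distrib_left)
    finally show "y \<le> ennreal (C * z) + ennreal e" using e C real by simp
  qed
  then show ?thesis using real C by (simp add: ennreal_mult)
next
  case top
  then show ?thesis using C by (simp add: ennreal_mult_top)
qed

lemma powr_inverse_DIM: "0 < t \<Longrightarrow> (t powr (1 / real DIM('a::euclidean_space))) ^ DIM('a) = t"
  by (simp add: powr_realpow[symmetric] powr_powr)

lemma ennreal_powr_mult_le:
  assumes u: "0 < u" and le: "ennreal (u powr (- \<sigma>)) * m \<le> ennreal s" and s: "0 \<le> s"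
  shows "m \<le> ennreal (s * u powr \<sigma>)"
proof -
  have "ennreal (u powr \<sigma>) * (ennreal (u powr (- \<sigma>)) * m) \<le> ennreal (u powr \<sigma>) * ennreal s"
    by (rule mult_left_mono[OF le]) simp
  moreover have "ennreal (u powr \<sigma>) * ennreal (u powr (- \<sigma>)) = 1"
    using u by (simp add: ennreal_mult[symmetric] powr_add[symmetric])
  ultimately have "m \<le> ennreal (u powr \<sigma>) * ennreal s" by (simp only: mult.assoc[symmetric] mult_1_left)
  then show ?thesis using s by (simp add: ennreal_mult mult.commute)
qed

text \<open>In the first bound a finite bound \<open>s\<close> of the supremum yields S = K s at all
  scales u \<ge> t^{1/d}. In the second, the modulus at the single scale v = t^{1/d} is propagated
  to all u \<ge> v by \<open>fdiff_bound_scale\<close>; for k = d/p the growth (2u/v)^k is absorbed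
  by the weight up to 2^k.\<close>

lemma rearrangement_sharp_le_SUP_modulus:
  assumes p: "1 < p" and q: "0 < q" and r: "0 < r" and k: "1 \<le> k"
  obtains C where "0 < C"
    "\<And>\<epsilon> (f::'a::euclidean_space \<Rightarrow> real) t. 0 < \<epsilon> \<Longrightarrow> \<epsilon> < real DIM('a) / p \<Longrightarrow>
      f \<in> hom_besov (real DIM('a) / p - \<epsilon>) r p q k \<Longrightarrow> 0 < t \<Longrightarrow>
      rearrangement UNIV (sharp UNIV f) t \<le> ennreal C *
        (SUP u\<in>{u\<in>{0<..}. t powr (1 / real DIM('a)) \<le> u}. ennreal (u powr (- (real DIM('a) / p))) * modulus UNIV {0<..} k p q f u)"
    "\<And>\<epsilon> (f::'a::euclidean_space \<Rightarrow> real) t. 0 < \<epsilon> \<Longrightarrow> \<epsilon> < real DIM('a) / p \<Longrightarrow> real k = real DIM('a) / p \<Longrightarrow>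
      f \<in> hom_besov (real DIM('a) / p - \<epsilon>) r p q k \<Longrightarrow> 0 < t \<Longrightarrow>
      rearrangement UNIV (sharp UNIV f) t \<le> ennreal C *
        (ennreal (t powr (- (real DIM('a) / p) / real DIM('a))) * modulus UNIV {0<..} k p q f (t powr (1 / real DIM('a))))"
proof -
  define d where "d = real DIM('a)"
  define \<sigma> where "\<sigma> = d / p"
  have d: "0 < d" by (simp add: d_def)
  obtain K where K: "0 < K" and bd:
    "\<And>(f::'a \<Rightarrow> real) \<Omega> I N u a L. f \<in> borel_measurable lebesgue \<Longrightarrow> \<Omega> \<in> sets borel \<Longrightarrow> 0 < N \<Longrightarrow>
      modulus \<Omega> I k p q f u \<le> ennreal N \<Longrightarrow> 0 < L \<Longrightarrow> cube a L \<subseteq> \<Omega> \<Longrightarrow> {0<..1 * L ^ DIM('a)} \<subseteq> I \<Longrightarrow>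
      fdiff_bound (cube a L) k p u (K * N) f"
    using fdiff_bound_of_modulus[OF p q, of 1 k, where 'a='a] by auto
  obtain C where C: "0 < C" and sharp:
    "\<And>(f::'a \<Rightarrow> real) t S. f \<in> borel_measurable lebesgue \<Longrightarrow>
      (\<And>a L. (\<integral>\<^sup>+x\<in>cube a L. ennreal \<bar>f x\<bar> \<partial>lebesgue) < \<infinity>) \<Longrightarrow> 0 < t \<Longrightarrow> 0 < S \<Longrightarrow>
      (\<And>u a L. t \<le> u \<Longrightarrow> 0 < L \<Longrightarrow> fdiff_bound (cube a L) k p u (S * u powr (real DIM('a) / p)) f) \<Longrightarrow>
      (\<lambda>n. mean_osc f (ccube n)) \<longlonglongrightarrow> 0 \<Longrightarrow>
      rearrangement UNIV (sharp UNIV f) (t ^ DIM('a)) \<le> ennreal (C * S)"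
    using rearrangement_sharp_UNIV[OF k less_imp_le[OF p], where 'a='a] by blast
  define C' where "C' = C * K * 2 ^ k"
  have C': "0 < C'" using C K by (simp add: C'_def)
  have CK: "C * K \<le> C'" using C K by (simp add: C'_def)
  have part1: "rearrangement UNIV (sharp UNIV f) t \<le> ennreal C' *
        (SUP u\<in>{u\<in>{0<..}. t powr (1 / d) \<le> u}. ennreal (u powr (- \<sigma>)) * modulus UNIV {0<..} k p q f u)"
    if \<epsilon>: "0 < \<epsilon>" "\<epsilon> < \<sigma>" and f: "f \<in> hom_besov (\<sigma> - \<epsilon>) r p q k" and t: "0 < t" for \<epsilon> t and f :: "'a \<Rightarrow> real"
  proof (rule ennreal_le_cmult_of_upper_bounds[OF C'])
    fix s :: real
    assume s: "0 < s" and le: "(SUP u\<in>{u\<in>{0<..}. t powr (1 / d) \<le> u}. ennreal (u powr (- \<sigma>)) * modulus UNIV {0<..} k p q f u) \<le> ennreal s"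
    note fm = hom_besov_locally_integrable[OF f]
    have lim: "(\<lambda>n. mean_osc f (ccube n)) \<longlonglongrightarrow> 0"
      using hom_besov_mean_osc_tendsto[OF p q r k, of \<epsilon> f] \<epsilon> f by (simp add: \<sigma>_def d_def)
    have v: "0 < t powr (1 / d)" using t by simp
    have "rearrangement UNIV (sharp UNIV f) ((t powr (1 / d)) ^ DIM('a)) \<le> ennreal (C * (K * s))"
    proof (rule sharp[OF fm v _ _ lim])
      fix u :: real and a :: 'a and L :: real assume u: "t powr (1 / d) \<le> u" and L: "0 < L"
      have u0: "0 < u" using u v by linarith
      have "ennreal (u powr (- \<sigma>)) * modulus UNIV {0<..} k p q f u \<le> ennreal s"
        using u u0 by (intro order_trans[OF SUP_upper le]) auto
      then have m: "modulus UNIV {0<..} k p q f u \<le> ennreal (s * u powr \<sigma>)"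
        using u0 s by (intro ennreal_powr_mult_le) auto
      have "fdiff_bound (cube a L) k p u (K * (s * u powr \<sigma>)) f"
        using s u0 L by (intro bd[OF fm(1) _ _ m]) auto
      then show "fdiff_bound (cube a L) k p u (K * s * u powr (real DIM('a) / p)) f"
        by (simp add: \<sigma>_def d_def mult.assoc)
    qed (use K s in simp)
    also have "\<dots> \<le> ennreal (C' * s)"
      using mult_right_mono[OF CK, of s] s by (intro ennreal_leI) (simp add: mult.assoc)
    finally show "rearrangement UNIV (sharp UNIV f) t \<le> ennreal (C' * s)"
      using powr_inverse_DIM[OF t, where 'a='a] by (simp add: d_def)
  qed
  have part2: "rearrangement UNIV (sharp UNIV f) t \<le> ennreal C' *
        (ennreal (t powr (- \<sigma> / d)) * modulus UNIV {0<..} k p q f (t powr (1 / d)))"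
    if \<epsilon>: "0 < \<epsilon>" "\<epsilon> < \<sigma>" and k\<sigma>: "real k = \<sigma>" and f: "f \<in> hom_besov (\<sigma> - \<epsilon>) r p q k" and t: "0 < t" for \<epsilon> t and f :: "'a \<Rightarrow> real"
  proof (rule ennreal_le_cmult_of_upper_bounds[OF C'])
    fix s :: real
    define v where "v = t powr (1 / d)"
    have v: "0 < v" using t by (simp add: v_def)
    have tv: "t powr (- \<sigma> / d) = v powr (- \<sigma>)" using t by (simp add: v_def powr_powr)
    assume s: "0 < s" and le: "ennreal (t powr (- \<sigma> / d)) * modulus UNIV {0<..} k p q f (t powr (1 / d)) \<le> ennreal s"
    note fm = hom_besov_locally_integrable[OF f]
    have lim: "(\<lambda>n. mean_osc f (ccube n)) \<longlonglongrightarrow> 0"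
      using hom_besov_mean_osc_tendsto[OF p q r k, of \<epsilon> f] \<epsilon> f by (simp add: \<sigma>_def d_def)
    have m: "modulus UNIV {0<..} k p q f v \<le> ennreal (s * v powr \<sigma>)"
      using le[unfolded tv] s v by (intro ennreal_powr_mult_le) (auto simp: v_def)
    have bdv: "fdiff_bound (cube a L) k p v (K * (s * v powr \<sigma>)) f" if "0 < L" for a L
      using s v that by (intro bd[OF fm(1) _ _ m]) auto
    have "rearrangement UNIV (sharp UNIV f) (v ^ DIM('a)) \<le> ennreal (C * (K * 2 ^ k * s))"
    proof (rule sharp[OF fm v _ _ lim])
      fix u :: real and a :: 'a and L :: real assume u: "v \<le> u" and L: "0 < L"
      have u0: "0 < u" using u v by linarith
      have "fdiff_bound (cube a L) k p u (K * (s * v powr \<sigma>) * (2 * u / v) ^ k) f"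
        using K s by (intro fdiff_bound_scale[OF fm(1) _ v u bdv L]) auto
      also have "K * (s * v powr \<sigma>) * (2 * u / v) ^ k = K * 2 ^ k * s * u powr \<sigma>"
        unfolding k\<sigma>[symmetric] using v u0 by (simp add: powr_realpow power_divide power_mult_distrib)
      finally show "fdiff_bound (cube a L) k p u (K * 2 ^ k * s * u powr (real DIM('a) / p)) f"
        by (simp add: \<sigma>_def d_def)
    qed (use K s in simp)
    then show "rearrangement UNIV (sharp UNIV f) t \<le> ennreal (C' * s)"
      using powr_inverse_DIM[OF t, where 'a='a] by (simp add: v_def d_def C'_def mult.assoc)
  qed
  show thesis
    by (rule that[OF C' part1[unfolded \<sigma>_def d_def] part2[unfolded \<sigma>_def d_def]])
qed

section \<open>Estimates on a cube\<close>

text \<open>A difference is a fixed combination of translates whose points stay in the convex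
  \<open>Q\<close>. On a cube this replaces the modulus for steps of length at least 1/2, whose
  windows leave the range (0,1).\<close>

lemma fdiff_bound_of_integral_bound:
  obtains B where "0 < B"
    "\<And>(f::'a::euclidean_space \<Rightarrow> real) Q W u. f \<in> borel_measurable lebesgue \<Longrightarrow> Q \<in> sets borel \<Longrightarrow> convex Q \<Longrightarrow> 0 \<le> W \<Longrightarrow>
      (\<And>E. E \<in> sets borel \<Longrightarrow> E \<subseteq> Q \<Longrightarrow> (\<integral>\<^sup>+x\<in>E. ennreal \<bar>f x\<bar> \<partial>lborel) \<le> ennreal (W * measure lborel E powr (1 - 1 / p))) \<Longrightarrow>
      fdiff_bound Q k p u (B * W) f"
proof -
  obtain c :: "nat \<Rightarrow> real" where
    c: "\<And>(f::'a \<Rightarrow> real) h x. (fdiff h ^^ k) f x = (\<Sum>j\<le>k. c j * f (x + real j *\<^sub>R h))"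
    using fdiff_funpow_expand[of k, where 'a='a] by blast
  define B where "B = 1 + (\<Sum>j\<le>k. \<bar>c j\<bar>)"
  have B: "0 < B" by (auto simp: B_def intro!: add_pos_nonneg sum_nonneg)
  have "fdiff_bound Q k p u (B * W) f"
    if f: "f \<in> borel_measurable lebesgue" and Q: "Q \<in> sets borel" "convex Q" and W: "0 \<le> W"
      and bd: "\<And>E. E \<in> sets borel \<Longrightarrow> E \<subseteq> Q \<Longrightarrow> (\<integral>\<^sup>+x\<in>E. ennreal \<bar>f x\<bar> \<partial>lborel) \<le> ennreal (W * measure lborel E powr (1 - 1 / p))"
    for f :: "'a \<Rightarrow> real" and Q W u
  proof -
    obtain g where gb: "g \<in> borel_measurable lborel" and ae: "AE x in lborel. f x = g x"
      using completion_ex_borel_measurable_real[OF f] by blast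
    have g[measurable]: "g \<in> borel_measurable borel" using gb by simp
    have "fdiff_bound Q k p u (B * W) g"
      unfolding fdiff_bound_def
    proof (intro allI impI)
      fix h :: 'a and E
      assume E: "E \<in> sets borel" "E \<subseteq> {x \<in> Q. x + real k *\<^sub>R h \<in> Q}"
      then have [measurable]: "E \<in> sets borel" by simp
      define M where "M = measure lborel E powr (1 - 1 / p)"
      have M: "0 \<le> M" by (simp add: M_def)
      have "(\<integral>\<^sup>+x\<in>E. ennreal \<bar>(fdiff h ^^ k) g x\<bar> \<partial>lborel)
          \<le> (\<integral>\<^sup>+x. (\<Sum>j\<le>k. ennreal \<bar>c j\<bar> * (ennreal \<bar>g (x + real j *\<^sub>R h)\<bar> * indicator E x)) \<partial>lborel)"
      proof (rule nn_integral_mono)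
        fix x
        have "ennreal \<bar>(fdiff h ^^ k) g x\<bar> \<le> ennreal (\<Sum>j\<le>k. \<bar>c j\<bar> * \<bar>g (x + real j *\<^sub>R h)\<bar>)"
          unfolding c abs_mult[symmetric] by (intro ennreal_leI sum_abs)
        also have "\<dots> = (\<Sum>j\<le>k. ennreal \<bar>c j\<bar> * ennreal \<bar>g (x + real j *\<^sub>R h)\<bar>)"
          by (simp add: ennreal_mult[symmetric])
        finally show "ennreal \<bar>(fdiff h ^^ k) g x\<bar> * indicator E x
            \<le> (\<Sum>j\<le>k. ennreal \<bar>c j\<bar> * (ennreal \<bar>g (x + real j *\<^sub>R h)\<bar> * indicator E x))"
          by (simp add: mult.assoc[symmetric] sum_distrib_right[symmetric] mult_right_mono del: sum_ennreal)
      qed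
      also have "\<dots> = (\<Sum>j\<le>k. ennreal \<bar>c j\<bar> * (\<integral>\<^sup>+x\<in>E. ennreal \<bar>g (x + real j *\<^sub>R h)\<bar> \<partial>lborel))"
        by (subst nn_integral_sum, measurable, subst nn_integral_cmult) measurable
      also have "\<dots> \<le> (\<Sum>j\<le>k. ennreal \<bar>c j\<bar> * ennreal (W * M))"
      proof (intro sum_mono mult_left_mono)
        fix j assume j: "j \<in> {..k}"
        define v where "v = real j *\<^sub>R h"
        have "(\<integral>\<^sup>+x\<in>E. ennreal \<bar>g (x + v)\<bar> \<partial>lborel) = (\<integral>\<^sup>+y\<in>{y. y - v \<in> E}. ennreal \<bar>g y\<bar> \<partial>lborel)"
          by (rule integral_translate(1)[of "\<lambda>y. ennreal \<bar>g y\<bar>"]) measurable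
        also have "\<dots> = (\<integral>\<^sup>+y\<in>{y. y - v \<in> E}. ennreal \<bar>f y\<bar> \<partial>lborel)"
          by (rule nn_integral_cong_AE) (use ae in \<open>eventually_elim, simp\<close>)
        also have "\<dots> \<le> ennreal (W * measure lborel {y. y - v \<in> E} powr (1 - 1 / p))"
        proof (rule bd)
          show "{y. y - v \<in> E} \<in> sets borel" by measurable
          show "{y. y - v \<in> E} \<subseteq> Q"
          proof
            fix y assume "y \<in> {y. y - v \<in> E}"
            then have "y - v \<in> Q" "y - v + real k *\<^sub>R h \<in> Q" using E by auto
            from segment_points_in[OF Q(2) this, of j] j show "y \<in> Q" by (simp add: v_def)
          qed
        qed
        also have "measure lborel {y. y - v \<in> E} = measure lborel E"
          by (rule integral_translate(2)[of "\<lambda>_. 0"]) auto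
        finally show "(\<integral>\<^sup>+x\<in>E. ennreal \<bar>g (x + real j *\<^sub>R h)\<bar> \<partial>lborel) \<le> ennreal (W * M)"
          by (simp add: v_def M_def)
      qed simp
      also have "\<dots> = ennreal ((\<Sum>j\<le>k. \<bar>c j\<bar>) * (W * M))"
        using W M by (simp add: ennreal_mult[symmetric] sum_distrib_right)
      also have "\<dots> \<le> ennreal (B * W * M)"
        using W M unfolding mult.assoc by (intro ennreal_leI mult_right_mono) (auto simp: B_def)
      finally show "(\<integral>\<^sup>+x\<in>E. ennreal \<bar>(fdiff h ^^ k) g x\<bar> \<partial>lborel) \<le> ennreal (B * W * measure lborel E powr (1 - 1 / p))"
        by (simp add: M_def)
    qed
    then show ?thesis
      by (rule fdiff_bound_AE_cong[OF _ Q(2)]) (use ae in \<open>eventually_elim, simp\<close>)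
  qed
  then show thesis by (rule that[OF B])
qed

lemma lorentz_norm_cong:
  assumes "\<And>x. x \<in> \<Omega> \<Longrightarrow> g x = h x"
  shows "lorentz_norm \<Omega> I p q g = lorentz_norm \<Omega> I p q h"
proof -
  have "{x\<in>\<Omega>. g x > l} = {x\<in>\<Omega>. h x > l}" for l using assms by auto
  then show ?thesis unfolding lorentz_norm_def rearrangement_def by presburger
qed

lemma modulus_cong:
  fixes f g :: "'a::euclidean_space \<Rightarrow> real"
  assumes \<Omega>: "convex \<Omega>" and eq: "\<And>x. x \<in> \<Omega> \<Longrightarrow> f x = g x"
  shows "modulus \<Omega> I k p q f t = modulus \<Omega> I k p q g t"
  unfolding modulus_def
proof (rule SUP_cong[OF refl], rule lorentz_norm_cong)
  fix h x assume "x \<in> {x. x \<in> \<Omega> \<and> x + real k *\<^sub>R h \<in> \<Omega>}"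
  then have "x + real j *\<^sub>R h \<in> \<Omega>" if "j \<le> k" for j
    using segment_points_in[OF \<Omega>, of x k h j] that by simp
  then have "(fdiff h ^^ k) f x = (fdiff h ^^ k) g x"
    by (rule fdiff_funpow_cong[OF eq])
  then show "ennreal \<bar>(fdiff h ^^ k) f x\<bar> = ennreal \<bar>(fdiff h ^^ k) g x\<bar>" by simp
qed

lemma sharp_cong:
  fixes f g :: "'a::euclidean_space \<Rightarrow> real"
  assumes eq: "\<And>x. x \<in> \<Omega> \<Longrightarrow> f x = g x"
  shows "sharp \<Omega> f x = sharp \<Omega> g x"
  unfolding sharp_eq
proof (rule SUP_cong[OF refl])
  fix Q assume "Q \<in> {Q \<in> cubes. x \<in> Q \<and> Q \<subseteq> \<Omega>}"
  then have Q: "\<And>y. y \<in> Q \<Longrightarrow> f y = g y" using eq by auto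
  have "set_lebesgue_integral lebesgue Q f = set_lebesgue_integral lebesgue Q g"
    unfolding set_lebesgue_integral_def
    by (rule Bochner_Integration.integral_cong[OF refl]) (auto simp: Q indicator_def)
  then have av: "average f Q = average g Q" by (simp add: average_def)
  show "mean_osc f Q = mean_osc g Q"
    unfolding mean_osc_def av by (intro arg_cong2[where f="(/)"] nn_integral_cong refl) (auto simp: Q indicator_def)
qed

text \<open>Small steps are controlled by the modulus, large ones by the Lorentz norm of
  \<open>f\<close>. The same norm bounds the oscillation on the whole cube, the term with which the
  iteration over growing cubes ends.\<close>

lemma rearrangement_sharp_cube_le:
  fixes a0 :: "'a::euclidean_space"
  assumes p: "1 < p" and q: "0 < q" and k: "1 \<le> k" and L: "0 < L"
  obtains C where "0 < C"
    "\<And>(f::'a \<Rightarrow> real) t. f \<in> borel_measurable (lebesgue_on (cube a0 L)) \<Longrightarrow> 0 < t \<Longrightarrow> t < 1 \<Longrightarrow>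
      rearrangement (cube a0 L) (sharp (cube a0 L) f) t \<le> ennreal C *
        ((SUP u\<in>{u\<in>{0<..<1/2}. t powr (1 / real DIM('a)) \<le> u}. ennreal (u powr (- (real DIM('a) / p))) * modulus (cube a0 L) {0<..<1} k p q f u)
          + lorentz_norm (cube a0 L) {0<..<1} p q (\<lambda>x. ennreal \<bar>f x\<bar>))"
proof -
  define d where "d = real DIM('a)"
  define \<sigma> where "\<sigma> = d / p"
  have \<sigma>: "0 \<le> \<sigma>" using p by (simp add: \<sigma>_def d_def)
  define Q where "Q = cube a0 L"
  have Qb: "Q \<in> sets borel" and Ql: "Q \<in> sets lebesgue" by (auto simp: Q_def)
  \<comment> \<open>The range (0,1) has to contain (0, c |E|] for all subsets \<open>E\<close> of
    the cube, hence c L^d < 1.\<close>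
  define c where "c = 1 / (1 + L ^ DIM('a))"
  have c: "0 < c" "c \<le> 1" "c * L ^ DIM('a) < 1" using L by (auto simp: c_def field_simps add_pos_pos)
  obtain K1 where K1: "0 < K1" and bd:
    "\<And>(f::'a \<Rightarrow> real) \<Omega> I N u a L. f \<in> borel_measurable lebesgue \<Longrightarrow> \<Omega> \<in> sets borel \<Longrightarrow> 0 < N \<Longrightarrow>
      modulus \<Omega> I k p q f u \<le> ennreal N \<Longrightarrow> 0 < L \<Longrightarrow> cube a L \<subseteq> \<Omega> \<Longrightarrow> {0<..c * L ^ DIM('a)} \<subseteq> I \<Longrightarrow>
      fdiff_bound (cube a L) k p u (K1 * N) f"
    using fdiff_bound_of_modulus[OF p q c(1,2), of k, where 'a='a] by blast
  obtain K2 where K2: "0 < K2" and int: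
    "\<And>(g::'a \<Rightarrow> real) \<Omega> I N E \<mu>. g \<in> borel_measurable lebesgue \<Longrightarrow> \<Omega> \<in> sets lebesgue \<Longrightarrow> 0 < N \<Longrightarrow>
      lorentz_norm \<Omega> I p q (\<lambda>x. ennreal \<bar>g x\<bar>) \<le> ennreal N \<Longrightarrow> E \<in> sets lebesgue \<Longrightarrow> E \<subseteq> \<Omega> \<Longrightarrow>
      emeasure lebesgue E = ennreal \<mu> \<Longrightarrow> 0 \<le> \<mu> \<Longrightarrow> {0<..c * \<mu>} \<subseteq> I \<Longrightarrow>
      (\<integral>\<^sup>+x\<in>E. ennreal \<bar>g x\<bar> \<partial>lebesgue) \<le> ennreal (K2 * N * \<mu> powr (1 - 1 / p))"
    using integral_le_lorentz[OF p q c(1,2), where 'a='a] by blast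
  obtain B where B: "0 < B" and triv:
    "\<And>(f::'a \<Rightarrow> real) Q W u. f \<in> borel_measurable lebesgue \<Longrightarrow> Q \<in> sets borel \<Longrightarrow> convex Q \<Longrightarrow> 0 \<le> W \<Longrightarrow>
      (\<And>E. E \<in> sets borel \<Longrightarrow> E \<subseteq> Q \<Longrightarrow> (\<integral>\<^sup>+x\<in>E. ennreal \<bar>f x\<bar> \<partial>lborel) \<le> ennreal (W * measure lborel E powr (1 - 1 / p))) \<Longrightarrow>
      fdiff_bound Q k p u (B * W) f"
    using fdiff_bound_of_integral_bound[of p k, where 'a='a] by blast
  obtain C0 where C0: "0 < C0" and sharp:
    "\<And>(f::'a \<Rightarrow> real) a0 L t S. f \<in> borel_measurable lebesgue \<Longrightarrow>
      (\<integral>\<^sup>+x\<in>cube a0 L. ennreal \<bar>f x\<bar> \<partial>lebesgue) < \<infinity> \<Longrightarrow> 0 < t \<Longrightarrow> t \<le> L \<Longrightarrow> 0 < S \<Longrightarrow>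
      (\<And>u. t \<le> u \<Longrightarrow> u \<le> L \<Longrightarrow> fdiff_bound (cube a0 L) k p u (S * u powr (real DIM('a) / p)) f) \<Longrightarrow>
      \<exists>Y\<in>sets borel. {x \<in> cube a0 L. ennreal C0 * (ennreal S + mean_osc f (cube a0 L)) < sharp (cube a0 L) f x} \<subseteq> Y
        \<and> emeasure lborel Y \<le> ennreal (t ^ DIM('a))"
    using sharp_level_set_lebesgue[OF k less_imp_le[OF p], where 'a='a] by blast
  define K3 where "K3 = 2 * K2 * (L ^ DIM('a)) powr (1 - 1 / p) / L ^ DIM('a)"
  \<comment> \<open>One summand for each range of steps; 2^\<sigma> enters because (2u)^\<sigma>
    \<ge> 1 for u \<ge> 1/2.\<close>
  define K4 where "K4 = K1 + B * K2 * 2 powr \<sigma>"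
  have K3: "0 < K3" using K2 L by (simp add: K3_def)
  have K4: "0 < K4" using K1 K2 B by (simp add: K4_def add_pos_pos)
  define C where "C = C0 * (K4 + K3)"
  have C: "0 < C" using C0 K3 K4 by (simp add: C_def)
  have main: "rearrangement Q (sharp Q f) t \<le> ennreal C *
        ((SUP u\<in>{u\<in>{0<..<1/2}. t powr (1 / d) \<le> u}. ennreal (u powr (- \<sigma>)) * modulus Q {0<..<1} k p q f u)
          + lorentz_norm Q {0<..<1} p q (\<lambda>x. ennreal \<bar>f x\<bar>))"
    if f: "f \<in> borel_measurable (lebesgue_on Q)" and t: "0 < t" "t < 1" for f :: "'a \<Rightarrow> real" and t
  proof (rule ennreal_le_cmult_of_upper_bounds[OF C])
    fix s :: real
    assume s: "0 < s" and le: "(SUP u\<in>{u\<in>{0<..<1/2}. t powr (1 / d) \<le> u}. ennreal (u powr (- \<sigma>)) * modulus Q {0<..<1} k p q f u)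
          + lorentz_norm Q {0<..<1} p q (\<lambda>x. ennreal \<bar>f x\<bar>) \<le> ennreal s"
    \<comment> \<open>Extension by zero makes the function measurable on the whole space.
      Differences and oscillations are taken inside the cube, where nothing changes.\<close>
    define f0 where "f0 x = (if x \<in> Q then f x else 0)" for x
    have f0: "f0 \<in> borel_measurable lebesgue"
      unfolding f0_def[abs_def] using f Ql by (subst borel_measurable_if) auto
    have f0_eq: "f x = f0 x" if "x \<in> Q" for x using that by (simp add: f0_def)
    define v where "v = t powr (1 / d)"
    have v: "0 < v" using t by (simp add: v_def)
    have vt: "v ^ DIM('a) = t" using powr_inverse_DIM[OF t(1), where 'a='a] by (simp add: v_def d_def)
    have lor: "lorentz_norm Q {0<..<1} p q (\<lambda>x. ennreal \<bar>f0 x\<bar>) \<le> ennreal s"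
    proof -
      have "lorentz_norm Q {0<..<1} p q (\<lambda>x. ennreal \<bar>f0 x\<bar>) = lorentz_norm Q {0<..<1} p q (\<lambda>x. ennreal \<bar>f x\<bar>)"
        by (rule lorentz_norm_cong) (simp add: f0_eq)
      also have "\<dots> \<le> ennreal s" using le by (rule order_trans[rotated]) (simp add: add_increasing)
      finally show ?thesis .
    qed
    have mod: "modulus Q {0<..<1} k p q f0 u \<le> ennreal (s * u powr \<sigma>)" if u: "v \<le> u" "u < 1 / 2" for u
    proof -
      have u0: "0 < u" using u v by linarith
      have "ennreal (u powr (- \<sigma>)) * modulus Q {0<..<1} k p q f u
          \<le> (SUP u\<in>{u\<in>{0<..<1/2}. t powr (1 / d) \<le> u}. ennreal (u powr (- \<sigma>)) * modulus Q {0<..<1} k p q f u)"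
        using u u0 by (intro SUP_upper) (auto simp: v_def)
      also have "\<dots> \<le> ennreal s" using le by (rule order_trans[rotated]) (simp add: add_increasing2)
      finally have "modulus Q {0<..<1} k p q f u \<le> ennreal (s * u powr \<sigma>)"
        using u0 s by (intro ennreal_powr_mult_le) auto
      moreover have "modulus Q {0<..<1} k p q f u = modulus Q {0<..<1} k p q f0 u"
        by (rule modulus_cong) (simp_all add: f0_eq convex_cube Q_def[symmetric], simp add: Q_def convex_cube)
      ultimately show ?thesis by simp
    qed
    have f0_int: "(\<integral>\<^sup>+x\<in>E. ennreal \<bar>f0 x\<bar> \<partial>lborel) \<le> ennreal (K2 * s * measure lborel E powr (1 - 1 / p))"
      if E: "E \<in> sets borel" "E \<subseteq> Q" for E
    proof -
      have eE: "emeasure lborel E \<le> ennreal (L ^ DIM('a))"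
        using emeasure_mono[of E Q lborel] E L Qb by (auto simp: emeasure_cube Q_def)
      then have fin: "emeasure lborel E = ennreal (measure lborel E)"
        by (intro emeasure_eq_ennreal_measure) (auto simp: top_unique)
      have mE: "measure lborel E \<le> L ^ DIM('a)" using eE fin L by simp
      have "c * measure lborel E \<le> c * L ^ DIM('a)" using c mE by (intro mult_left_mono) auto
      then have "c * measure lborel E < 1" using c by linarith
      then have "(\<integral>\<^sup>+x\<in>E. ennreal \<bar>f0 x\<bar> \<partial>lebesgue) \<le> ennreal (K2 * s * measure lborel E powr (1 - 1 / p))"
        using E fin by (intro int[OF f0 Ql s lor]) auto
      then show ?thesis by (simp add: nn_integral_completion)
    qed
    have Qm: "measure lborel Q = L ^ DIM('a)" using L by (simp add: Q_def measure_cube)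
    have Qint: "(\<integral>\<^sup>+x\<in>Q. ennreal \<bar>f0 x\<bar> \<partial>lborel) \<le> ennreal (K2 * s * (L ^ DIM('a)) powr (1 - 1 / p))"
      using f0_int[OF Qb order.refl] by (simp add: Qm)
    then have f0_fin: "(\<integral>\<^sup>+x\<in>cube a0 L. ennreal \<bar>f0 x\<bar> \<partial>lebesgue) < \<infinity>"
      by (auto simp: nn_integral_completion Q_def intro: le_less_trans)
    have osc: "mean_osc f0 Q \<le> ennreal (K3 * s)"
    proof -
      have "mean_osc f0 Q \<le> 2 * (\<integral>\<^sup>+y\<in>Q. ennreal \<bar>f0 y - 0\<bar> \<partial>lborel) / ennreal (L ^ DIM('a))"
        unfolding Q_def by (rule mean_osc_le_lebesgue[OF f0 f0_fin L])
      also have "\<dots> \<le> 2 * ennreal (K2 * s * (L ^ DIM('a)) powr (1 - 1 / p)) / ennreal (L ^ DIM('a))"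
        using Qint by (intro divide_right_mono_ennreal mult_left_mono) auto
      also have "2 * ennreal (K2 * s * (L ^ DIM('a)) powr (1 - 1 / p)) = ennreal (2 * (K2 * s * (L ^ DIM('a)) powr (1 - 1 / p)))"
        using K2 s by (subst ennreal_mult) auto
      also have "\<dots> / ennreal (L ^ DIM('a)) = ennreal (2 * (K2 * s * (L ^ DIM('a)) powr (1 - 1 / p)) / L ^ DIM('a))"
        using K2 s L by (intro divide_ennreal) auto
      also have "2 * (K2 * s * (L ^ DIM('a)) powr (1 - 1 / p)) / L ^ DIM('a) = K3 * s" by (simp add: K3_def)
      finally show ?thesis .
    qed
    have sharp_eq0: "sharp Q f = sharp Q f0" by (rule ext, rule sharp_cong) (rule f0_eq)
    show "rearrangement Q (sharp Q f) t \<le> ennreal (C * s)"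
    proof (cases "v \<le> L")
      case True
      have "\<exists>Y\<in>sets borel. {x \<in> cube a0 L. ennreal C0 * (ennreal (K4 * s) + mean_osc f0 (cube a0 L)) < sharp (cube a0 L) f0 x} \<subseteq> Y
        \<and> emeasure lborel Y \<le> ennreal (v ^ DIM('a))"
      proof (rule sharp[OF f0 f0_fin v True])
        fix u assume u: "v \<le> u" "u \<le> L"
        have u0: "0 < u" using u v by linarith
        show "fdiff_bound (cube a0 L) k p u (K4 * s * u powr (real DIM('a) / p)) f0"
        proof (cases "u < 1 / 2")
          case True
          have "fdiff_bound (cube a0 L) k p u (K1 * (s * u powr \<sigma>)) f0"
            using s u0 L c by (intro bd[OF f0 Qb _ mod[OF u(1) True]]) (auto simp: Q_def)
          then show ?thesis
          proof (rule fdiff_bound_mono)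
            have "K1 * (s * u powr \<sigma>) \<le> K4 * (s * u powr \<sigma>)"
              using s B K2 by (intro mult_right_mono) (auto simp: K4_def)
            then show "K1 * (s * u powr \<sigma>) \<le> K4 * s * u powr (real DIM('a) / p)" by (simp add: \<sigma>_def d_def mult.assoc)
          qed
        next
          case False
          have "fdiff_bound Q k p u (B * (K2 * s)) f0"
            using K2 s convex_cube by (intro triv[OF f0 Qb _ _ f0_int]) (auto simp: Q_def)
          then have "fdiff_bound (cube a0 L) k p u (B * (K2 * s)) f0" by (simp add: Q_def)
          then show ?thesis
          proof (rule fdiff_bound_mono)
            have "1 \<le> (2 * u) powr \<sigma>" using False \<sigma> by (intro ge_one_powr_ge_zero) auto
            then have "B * (K2 * s) * 1 \<le> B * (K2 * s) * (2 * u) powr \<sigma>"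
              using B K2 s by (intro mult_left_mono) auto
            also have "\<dots> = (B * K2 * 2 powr \<sigma>) * (s * u powr \<sigma>)" using u0 by (simp add: powr_mult)
            also have "\<dots> \<le> K4 * (s * u powr \<sigma>)"
              using s K1 by (intro mult_right_mono) (auto simp: K4_def)
            finally show "B * (K2 * s) \<le> K4 * s * u powr (real DIM('a) / p)" by (simp add: \<sigma>_def d_def mult.assoc)
          qed
        qed
      qed (use K4 s in simp)
      then obtain Y where Y: "Y \<in> sets borel" "emeasure lborel Y \<le> ennreal t"
        "{x \<in> Q. ennreal C0 * (ennreal (K4 * s) + mean_osc f0 Q) < sharp Q f0 x} \<subseteq> Y"
        unfolding vt Q_def by blast
      have "rearrangement Q (sharp Q f0) t \<le> ennreal C0 * (ennreal (K4 * s) + mean_osc f0 Q)"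
        by (rule rearrangement_le_cover[OF Y(3,1,2)])
      also have "\<dots> \<le> ennreal C0 * (ennreal (K4 * s) + ennreal (K3 * s))"
        by (intro mult_left_mono add_left_mono osc) simp
      also have "\<dots> = ennreal (C0 * (K4 * s + K3 * s))"
        using C0 K3 K4 s by (simp add: ennreal_mult)
      also have "C0 * (K4 * s + K3 * s) = C * s" by (simp add: C_def algebra_simps)
      finally show ?thesis by (simp add: sharp_eq0)
    next
      \<comment> \<open>The cube itself has measure at most \<open>t\<close> and serves as the
        cover, so the rearrangement vanishes.\<close>
      case False
      then have "L ^ DIM('a) \<le> v ^ DIM('a)" using L by (intro power_mono) auto
      then have "emeasure lborel Q \<le> ennreal t"
        using L by (simp add: Q_def emeasure_cube vt ennreal_leI)
      then have "rearrangement Q (sharp Q f) t \<le> 0"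
        by (intro rearrangement_le_cover[of _ _ _ Q] Qb) auto
      then show ?thesis by (rule order_trans) simp
    qed
  qed
  show thesis
    by (rule that[OF C main[unfolded \<sigma>_def d_def Q_def]])
qed

lemma mono_modulus: "mono (modulus \<Omega> I k p q f)"
  by (intro monoI modulus_mono)

theorem corollary3p7:
  fixes p :: real and q r :: ennreal and k :: nat and d :: real
  defines "d \<equiv> real DIM('a::euclidean_space)"
  assumes "1 < p" and "0 < q" and "0 < r" and "1 \<le> k"
  shows
    "(real k > d / p \<longrightarrow>
       (\<exists>C\<^sub>0>0. \<forall>\<^sub>F \<epsilon> in at_right 0.
          \<forall>f \<in> (hom_besov (d / p - \<epsilon>) r p q k :: ('a \<Rightarrow> real) set).
            lorentz_norm UNIV {0<..} (d / \<epsilon>) r (sharp UNIV f)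
              \<le> ennreal (C\<^sub>0 * \<epsilon> powr (- enn2real (1 / r))) * hom_besov_norm (d / p - \<epsilon>) r p q k f)) \<and>
     (real k = d / p \<longrightarrow>
       (\<exists>C\<^sub>1>0. \<forall>\<^sub>F \<epsilon> in at_right 0.
          \<forall>f \<in> (hom_besov (d / p - \<epsilon>) r p q k :: ('a \<Rightarrow> real) set).
            lorentz_norm UNIV {0<..} (d / \<epsilon>) r (sharp UNIV f)
              \<le> ennreal C\<^sub>1 * hom_besov_norm (d / p - \<epsilon>) r p q k f)) \<and>
     (real k \<ge> d / p \<longrightarrow>
       (\<forall>Q\<^sub>0 \<in> (cubes :: 'a set set). \<exists>C\<^sub>2>0. \<forall>\<^sub>F \<epsilon> in at_right 0.
          \<forall>f \<in> besov Q\<^sub>0 (d / p - \<epsilon>) r p q k.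
            lorentz_norm Q\<^sub>0 {0<..<1} (d / \<epsilon>) r (sharp Q\<^sub>0 f)
              \<le> ennreal (C\<^sub>2 * \<epsilon> powr (- enn2real (1 / r))) * besov_norm Q\<^sub>0 (d / p - \<epsilon>) r p q k f))"
proof -
  have d: "0 < d" by (simp add: d_def)
  have \<sigma>: "0 < d / p" using d \<open>1 < p\<close> by simp
  \<comment> \<open>Sufficiently small means \<epsilon> < d/p, so that the smoothness index stays
    positive.\<close>
  have ev: "\<forall>\<^sub>F \<epsilon> in at_right 0. P \<epsilon>" if "\<And>\<epsilon>. 0 < \<epsilon> \<Longrightarrow> \<epsilon> < d / p \<Longrightarrow> P \<epsilon>" for P :: "real \<Rightarrow> bool"
    using eventually_at_rightI[of 0 "d / p" P] that \<sigma> by auto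
  obtain C where C: "0 < C" and
    sup: "\<And>\<epsilon> (f::'a \<Rightarrow> real) t. 0 < \<epsilon> \<Longrightarrow> \<epsilon> < real DIM('a) / p \<Longrightarrow>
      f \<in> hom_besov (real DIM('a) / p - \<epsilon>) r p q k \<Longrightarrow> 0 < t \<Longrightarrow>
      rearrangement UNIV (sharp UNIV f) t \<le> ennreal C *
        (SUP u\<in>{u\<in>{0<..}. t powr (1 / real DIM('a)) \<le> u}. ennreal (u powr (- (real DIM('a) / p))) * modulus UNIV {0<..} k p q f u)" and
    point: "\<And>\<epsilon> (f::'a \<Rightarrow> real) t. 0 < \<epsilon> \<Longrightarrow> \<epsilon> < real DIM('a) / p \<Longrightarrow> real k = real DIM('a) / p \<Longrightarrow>
      f \<in> hom_besov (real DIM('a) / p - \<epsilon>) r p q k \<Longrightarrow> 0 < t \<Longrightarrow>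
      rearrangement UNIV (sharp UNIV f) t \<le> ennreal C *
        (ennreal (t powr (- (real DIM('a) / p) / real DIM('a))) * modulus UNIV {0<..} k p q f (t powr (1 / real DIM('a))))"
    using rearrangement_sharp_le_SUP_modulus[OF \<open>1 < p\<close> \<open>0 < q\<close> \<open>0 < r\<close> \<open>1 \<le> k\<close>, where 'a='a] by blast
  have part1: "\<exists>C\<^sub>0>0. \<forall>\<^sub>F \<epsilon> in at_right 0.
          \<forall>f \<in> (hom_besov (d / p - \<epsilon>) r p q k :: ('a \<Rightarrow> real) set).
            lorentz_norm UNIV {0<..} (d / \<epsilon>) r (sharp UNIV f)
              \<le> ennreal (C\<^sub>0 * \<epsilon> powr (- enn2real (1 / r))) * hom_besov_norm (d / p - \<epsilon>) r p q k f"
  proof -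
    \<comment> \<open>The constant is fixed before \<epsilon> and \<open>f\<close> are introduced,
      which gives the required uniformity.\<close>
    obtain K where K: "0 < K" and le: "\<And>\<epsilon> \<phi> \<omega> F I J. 0 < \<epsilon> \<Longrightarrow> mono \<omega> \<Longrightarrow> I \<in> sets borel \<Longrightarrow> I \<subseteq> {0<..} \<Longrightarrow> J \<subseteq> I \<Longrightarrow>
      (\<And>u. u \<in> J \<Longrightarrow> {u..2 * u} \<subseteq> I) \<Longrightarrow> F = 0 \<or> I = {0<..<1} \<Longrightarrow>
      (\<And>t. t \<in> I \<Longrightarrow> \<phi> t \<le> ennreal C * ((SUP u\<in>{u\<in>J. t powr (1 / d) \<le> u}. ennreal (u powr (- (d / p))) * \<omega> u) + F)) \<Longrightarrow>
      Lq_dtt I r (\<lambda>t. ennreal (t powr (\<epsilon> / d)) * \<phi> t)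
        \<le> ennreal (K * \<epsilon> powr (- enn2real (1 / r))) * (F + Lq_dtt I r (\<lambda>u. ennreal (u powr (- (d / p - \<epsilon>))) * \<omega> u))"
      using Lq_dtt_sup_le[OF \<open>0 < r\<close> d less_imp_le[OF \<sigma>] C] by blast
    show ?thesis
    proof (intro exI[of _ K] conjI K ev ballI)
      fix \<epsilon> and f :: "'a \<Rightarrow> real"
      assume \<epsilon>: "0 < \<epsilon>" "\<epsilon> < d / p" and f: "f \<in> hom_besov (d / p - \<epsilon>) r p q k"
      have "lorentz_norm UNIV {0<..} (d / \<epsilon>) r (sharp UNIV f) =
          Lq_dtt {0<..} r (\<lambda>t. ennreal (t powr (\<epsilon> / d)) * rearrangement UNIV (sharp UNIV f) t)"
        by (simp add: lorentz_norm_def)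
      also have "\<dots> \<le> ennreal (K * \<epsilon> powr (- enn2real (1 / r))) * (0 + Lq_dtt {0<..} r (\<lambda>u. ennreal (u powr (- (d / p - \<epsilon>))) * modulus UNIV {0<..} k p q f u))"
      proof (rule le[OF \<epsilon>(1) mono_modulus, where J="{0<..}"])
        fix t :: real assume "t \<in> {0<..}"
        then have "0 < t" by simp
        from sup[OF \<epsilon>(1) \<epsilon>(2)[unfolded d_def] f[unfolded d_def] this]
        show "rearrangement UNIV (sharp UNIV f) t \<le> ennreal C *
          ((SUP u\<in>{u\<in>{0<..}. t powr (1 / d) \<le> u}. ennreal (u powr (- (d / p))) * modulus UNIV {0<..} k p q f u) + 0)"
          by (simp add: d_def)
      qed auto
      finally show "lorentz_norm UNIV {0<..} (d / \<epsilon>) r (sharp UNIV f)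
              \<le> ennreal (K * \<epsilon> powr (- enn2real (1 / r))) * hom_besov_norm (d / p - \<epsilon>) r p q k f"
        by (simp add: hom_besov_norm_def)
    qed
  qed
  have part2: "\<exists>C\<^sub>1>0. \<forall>\<^sub>F \<epsilon> in at_right 0.
          \<forall>f \<in> (hom_besov (d / p - \<epsilon>) r p q k :: ('a \<Rightarrow> real) set).
            lorentz_norm UNIV {0<..} (d / \<epsilon>) r (sharp UNIV f)
              \<le> ennreal C\<^sub>1 * hom_besov_norm (d / p - \<epsilon>) r p q k f" if k\<sigma>: "real k = d / p"
  proof -
    obtain K where K: "0 < K" and le: "\<And>\<epsilon> \<phi> \<omega>. 0 < \<epsilon> \<Longrightarrow> \<epsilon> < d / p \<Longrightarrow> mono \<omega> \<Longrightarrow>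
      (\<And>t. 0 < t \<Longrightarrow> \<phi> t \<le> ennreal C * (ennreal (t powr (- (d / p) / d)) * \<omega> (t powr (1 / d)))) \<Longrightarrow>
      Lq_dtt {0<..} r (\<lambda>t. ennreal (t powr (\<epsilon> / d)) * \<phi> t)
        \<le> ennreal K * Lq_dtt {0<..} r (\<lambda>u. ennreal (u powr (- (d / p - \<epsilon>))) * \<omega> u)"
      using Lq_dtt_pointwise_le[OF \<open>0 < r\<close> d C, of "d / p"] by blast
    show ?thesis
    proof (intro exI[of _ K] conjI K ev ballI)
      fix \<epsilon> and f :: "'a \<Rightarrow> real"
      assume \<epsilon>: "0 < \<epsilon>" "\<epsilon> < d / p" and f: "f \<in> hom_besov (d / p - \<epsilon>) r p q k"
      have "lorentz_norm UNIV {0<..} (d / \<epsilon>) r (sharp UNIV f) =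
          Lq_dtt {0<..} r (\<lambda>t. ennreal (t powr (\<epsilon> / d)) * rearrangement UNIV (sharp UNIV f) t)"
        by (simp add: lorentz_norm_def)
      also have "\<dots> \<le> ennreal K * Lq_dtt {0<..} r (\<lambda>u. ennreal (u powr (- (d / p - \<epsilon>))) * modulus UNIV {0<..} k p q f u)"
        using point[OF \<epsilon>(1) \<epsilon>(2)[unfolded d_def] k\<sigma>[unfolded d_def] f[unfolded d_def]]
        by (intro le \<epsilon> mono_modulus) (simp add: d_def)
      finally show "lorentz_norm UNIV {0<..} (d / \<epsilon>) r (sharp UNIV f)
              \<le> ennreal K * hom_besov_norm (d / p - \<epsilon>) r p q k f"
        by (simp add: hom_besov_norm_def)
    qed
  qed
  have part3: "\<exists>C\<^sub>2>0. \<forall>\<^sub>F \<epsilon> in at_right 0.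
          \<forall>f \<in> besov Q\<^sub>0 (d / p - \<epsilon>) r p q k.
            lorentz_norm Q\<^sub>0 {0<..<1} (d / \<epsilon>) r (sharp Q\<^sub>0 f)
              \<le> ennreal (C\<^sub>2 * \<epsilon> powr (- enn2real (1 / r))) * besov_norm Q\<^sub>0 (d / p - \<epsilon>) r p q k f"
    if Q0: "Q\<^sub>0 \<in> cubes" for Q\<^sub>0 :: "'a set"
  proof -
    obtain a0 L where Q: "Q\<^sub>0 = cube a0 L" and L: "0 < L" using Q0 by (auto simp: cubes_eq)
    obtain C where C: "0 < C" and cube_le:
      "\<And>(f::'a \<Rightarrow> real) t. f \<in> borel_measurable (lebesgue_on (cube a0 L)) \<Longrightarrow> 0 < t \<Longrightarrow> t < 1 \<Longrightarrow>
      rearrangement (cube a0 L) (sharp (cube a0 L) f) t \<le> ennreal C *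
        ((SUP u\<in>{u\<in>{0<..<1/2}. t powr (1 / real DIM('a)) \<le> u}. ennreal (u powr (- (real DIM('a) / p))) * modulus (cube a0 L) {0<..<1} k p q f u)
          + lorentz_norm (cube a0 L) {0<..<1} p q (\<lambda>x. ennreal \<bar>f x\<bar>))"
      using rearrangement_sharp_cube_le[OF \<open>1 < p\<close> \<open>0 < q\<close> \<open>1 \<le> k\<close> L, of a0] by blast
    obtain K where K: "0 < K" and le: "\<And>\<epsilon> \<phi> \<omega> F I J. 0 < \<epsilon> \<Longrightarrow> mono \<omega> \<Longrightarrow> I \<in> sets borel \<Longrightarrow> I \<subseteq> {0<..} \<Longrightarrow> J \<subseteq> I \<Longrightarrow>
      (\<And>u. u \<in> J \<Longrightarrow> {u..2 * u} \<subseteq> I) \<Longrightarrow> F = 0 \<or> I = {0<..<1} \<Longrightarrow>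
      (\<And>t. t \<in> I \<Longrightarrow> \<phi> t \<le> ennreal C * ((SUP u\<in>{u\<in>J. t powr (1 / d) \<le> u}. ennreal (u powr (- (d / p))) * \<omega> u) + F)) \<Longrightarrow>
      Lq_dtt I r (\<lambda>t. ennreal (t powr (\<epsilon> / d)) * \<phi> t)
        \<le> ennreal (K * \<epsilon> powr (- enn2real (1 / r))) * (F + Lq_dtt I r (\<lambda>u. ennreal (u powr (- (d / p - \<epsilon>))) * \<omega> u))"
      using Lq_dtt_sup_le[OF \<open>0 < r\<close> d less_imp_le[OF \<sigma>] C] by blast
    show ?thesis
    proof (intro exI[of _ K] conjI K ev ballI)
      fix \<epsilon> and f :: "'a \<Rightarrow> real"
      assume \<epsilon>: "0 < \<epsilon>" "\<epsilon> < d / p" and f: "f \<in> besov Q\<^sub>0 (d / p - \<epsilon>) r p q k"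
      have fm: "f \<in> borel_measurable (lebesgue_on (cube a0 L))" using f by (simp add: besov_def Q)
      have "lorentz_norm Q\<^sub>0 {0<..<1} (d / \<epsilon>) r (sharp Q\<^sub>0 f) =
          Lq_dtt {0<..<1} r (\<lambda>t. ennreal (t powr (\<epsilon> / d)) * rearrangement Q\<^sub>0 (sharp Q\<^sub>0 f) t)"
        by (simp add: lorentz_norm_def)
      \<comment> \<open>The set \<open>J\<close> is (0, 1/2) because the window [u, 2u] then lies in
        (0,1); \<open>F\<close> is the Lorentz norm of \<open>f\<close>.\<close>
      also have "\<dots> \<le> ennreal (K * \<epsilon> powr (- enn2real (1 / r))) *
          (lorentz_norm Q\<^sub>0 {0<..<1} p q (\<lambda>x. ennreal \<bar>f x\<bar>) +
           Lq_dtt {0<..<1} r (\<lambda>u. ennreal (u powr (- (d / p - \<epsilon>))) * modulus Q\<^sub>0 {0<..<1} k p q f u))"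
        using cube_le[OF fm] unfolding Q
        by (intro le[OF \<epsilon>(1) mono_modulus, where J="{0<..<1/2}"]) (auto simp: d_def)
      finally show "lorentz_norm Q\<^sub>0 {0<..<1} (d / \<epsilon>) r (sharp Q\<^sub>0 f)
              \<le> ennreal (K * \<epsilon> powr (- enn2real (1 / r))) * besov_norm Q\<^sub>0 (d / p - \<epsilon>) r p q k f"
        by (simp add: besov_norm_def)
    qed
  qed
  show ?thesis using part1 part2 part3 by blast
qed

end
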